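(* Let $X$ be a metrizable space and let $Y$ be a perfectly normal space. Let $D(X)$ be either $C(X)$ or $C^*(X)$, and, independently, let $D(Y)$ be either $C(Y)$ or $C^*(Y)$. Suppose that $T: D_p(X)\to D_p(Y)$ is a uniformly continuous inversely bounded surjection. Then: (i) if $X$ is countable-dimensional, then $Y$ is countable-dimensional; and if $X$ is strongly countable-dimensional, then $Y$ is strongly countable-dimensional; (ii) if $X$ is zero-dimensional, then $Y$ is zero-dimensional.
   Context: All spaces are Tychonoff. For a Tychonoff space $X$, $C(X)$ is the linear space of all continuous real-valued functions on $X$, and $C^*(X)\subset C(X)$ is the subspace of bounded functions. $D_p(X)$ denotes $D(X)$ endowed with the topology of pointwise convergence. The choices for $D(X)$ and $D(Y)$ are independent, so all four combinations are covered. A map $T: D_p(X)\to D_p(Y)$ (not necessarily linear) is uniformly continuous if for every neighborhood $U$ of the zero function in $D_p(Y)$ there is a neighborhood $V$ of the zero function in $D_p(X)$ such that $f,g\in D_p(X)$ and $f-g\in V$ imply $T(f)-T(g)\in U$. $\|f\|$ denotes the supremum norm of a bounded function $f$. A sequence $\{g_n: n\in\mathbb N\}$ of bounded continuous functions is norm bounded if there is $M>0$ with $\|g_n\|\le M$ for all $n$. A map $T: D(X)\to D(Y)$ is inversely bounded if for every norm bounded sequence $\{g_n\}\subset C^*(Y)$ there is a norm bounded sequence $\{f_n\}\subset C^*(X)$ with $T(f_n)=g_n$ for each $n\in\mathbb N$. Dimension means covering dimension: for a Tychonoff space $X$ and an integer $n\ge 0$, $\dim X\le n$ if every finite functionally open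 cover of $X$ has a finite functionally open refinement of order $\le n$ (i.e. every point lies in at most $n+1$ members; functionally open sets are cozero sets). $X$ is finite-dimensional if $\dim X\le n$ for some $n$, and zero-dimensional if $\dim X\le 0$. A normal space $X$ is countable-dimensional (respectively, strongly countable-dimensional) if $X$ can be represented as a countable union of normal finite-dimensional subspaces (respectively, of closed finite-dimensional subspaces). *)

theory Defs
  imports "HOL-Analysis.Analysis"
begin

text \<open>
  The library's \<open>normal_space\<close> and \<open>completely_regular_space\<close> carry no separation axiom, so
  the standing convention that all spaces are Tychonoff has to be stated explicitly.
\<close>

definition tychonoff_space :: "'a topology \<Rightarrow> bool" where
  "tychonoff_space X \<longleftrightarrow> completely_regular_space X \<and> Hausdorff_space X"

definition perfectly_normal_space :: "'a topology \<Rightarrow> bool" where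
  "perfectly_normal_space X \<longleftrightarrow>
     normal_space X \<and> Hausdorff_space X \<and> (\<forall>S. closedin X S \<longrightarrow> gdelta_in X S)"

text \<open>
  Real functions on a space are total HOL functions that take the value \<open>undefined\<close> outside
  the carrier (\<open>extensional\<close>), so that equality in HOL is equality on the carrier. This is also
  the representation that \<open>powertop_real\<close> uses for its points; the constant zero and
  differences therefore have to be restricted to the carrier.
\<close>

definition cont_funs :: "'a topology \<Rightarrow> ('a \<Rightarrow> real) set" where
  "cont_funs X = {f \<in> extensional (topspace X). continuous_map X euclideanreal f}"

definition bdd_cont_funs :: "'a topology \<Rightarrow> ('a \<Rightarrow> real) set" where
  "bdd_cont_funs X = {f \<in> cont_funs X. bounded (f ` topspace X)}"

definition pointwise_topology :: "'a topology \<Rightarrow> ('a \<Rightarrow> real) set \<Rightarrow> ('a \<Rightarrow> real) topology" where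
  "pointwise_topology X D = subtopology (powertop_real (topspace X)) D"

definition zero_fun :: "'a topology \<Rightarrow> 'a \<Rightarrow> real" where
  "zero_fun X = (\<lambda>x\<in>topspace X. 0)"

definition diff_fun :: "'a topology \<Rightarrow> ('a \<Rightarrow> real) \<Rightarrow> ('a \<Rightarrow> real) \<Rightarrow> 'a \<Rightarrow> real" where
  "diff_fun X f g = (\<lambda>x\<in>topspace X. f x - g x)"

definition uniformly_continuous_p ::
  "'a topology \<Rightarrow> ('a \<Rightarrow> real) set \<Rightarrow> 'b topology \<Rightarrow> ('b \<Rightarrow> real) set \<Rightarrow>
   (('a \<Rightarrow> real) \<Rightarrow> 'b \<Rightarrow> real) \<Rightarrow> bool" where
  "uniformly_continuous_p X DX Y DY T \<longleftrightarrow>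
     T \<in> DX \<rightarrow> DY \<and>
     (\<forall>U. openin (pointwise_topology Y DY) U \<and> zero_fun Y \<in> U \<longrightarrow>
        (\<exists>V. openin (pointwise_topology X DX) V \<and> zero_fun X \<in> V \<and>
           (\<forall>f\<in>DX. \<forall>g\<in>DX. diff_fun X f g \<in> V \<longrightarrow> diff_fun Y (T f) (T g) \<in> U)))"

text \<open>
  Inserting \<open>0\<close> changes nothing on a nonempty space; it makes the norm \<open>0\<close> on the empty space,
  where the real \<open>Sup\<close> would be unspecified.
\<close>

definition sup_norm :: "'a topology \<Rightarrow> ('a \<Rightarrow> real) \<Rightarrow> real" where
  "sup_norm X f = Sup (insert 0 ((\<lambda>x. \<bar>f x\<bar>) ` topspace X))"

definition norm_bounded_seq :: "'a topology \<Rightarrow> (nat \<Rightarrow> 'a \<Rightarrow> real) \<Rightarrow> bool" where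
  "norm_bounded_seq X g \<longleftrightarrow>
     range g \<subseteq> bdd_cont_funs X \<and> (\<exists>M>0. \<forall>n. sup_norm X (g n) \<le> M)"

definition inversely_bounded ::
  "'a topology \<Rightarrow> ('a \<Rightarrow> real) set \<Rightarrow> 'b topology \<Rightarrow> ('b \<Rightarrow> real) set \<Rightarrow>
   (('a \<Rightarrow> real) \<Rightarrow> 'b \<Rightarrow> real) \<Rightarrow> bool" where
  "inversely_bounded X DX Y DY T \<longleftrightarrow>
     T \<in> DX \<rightarrow> DY \<and>
     (\<forall>g. norm_bounded_seq Y g \<longrightarrow> (\<exists>f. norm_bounded_seq X f \<and> (\<forall>n. T (f n) = g n)))"

definition functionally_open :: "'a topology \<Rightarrow> 'a set \<Rightarrow> bool" where
  "functionally_open X U \<longleftrightarrow>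
     (\<exists>f. continuous_map X euclideanreal f \<and> U = {x \<in> topspace X. f x \<noteq> 0})"

definition finite_functionally_open_cover :: "'a topology \<Rightarrow> 'a set set \<Rightarrow> bool" where
  "finite_functionally_open_cover X \<U> \<longleftrightarrow>
     finite \<U> \<and> (\<forall>U\<in>\<U>. functionally_open X U) \<and> \<Union>\<U> = topspace X"

definition covering_dim_le :: "'a topology \<Rightarrow> nat \<Rightarrow> bool" where
  "covering_dim_le X n \<longleftrightarrow>
     (\<forall>\<U>. finite_functionally_open_cover X \<U> \<longrightarrow>
        (\<exists>\<V>. finite_functionally_open_cover X \<V> \<and>
             (\<forall>V\<in>\<V>. \<exists>U\<in>\<U>. V \<subseteq> U) \<and>
             (\<forall>x\<in>topspace X. card {V\<in>\<V>. x \<in> V} \<le> n + 1)))"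

definition finite_dimensional_space :: "'a topology \<Rightarrow> bool" where
  "finite_dimensional_space X \<longleftrightarrow> (\<exists>n. covering_dim_le X n)"

definition zero_dimensional_space :: "'a topology \<Rightarrow> bool" where
  "zero_dimensional_space X \<longleftrightarrow> covering_dim_le X 0"

definition countable_dimensional_space :: "'a topology \<Rightarrow> bool" where
  "countable_dimensional_space X \<longleftrightarrow>
     normal_space X \<and>
     (\<exists>\<A>. countable \<A> \<and> \<Union>\<A> = topspace X \<and>
        (\<forall>A\<in>\<A>. normal_space (subtopology X A) \<and> finite_dimensional_space (subtopology X A)))"

definition strongly_countable_dimensional_space :: "'a topology \<Rightarrow> bool" where
  "strongly_countable_dimensional_space X \<longleftrightarrow>
     normal_space X \<and>
     (\<exists>\<A>. countable \<A> \<and> \<Union>\<A> = topspace X \<and>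
        (\<forall>A\<in>\<A>. closedin X A \<and> finite_dimensional_space (subtopology X A)))"

end

theory Submission
  imports Defs
begin

text \<open>
  By inverse boundedness \<open>T\<close> may be restricted to bounded functions. Let \<open>\<beta>X\<close> be the closure of the
  point evaluations, and for finite \<open>K \<subseteq> \<beta>X\<close> write \<open>a(y, K)\<close> for the supremum of
  \<open>\<bar>T f y - T g y\<bar>\<close> over all \<open>f\<close>, \<open>g\<close> with \<open>\<bar>\<xi> f - \<xi> g\<bar> < 1\<close> on \<open>K\<close>. Uniform continuity gives for
  every \<open>y\<close> a finite set \<open>K \<subseteq> X\<close> with \<open>a(y, K)\<close> finite, interpolation gives
  \<open>a(y, K \<inter> L) \<le> a(y, K) + a(y, L)\<close>, and compactness of \<open>\<beta>X\<close> makes the set \<open>M(p, n)\<close> of all \<open>y\<close>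
  with \<open>a(y, K) \<le> p\<close> for some \<open>K\<close> of size at most \<open>n\<close> closed. On the F-sigma set
  \<open>M(p, n + 1) - M(2 p, n)\<close> the set \<open>K\<close> is therefore unique and depends continuously on \<open>y\<close>; these
  sets cover \<open>Y\<close>.

  Inverse boundedness makes this dependence light: if a continuous \<open>h\<close> from \<open>Y\<close> to \<open>[0, 1]\<close> took all
  values on the points \<open>y\<close> with \<open>K(y)\<close> near a given finite set, one could lift a norm bounded
  sequence of functions of \<open>h\<close> that are more than \<open>p\<close> apart at some such \<open>y\<close>, whereas by the
  pigeonhole principle two of the lifts differ by less than \<open>1\<close> near that set. Hence \<open>h\<close> omits a value there and
  splits the piece into clopen parts. Pulling back small covers of \<open>X\<close> of order \<open>d + 1\<close> thus bounds the
  order of refinements of arbitrary covers of the pieces of \<open>Y\<close>, by \<open>1\<close> in case \<open>d = 0\<close>.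
\<close>

subsection \<open>Perfectly normal spaces\<close>

text \<open>The finite sets that control \<open>T\<close> live in the compactification because
  supports of points converging in \<open>Y\<close> may escape from \<open>X\<close>; intersecting
  with a support inside \<open>X\<close> later brings the minimal ones back to \<open>X\<close>. As
  \<open>T\<close> is not linear, a bound \<open>p\<close> is carried along, and intersecting two
  supports with bound \<open>p\<close> costs a factor 2; hence M(2 p, n) is removed and not M(p, n).

  Norm bounded preimages give one bound for all lifts of a steepening sequence of functions of
  \<open>h\<close>. This bound and the size of the supports determine how many lifts the pigeonhole
  argument needs, so finitely many lifts are fixed before the cover of \<open>X\<close> is chosen,
  and it only has to be fine for these.

  The argument makes \<open>h\<close> omit a value strictly between 0 and 1, so it handles covers
  that come with a closed shrinking. A cover of a piece may have none that is closed in
  \<open>Y\<close>; slicing the piece into overlapping shells doubles the order. For finite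
  dimension this is harmless, but it would spoil dimension 0, which is therefore treated through
  closed pieces and clopen separation.\<close>

lemma openin_less:
  assumes "continuous_map X euclideanreal f" "continuous_map X euclideanreal g"
  shows "openin X {x \<in> topspace X. f x < g x}"
proof -
  have "openin X {x \<in> topspace X. g x - f x \<in> {0<..}}"
    by (rule openin_continuous_map_preimage[OF continuous_map_diff[OF assms(2,1)]]) auto
  then show ?thesis by simp
qed

lemma closedin_le:
  assumes "continuous_map X euclideanreal f" "continuous_map X euclideanreal g"
  shows "closedin X {x \<in> topspace X. f x \<le> g x}"
proof -
  have "closedin X {x \<in> topspace X. g x - f x \<in> {0..}}"
    by (rule closedin_continuous_map_preimage[OF continuous_map_diff[OF assms(2,1)]]) auto
  then show ?thesis by simp
qed

lemma bdd_cont_funs_iff: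
  "f \<in> bdd_cont_funs X \<longleftrightarrow> f \<in> extensional (topspace X) \<and> continuous_map X euclideanreal f \<and>
     (\<exists>M. \<forall>x\<in>topspace X. \<bar>f x\<bar> \<le> M)"
  by (auto simp: bdd_cont_funs_def cont_funs_def bounded_iff)

lemma continuous_map_restrict_topspace:
  "continuous_map X Y f \<Longrightarrow> continuous_map X Y (restrict f (topspace X))"
  by (erule continuous_map_eq) auto

lemma restrict_in_bdd_cont_funs:
  assumes "continuous_map X euclideanreal f" "\<And>x. x \<in> topspace X \<Longrightarrow> \<bar>f x\<bar> \<le> M"
  shows "restrict f (topspace X) \<in> bdd_cont_funs X"
  unfolding bdd_cont_funs_iff using assms continuous_map_restrict_topspace by fastforce

text \<open>The closed complement \<open>C\<close> is the intersection of the \<open>G n\<close>; a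
  weighted sum of Urysohn functions that vanish on \<open>C\<close> and equal 1 off
  \<open>G n\<close> vanishes exactly on \<open>C\<close>.\<close>

lemma perfectly_normal_space_cozero:
  assumes X: "perfectly_normal_space X" and U: "openin X U"
  obtains f where "continuous_map X euclideanreal f" "\<And>x. x \<in> topspace X \<Longrightarrow> 0 \<le> f x \<and> f x \<le> 1"
    "U = {x \<in> topspace X. 0 < f x}"
proof -
  define C where "C = topspace X - U"
  have C: "closedin X C" using U by (auto simp: C_def)
  then have "gdelta_in X C" using X by (auto simp: perfectly_normal_space_def)
  then obtain G :: "nat \<Rightarrow> _" where G: "\<And>n. openin X (G n)" "\<Inter>(range G) = C"
    unfolding gdelta_in_descending by blast
  have "\<exists>f. continuous_map X (top_of_set {0..1::real}) f \<and> f ` C \<subseteq> {0} \<and> f ` (topspace X - G n) \<subseteq> {1}" for n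
  proof -
    have "disjnt C (topspace X - G n)" using G by (auto simp: disjnt_def)
    moreover have "closedin X (topspace X - G n)" using G by auto
    moreover have "normal_space X" using X by (auto simp: perfectly_normal_space_def)
    ultimately show ?thesis using Urysohn_lemma[of X C "topspace X - G n" 0 1] C by (metis zero_le_one)
  qed
  then obtain F where F: "\<And>n. continuous_map X (top_of_set {0..1::real}) (F n)"
      "\<And>n. F n ` C \<subseteq> {0}" "\<And>n. F n ` (topspace X - G n) \<subseteq> {1}"
    by metis
  have Fc: "continuous_map X euclideanreal (F n)" for n
    using F(1) continuous_map_in_subtopology by blast
  have Fb: "0 \<le> F n x \<and> F n x \<le> 1" if "x \<in> topspace X" for n x
    using F(1)[of n] that by (auto simp: continuous_map_in_subtopology)
  define g where "g = (\<lambda>n x. (1/2)^Suc n * F n x)"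
  define f where "f = (\<lambda>x. \<Sum>n. g n x)"
  have gb: "0 \<le> g n x \<and> g n x \<le> (1/2)^Suc n" if "x \<in> topspace X" for n x
    using Fb[OF that, of n] by (auto simp: g_def field_simps)
  have half: "(\<lambda>n. (1/2)^Suc n) sums (1::real)" by (rule power_half_series)
  have sg: "summable (\<lambda>n. g n x)" if "x \<in> topspace X" for x
    by (rule summable_comparison_test'[OF sums_summable[OF half], of 0]) (use gb[OF that] in auto)
  have "uniform_limit (topspace X) (\<lambda>n x. \<Sum>i<n. g i x) (\<lambda>x. suminf (\<lambda>i. g i x)) sequentially"
    by (rule Weierstrass_m_test[OF _ sums_summable[OF half]]) (use gb in auto)
  then have unif: "uniform_limit (topspace X) (\<lambda>n x. \<Sum>i<n. g i x) f sequentially"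
    by (simp add: f_def)
  have "continuous_map X euclideanreal f"
  proof -
    have "continuous_map X (Met_TC.mtopology :: real topology) f"
    proof (rule Met_TC.continuous_map_uniform_limit[where F = sequentially and f = "\<lambda>n x. \<Sum>i<n. g i x"])
      show "\<forall>\<^sub>F n in sequentially. continuous_map X (Met_TC.mtopology :: real topology) (\<lambda>x. \<Sum>i<n. g i x)"
        unfolding g_def by (intro always_eventually) (auto intro!: continuous_intros Fc)
      show "\<forall>\<^sub>F n in sequentially. \<forall>x\<in>topspace X. f x \<in> UNIV \<and> dist (\<Sum>i<n. g i x) (f x) < e"
        if "0 < e" for e
        using uniform_limitD[OF unif that] by simp
    qed simp
    then show ?thesis by simp
  qed
  moreover have f01: "0 \<le> f x \<and> f x \<le> 1" if "x \<in> topspace X" for x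
  proof
    show "0 \<le> f x" unfolding f_def by (rule suminf_nonneg[OF sg[OF that]]) (use gb[OF that] in auto)
    have "f x \<le> (\<Sum>n. (1/2)^Suc n)" unfolding f_def
      by (rule suminf_le[OF _ sg[OF that] sums_summable[OF half]]) (use gb[OF that] in auto)
    then show "f x \<le> 1" using sums_unique[OF half] by simp
  qed
  moreover have "U = {x \<in> topspace X. 0 < f x}"
  proof -
    have "x \<in> C \<longleftrightarrow> f x = 0" if "x \<in> topspace X" for x
    proof -
      have "f x = 0 \<longleftrightarrow> (\<forall>n. g n x = 0)" unfolding f_def
        by (rule suminf_eq_zero_iff[OF sg[OF that]]) (use gb[OF that] in auto)
      also have "\<dots> \<longleftrightarrow> (\<forall>n. F n x = 0)" by (simp add: g_def)
      also have "\<dots> \<longleftrightarrow> x \<in> C"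
      proof
        assume *: "\<forall>n. F n x = 0"
        have "x \<in> G n" for n
        proof (rule ccontr)
          assume "x \<notin> G n"
          then have "F n x = 1" using F(3)[of n] that by blast
          with * show False by simp
        qed
        then show "x \<in> C" using G by blast
      qed (use F(2) in blast)
      finally show ?thesis by simp
    qed
    moreover have "f x \<noteq> 0 \<longleftrightarrow> 0 < f x" if "x \<in> topspace X" for x using f01[OF that] by auto
    ultimately show ?thesis using openin_subset[OF U] unfolding C_def by blast
  qed
  ultimately show thesis using that by blast
qed

lemma metrizable_imp_perfectly_normal_space:
  "metrizable_space X \<Longrightarrow> perfectly_normal_space X"
  by (simp add: perfectly_normal_space_def metrizable_imp_normal_space
      metrizable_imp_Hausdorff_space closed_imp_gdelta_in)

text \<open>The function lives on all of \<open>X\<close> although \<open>A\<close> is arbitrary: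
  normality and order estimates on subspaces come from comparing such global functions.\<close>

lemma perfectly_normal_space_relative_cozero:
  assumes "perfectly_normal_space X" and "openin (subtopology X A) U"
  obtains f where "continuous_map X euclideanreal f"
    "\<And>x. x \<in> topspace X \<Longrightarrow> 0 \<le> f x \<and> f x \<le> 1" "U = {x \<in> topspace X \<inter> A. 0 < f x}"
proof -
  obtain W where "openin X W" "U = W \<inter> A" using assms(2) by (auto simp: openin_subtopology)
  obtain f where "continuous_map X euclideanreal f" "\<And>x. x \<in> topspace X \<Longrightarrow> 0 \<le> f x \<and> f x \<le> 1"
    "W = {x \<in> topspace X. 0 < f x}"
    using perfectly_normal_space_cozero[OF assms(1) \<open>openin X W\<close>] by blast
  then show thesis using \<open>U = W \<inter> A\<close> by (intro that[of f]) auto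
qed

lemma functionally_open_subtopology:
  assumes "perfectly_normal_space X"
  shows "functionally_open (subtopology X A) U \<longleftrightarrow> openin (subtopology X A) U"
proof
  assume "functionally_open (subtopology X A) U"
  then obtain f where f: "continuous_map (subtopology X A) euclideanreal f"
     "U = {x \<in> topspace (subtopology X A). f x \<noteq> 0}"
    by (auto simp: functionally_open_def)
  have "openin (subtopology X A) {x \<in> topspace (subtopology X A). f x \<in> - {0}}"
    by (rule openin_continuous_map_preimage[OF f(1)]) auto
  then show "openin (subtopology X A) U" by (simp add: f(2))
next
  assume "openin (subtopology X A) U"
  from perfectly_normal_space_relative_cozero[OF assms this]
  obtain f where f: "continuous_map X euclideanreal f"
    "\<And>x. x \<in> topspace X \<Longrightarrow> 0 \<le> f x \<and> f x \<le> 1" "U = {x \<in> topspace X \<inter> A. 0 < f x}" by blast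
  then have "U = {x \<in> topspace (subtopology X A). f x \<noteq> 0}" by force
  then show "functionally_open (subtopology X A) U"
    unfolding functionally_open_def using f(1) continuous_map_from_subtopology by blast
qed

text \<open>If \<open>s\<close> and \<open>t\<close> have the complements of \<open>S\<close> and
  \<open>T\<close> in the subspace as positivity sets, then \<open>s\<close> vanishes on
  \<open>S\<close>, where \<open>t\<close> is positive, and conversely on \<open>T\<close>; so
  \<open>s < t\<close> and \<open>t < s\<close> separate them.\<close>

lemma perfectly_normal_space_imp_normal_subtopology:
  assumes "perfectly_normal_space X"
  shows "normal_space (subtopology X A)"
  unfolding normal_space_def
proof (intro allI impI)
  fix S T assume ST: "closedin (subtopology X A) S \<and> closedin (subtopology X A) T \<and> disjnt S T"
  let ?Z = "subtopology X A"
  have S: "openin ?Z (topspace ?Z - S)" and T: "openin ?Z (topspace ?Z - T)"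
    using ST by (auto intro: openin_diff simp del: topspace_subtopology)
  obtain s where s: "continuous_map X euclideanreal s" "\<And>x. x \<in> topspace X \<Longrightarrow> 0 \<le> s x \<and> s x \<le> 1"
      "topspace ?Z - S = {x \<in> topspace X \<inter> A. 0 < s x}"
    using perfectly_normal_space_relative_cozero[OF assms S] by blast
  obtain t where t: "continuous_map X euclideanreal t" "\<And>x. x \<in> topspace X \<Longrightarrow> 0 \<le> t x \<and> t x \<le> 1"
      "topspace ?Z - T = {x \<in> topspace X \<inter> A. 0 < t x}"
    using perfectly_normal_space_relative_cozero[OF assms T] by blast
  have sub: "S \<subseteq> topspace ?Z" "T \<subseteq> topspace ?Z" using ST closedin_subset by blast+
  let ?U = "{x \<in> topspace ?Z. s x < t x}" and ?V = "{x \<in> topspace ?Z. t x < s x}"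
  have "openin ?Z ?U" "openin ?Z ?V"
    by (intro openin_less continuous_map_from_subtopology s t)+
  moreover have "S \<subseteq> ?U"
  proof
    fix x assume x: "x \<in> S"
    then have "x \<in> topspace ?Z - T" using ST sub by (auto simp: disjnt_def)
    then have "0 < t x" using t(3) by blast
    moreover have "\<not> 0 < s x" using s(3) x sub by auto
    ultimately show "x \<in> ?U" using x sub by auto
  qed
  moreover have "T \<subseteq> ?V"
  proof
    fix x assume x: "x \<in> T"
    then have "x \<in> topspace ?Z - S" using ST sub by (auto simp: disjnt_def)
    then have "0 < s x" using s(3) by blast
    moreover have "\<not> 0 < t x" using t(3) x sub by auto
    ultimately show "x \<in> ?V" using x sub by auto
  qed
  moreover have "disjnt ?U ?V" by (auto simp: disjnt_def)
  ultimately show "\<exists>U V. openin ?Z U \<and> openin ?Z V \<and> S \<subseteq> U \<and> T \<subseteq> V \<and> disjnt U V" by blast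
qed

subsection \<open>Covering dimension of subspaces of perfectly normal spaces\<close>

text \<open>The order of an indexed family is estimated by counting indices; members that coincide
  only lower the count.\<close>

lemma card_family_le:
  assumes "finite I"
  shows "card {V \<in> W ` I. x \<in> V} \<le> card {i \<in> I. x \<in> W i}"
proof -
  have "{V \<in> W ` I. x \<in> V} = W ` {i \<in> I. x \<in> W i}" by auto
  then show ?thesis using assms by (simp add: card_image_le)
qed

lemma covering_dim_leI:
  assumes Y: "perfectly_normal_space Y" and A: "A \<subseteq> topspace Y"
    and ref: "\<And>\<U>. finite \<U> \<Longrightarrow> \<forall>U\<in>\<U>. openin Y U \<Longrightarrow> A \<subseteq> \<Union>\<U> \<Longrightarrow>
       \<exists>\<V>. finite \<V> \<and> (\<forall>V\<in>\<V>. openin (subtopology Y A) V \<and> (\<exists>U\<in>\<U>. V \<subseteq> U)) \<and> A \<subseteq> \<Union>\<V> \<and>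
           (\<forall>x\<in>A. card {V\<in>\<V>. x \<in> V} \<le> d + 1)"
  shows "covering_dim_le (subtopology Y A) d"
  unfolding covering_dim_le_def
proof (intro allI impI)
  fix \<U> assume U: "finite_functionally_open_cover (subtopology Y A) \<U>"
  have topA: "topspace (subtopology Y A) = A" using A by auto
  have "\<forall>U\<in>\<U>. \<exists>G. openin Y G \<and> U = G \<inter> A"
    using U by (simp add: finite_functionally_open_cover_def functionally_open_subtopology[OF Y] openin_subtopology)
  then obtain G where G: "\<And>U. U \<in> \<U> \<Longrightarrow> openin Y (G U) \<and> U = G U \<inter> A" by metis
  have fin: "finite \<U>" and cov: "\<Union>\<U> = A"
    using U topA by (auto simp: finite_functionally_open_cover_def)
  have covG: "A \<subseteq> \<Union>(G ` \<U>)" using cov G by blast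
  have finG: "finite (G ` \<U>)" using fin by (rule finite_imageI)
  have opG: "\<forall>V \<in> G ` \<U>. openin Y V" using G by blast
  from ref[OF finG opG covG] obtain \<V> where V: "finite \<V>"
      "\<forall>V\<in>\<V>. openin (subtopology Y A) V \<and> (\<exists>U\<in>G ` \<U>. V \<subseteq> U)"
      "A \<subseteq> \<Union>\<V>" "\<forall>x\<in>A. card {V\<in>\<V>. x \<in> V} \<le> d + 1"
    by (elim exE conjE)
  have VA: "V \<subseteq> A" if "V \<in> \<V>" for V
    using V(2) that openin_subset[of "subtopology Y A" V] unfolding topA by blast
  have "\<forall>V\<in>\<V>. \<exists>U\<in>\<U>. V \<subseteq> U"
  proof
    fix V assume VV: "V \<in> \<V>"
    then obtain U where "U \<in> \<U>" "V \<subseteq> G U" using V(2) by blast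
    then show "\<exists>U\<in>\<U>. V \<subseteq> U" using VA[OF VV] G[OF \<open>U \<in> \<U>\<close>] by blast
  qed
  moreover have "finite_functionally_open_cover (subtopology Y A) \<V>"
    unfolding finite_functionally_open_cover_def functionally_open_subtopology[OF Y] topA
    using V VA by blast
  ultimately show "\<exists>\<V>. finite_functionally_open_cover (subtopology Y A) \<V> \<and> (\<forall>V\<in>\<V>. \<exists>U\<in>\<U>. V \<subseteq> U) \<and>
      (\<forall>x\<in>topspace (subtopology Y A). card {V \<in> \<V>. x \<in> V} \<le> d + 1)"
    using V(4) unfolding topA by blast
qed

lemma covering_dim_leD:
  assumes X: "perfectly_normal_space X" and A: "A \<subseteq> topspace X"
    and dim: "covering_dim_le (subtopology X A) d"
    and fin: "finite \<U>" and op: "\<And>U. U \<in> \<U> \<Longrightarrow> openin X U" and cov: "A \<subseteq> \<Union>\<U>"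
  obtains \<V> where "finite \<V>" "\<And>V. V \<in> \<V> \<Longrightarrow> openin (subtopology X A) V"
    "\<And>V. V \<in> \<V> \<Longrightarrow> \<exists>U\<in>\<U>. V \<subseteq> U" "A = \<Union>\<V>" "\<And>x. x \<in> A \<Longrightarrow> card {V\<in>\<V>. x \<in> V} \<le> d + 1"
proof -
  have topA: "topspace (subtopology X A) = A" using A by auto
  have "finite_functionally_open_cover (subtopology X A) ((\<lambda>U. U \<inter> A) ` \<U>)"
    unfolding finite_functionally_open_cover_def functionally_open_subtopology[OF X] topA
    using fin op cov by (auto simp: openin_subtopology)
  then obtain \<V> where V: "finite_functionally_open_cover (subtopology X A) \<V>"
     "\<forall>V\<in>\<V>. \<exists>U\<in>(\<lambda>U. U \<inter> A) ` \<U>. V \<subseteq> U"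
     "\<forall>x\<in>topspace (subtopology X A). card {V\<in>\<V>. x \<in> V} \<le> d + 1"
    using dim[unfolded covering_dim_le_def, rule_format] by blast
  have "finite \<V> \<and> (\<forall>V\<in>\<V>. openin (subtopology X A) V) \<and> \<Union>\<V> = A"
    using V(1) unfolding finite_functionally_open_cover_def functionally_open_subtopology[OF X] topA .
  note V' = this[THEN conjunct1] this[THEN conjunct2, THEN conjunct1] this[THEN conjunct2, THEN conjunct2]
  show thesis
  proof (rule that[of \<V>])
    show "\<exists>U\<in>\<U>. V \<subseteq> U" if "V \<in> \<V>" for V using V(2)[rule_format, OF that] by (elim imageE bexE) auto
    show "card {V \<in> \<V>. x \<in> V} \<le> d + 1" if "x \<in> A" for x using V(3) that unfolding topA by blast
    show "openin (subtopology X A) V" if "V \<in> \<V>" for V using V'(2) that by blast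
    show "finite \<V>" by (rule V'(1))
    show "A = \<Union>\<V>" by (rule V'(3)[symmetric])
  qed
qed

text \<open>
  A relatively open cover of \<open>A\<close> given by the positivity sets of functions \<open>k\<close> on the whole
  space keeps its order off \<open>A\<close> once each set is cut down to where \<open>k\<close> exceeds a fixed fraction
  \<open>\<theta>\<close> of the sum, and where the sum of all products of \<open>d + 2\<close> functions, which vanishes on
  \<open>A\<close>, is below \<open>\<theta> ^ (d + 2)\<close>.
\<close>

lemma covering_dim_le_swelling:
  assumes X: "perfectly_normal_space X" and A: "A \<subseteq> topspace X"
    and dim: "covering_dim_le (subtopology X A) d"
    and fin: "finite \<U>" and op: "\<And>U. U \<in> \<U> \<Longrightarrow> openin X U" and cov: "A \<subseteq> \<Union>\<U>"
  obtains \<W> where "finite \<W>" "\<And>W. W \<in> \<W> \<Longrightarrow> openin X W"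
    "\<And>W. W \<in> \<W> \<Longrightarrow> \<exists>U\<in>\<U>. W \<subseteq> U" "A \<subseteq> \<Union>\<W>"
    "\<And>x. x \<in> topspace X \<Longrightarrow> card {W\<in>\<W>. x \<in> W} \<le> d + 1"
proof -
  obtain \<V> where V: "finite \<V>" "\<And>V. V \<in> \<V> \<Longrightarrow> openin (subtopology X A) V"
    "\<And>V. V \<in> \<V> \<Longrightarrow> \<exists>U\<in>\<U>. V \<subseteq> U" "A = \<Union>\<V>" "\<And>x. x \<in> A \<Longrightarrow> card {V\<in>\<V>. x \<in> V} \<le> d + 1"
    using covering_dim_leD[OF X A dim fin op cov] by blast
  have "\<exists>k. continuous_map X euclideanreal k \<and> (\<forall>x\<in>topspace X. 0 \<le> k x) \<and>
      V = {x \<in> A. 0 < k x} \<and> (\<exists>U\<in>\<U>. {x \<in> topspace X. 0 < k x} \<subseteq> U)" if VV: "V \<in> \<V>" for V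
  proof -
    obtain G where G: "openin X G" "V = G \<inter> A" using V(2)[OF VV] by (auto simp: openin_subtopology)
    obtain U where U: "U \<in> \<U>" "V \<subseteq> U" using V(3)[OF VV] by blast
    have "openin X (G \<inter> U)" using G op U by blast
    then obtain k where "continuous_map X euclideanreal k" "\<And>x. x \<in> topspace X \<Longrightarrow> 0 \<le> k x \<and> k x \<le> 1"
       "G \<inter> U = {x \<in> topspace X. 0 < k x}"
      using perfectly_normal_space_cozero[OF X \<open>openin X (G \<inter> U)\<close>] by blast
    moreover have "V = (G \<inter> U) \<inter> A" using G U by blast
    ultimately show ?thesis using A U by (intro exI[of _ k]) (auto intro!: bexI[of _ U])
  qed
  then have "\<forall>V\<in>\<V>. \<exists>k. continuous_map X euclideanreal k \<and> (\<forall>x\<in>topspace X. 0 \<le> k x) \<and>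
      V = {x \<in> A. 0 < k x} \<and> (\<exists>U\<in>\<U>. {x \<in> topspace X. 0 < k x} \<subseteq> U)" by blast
  from bchoice[OF this] obtain k where kall: "\<forall>V\<in>\<V>. continuous_map X euclideanreal (k V) \<and> (\<forall>x\<in>topspace X. 0 \<le> k V x) \<and>
      V = {x \<in> A. 0 < k V x} \<and> (\<exists>U\<in>\<U>. {x \<in> topspace X. 0 < k V x} \<subseteq> U)" by blast
  then have kc: "\<And>V. V \<in> \<V> \<Longrightarrow> continuous_map X euclideanreal (k V)"
      and k0: "\<And>V x. V \<in> \<V> \<Longrightarrow> x \<in> topspace X \<Longrightarrow> 0 \<le> k V x"
      and kV: "\<And>V. V \<in> \<V> \<Longrightarrow> V = {x \<in> A. 0 < k V x}"
      and kU: "\<And>V. V \<in> \<V> \<Longrightarrow> \<exists>U\<in>\<U>. {x \<in> topspace X. 0 < k V x} \<subseteq> U"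
    by blast+
  define r where "r = real (card \<V>)"
  define s where "s = (\<lambda>x. \<Sum>V\<in>\<V>. k V x)"
  \<comment> \<open>Half the mean of the \<open>k V\<close>, so wherever \<open>s\<close> is
    positive some \<open>k V\<close> exceeds it. For empty \<open>\<V>\<close> division by zero
    gives 0, and no set \<open>W V\<close> arises.\<close>
  define \<theta> where "\<theta> = (\<lambda>x. s x / (2 * r))"
  define \<D> where "\<D> = {D. D \<subseteq> \<V> \<and> card D = d + 2}"
  define \<kappa> where "\<kappa> = (\<lambda>x. \<Sum>D\<in>\<D>. \<Prod>V\<in>D. k V x)"
  define W where "W = (\<lambda>V. {x \<in> topspace X. \<theta> x < k V x} \<inter> {x \<in> topspace X. \<kappa> x < \<theta> x ^ (d + 2)})"
  have finD: "finite \<D>" "\<And>D. D \<in> \<D> \<Longrightarrow> finite D"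
    using V(1) finite_subset by (auto simp: \<D>_def)
  have sc: "continuous_map X euclideanreal s" unfolding s_def by (intro continuous_map_sum V(1) kc)
  have \<theta>c: "continuous_map X euclideanreal \<theta>"
  proof -
    have "continuous_map X euclideanreal (\<lambda>x. s x * (1 / (2 * r)))"
      by (intro continuous_map_real_mult_right sc)
    then show ?thesis by (simp add: \<theta>_def)
  qed
  have DV: "V \<in> \<V>" if "D \<in> \<D>" "V \<in> D" for D V using that by (auto simp: \<D>_def)
  have \<kappa>c: "continuous_map X euclideanreal \<kappa>" unfolding \<kappa>_def
  proof (rule continuous_map_sum[OF finD(1)])
    fix D assume D: "D \<in> \<D>"
    show "continuous_map X euclideanreal (\<lambda>x. \<Prod>V\<in>D. k V x)"
      by (rule continuous_map_prod[OF finD(2)[OF D]]) (rule kc[OF DV[OF D]])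
  qed
  have s0: "0 \<le> s x" if "x \<in> topspace X" for x unfolding s_def using k0 that by (intro sum_nonneg) auto
  have \<theta>0: "0 \<le> \<theta> x" if "x \<in> topspace X" for x using s0[OF that] by (auto simp: \<theta>_def r_def)
  show thesis
  proof (rule that[of "W ` \<V>"])
    show "finite (W ` \<V>)" using V(1) by simp
    show "openin X B" if BW: "B \<in> W ` \<V>" for B
    proof -
      obtain V where Vv: "V \<in> \<V>" "B = W V" using BW by blast
      show ?thesis unfolding Vv(2) W_def
        by (intro openin_Int openin_less continuous_map_real_pow \<theta>c \<kappa>c kc[OF Vv(1)])
    qed
    show "\<exists>U\<in>\<U>. B \<subseteq> U" if BW: "B \<in> W ` \<V>" for B
    proof -
      obtain V where Vv: "V \<in> \<V>" "B = W V" using BW by blast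
      have "B \<subseteq> {x \<in> topspace X. 0 < k V x}" unfolding Vv(2) W_def using \<theta>0 order_le_less_trans by blast
      then show ?thesis using kU[OF Vv(1)] by blast
    qed
    show "A \<subseteq> \<Union>(W ` \<V>)"
    proof
      fix x assume xA: "x \<in> A"
      then have x: "x \<in> topspace X" using A by blast
      obtain V0 where V0: "V0 \<in> \<V>" "x \<in> V0" using V(4) xA by blast
      have "0 < k V0 x" using kV V0 by blast
      also have "k V0 x \<le> s x" unfolding s_def
        using member_le_sum[OF V0(1), of "\<lambda>V. k V x"] k0 x V(1) by auto
      finally have s: "0 < s x" .
      have r: "0 < r" using V0 V(1) by (auto simp: r_def card_gt_0_iff)
      have \<theta>p: "0 < \<theta> x" using s r by (simp add: \<theta>_def)
      have "\<exists>V\<in>\<V>. \<theta> x < k V x"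
      proof (rule ccontr)
        assume "\<not> (\<exists>V\<in>\<V>. \<theta> x < k V x)"
        then have "s x \<le> (\<Sum>V\<in>\<V>. \<theta> x)" unfolding s_def by (intro sum_mono) auto
        also have "\<dots> = s x / 2" using r by (simp add: r_def \<theta>_def)
        finally show False using s by simp
      qed
      then obtain V1 where V1: "V1 \<in> \<V>" "\<theta> x < k V1 x" by blast
      have "\<kappa> x = 0" unfolding \<kappa>_def
      proof (intro sum.neutral ballI)
        fix D assume D: "D \<in> \<D>"
        have "\<not> D \<subseteq> {V\<in>\<V>. x \<in> V}"
        proof
          assume "D \<subseteq> {V\<in>\<V>. x \<in> V}"
          then have "card D \<le> card {V\<in>\<V>. x \<in> V}" using V(1) by (intro card_mono) auto
          then show False using D V(5)[OF xA] by (simp add: \<D>_def)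
        qed
        then obtain V where "V \<in> D" "x \<notin> V" "V \<in> \<V>" using D by (auto simp: \<D>_def)
        have "\<not> 0 < k V x" using kV[OF \<open>V \<in> \<V>\<close>] \<open>x \<notin> V\<close> xA by blast
        then have "k V x = 0" using k0[OF \<open>V \<in> \<V>\<close> x] by simp
        then show "(\<Prod>V\<in>D. k V x) = 0" using \<open>V \<in> D\<close> finD(2)[OF D] by (auto intro: prod_zero)
      qed
      then have "x \<in> W V1" using V1 x \<theta>p by (auto simp: W_def)
      then show "x \<in> \<Union>(W ` \<V>)" using V1 by blast
    qed
    show "card {B \<in> W ` \<V>. x \<in> B} \<le> d + 1" if x: "x \<in> topspace X" for x
    proof (rule ccontr)
      assume "\<not> card {B \<in> W ` \<V>. x \<in> B} \<le> d + 1"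
      \<comment> \<open>If \<open>d + 2\<close> of the sets met at \<open>x\<close>, one summand of
        \<open>\<kappa> x\<close> would be at least \<open>\<theta> x ^ (d + 2)\<close>, against the
        second condition in \<open>W\<close>.\<close>
      then have E: "d + 2 \<le> card {V \<in> \<V>. x \<in> W V}"
        using card_family_le[OF V(1), of W x] by linarith
      obtain D where D: "D \<subseteq> {V \<in> \<V>. x \<in> W V}" "card D = d + 2"
        by (rule obtain_subset_with_card_n[OF E]) (rule that)
      then have DD: "D \<in> \<D>" unfolding \<D>_def by blast
      have "D \<noteq> {}" using D(2) by auto
      then obtain V where "V \<in> D" by blast
      then have "x \<in> W V" using D(1) by blast
      then have "\<kappa> x < \<theta> x ^ (d + 2)" by (simp add: W_def)
      also have "\<theta> x ^ (d + 2) = (\<Prod>V\<in>D. \<theta> x)" using D by simp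
      also have "\<dots> \<le> (\<Prod>V\<in>D. k V x)"
      proof (intro prod_mono conjI \<theta>0[OF x])
        fix V assume "V \<in> D"
        then have "x \<in> W V" using D(1) by blast
        then show "\<theta> x \<le> k V x" by (simp add: W_def)
      qed
      also have "\<dots> \<le> \<kappa> x" unfolding \<kappa>_def
      proof (rule member_le_sum[OF DD _ finD(1)])
        fix E assume "E \<in> \<D> - {D}"
        then show "0 \<le> (\<Prod>V\<in>E. k V x)" using k0[OF _ x] DV by (intro prod_nonneg) blast
      qed
      finally show False by simp
    qed
  qed
qed

text \<open>A Menger-Urysohn type estimate. Swollen covers of \<open>A\<close> and of
  \<open>B\<close> keep their orders a + 1 and b + 1 at every point of \<open>X\<close>, so together
  they have at most a + b + 2 members at a point, although points of \<open>B\<close> may also lie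
  in sets built for \<open>A\<close>.\<close>

lemma covering_dim_le_Un:
  assumes X: "perfectly_normal_space X" and A: "A \<subseteq> topspace X" and B: "B \<subseteq> topspace X"
    and a: "covering_dim_le (subtopology X A) a" and b: "covering_dim_le (subtopology X B) b"
  shows "covering_dim_le (subtopology X (A \<union> B)) (a + b + 1)"
proof (rule covering_dim_leI[OF X])
  show "A \<union> B \<subseteq> topspace X" using A B by blast
  fix \<U> assume fin: "finite \<U>" and op: "\<forall>U\<in>\<U>. openin X U" and cov: "A \<union> B \<subseteq> \<Union>\<U>"
  have covA: "A \<subseteq> \<Union>\<U>" and covB: "B \<subseteq> \<Union>\<U>" using cov by auto
  obtain P where P: "finite P" "\<And>W. W \<in> P \<Longrightarrow> openin X W"
    "\<And>W. W \<in> P \<Longrightarrow> \<exists>U\<in>\<U>. W \<subseteq> U" "A \<subseteq> \<Union>P" "\<And>x. x \<in> topspace X \<Longrightarrow> card {W\<in>P. x \<in> W} \<le> a + 1"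
    using covering_dim_le_swelling[OF X A a fin op[rule_format] covA] by blast
  obtain Q where Q: "finite Q" "\<And>W. W \<in> Q \<Longrightarrow> openin X W"
    "\<And>W. W \<in> Q \<Longrightarrow> \<exists>U\<in>\<U>. W \<subseteq> U" "B \<subseteq> \<Union>Q" "\<And>x. x \<in> topspace X \<Longrightarrow> card {W\<in>Q. x \<in> W} \<le> b + 1"
    using covering_dim_le_swelling[OF X B b fin op[rule_format] covB] by blast
  define R where "R = (\<lambda>W. W \<inter> (A \<union> B)) ` (P \<union> Q)"
  have "card {W\<in>R. x \<in> W} \<le> a + b + 1 + 1" if x: "x \<in> A \<union> B" for x
  proof -
    have "card {W\<in>R. x \<in> W} \<le> card {W \<in> P \<union> Q. x \<in> W \<inter> (A \<union> B)}" unfolding R_def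
      by (rule card_family_le) (use P Q in auto)
    also have "{W \<in> P \<union> Q. x \<in> W \<inter> (A \<union> B)} = {W\<in>P. x \<in> W} \<union> {W\<in>Q. x \<in> W}" using x by blast
    also have "card \<dots> \<le> card {W\<in>P. x \<in> W} + card {W\<in>Q. x \<in> W}" by (rule card_Un_le)
    also have "\<dots> \<le> a + 1 + (b + 1)" using x A B by (intro add_mono P Q) auto
    finally show ?thesis by simp
  qed
  moreover have "openin (subtopology X (A \<union> B)) W \<and> (\<exists>U\<in>\<U>. W \<subseteq> U)" if WR: "W \<in> R" for W
  proof -
    obtain W' where W': "W' \<in> P \<union> Q" "W = W' \<inter> (A \<union> B)" using WR unfolding R_def by blast
    have "openin X W'" using W'(1) P(2) Q(2) by blast
    moreover obtain U where "U \<in> \<U>" "W' \<subseteq> U" using W'(1) P(3) Q(3) by (metis UnE)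
    ultimately show ?thesis unfolding W'(2) by (auto intro: openin_subtopology_Int)
  qed
  moreover have "finite R" "A \<union> B \<subseteq> \<Union>R" using P Q by (auto simp: R_def)
  ultimately show "\<exists>\<V>. finite \<V> \<and> (\<forall>V\<in>\<V>. openin (subtopology X (A \<union> B)) V \<and> (\<exists>U\<in>\<U>. V \<subseteq> U)) \<and>
      A \<union> B \<subseteq> \<Union>\<V> \<and> (\<forall>x\<in>A \<union> B. card {V \<in> \<V>. x \<in> V} \<le> a + b + 1 + 1)"
    by (intro exI[of _ R]) auto
qed

lemma finite_dimensional_space_Union:
  assumes X: "perfectly_normal_space X" and "finite \<A>"
    and "\<And>A. A \<in> \<A> \<Longrightarrow> A \<subseteq> topspace X \<and> finite_dimensional_space (subtopology X A)"
  shows "finite_dimensional_space (subtopology X (\<Union>\<A>))"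
  using assms(2,3)
proof (induction rule: finite_induct)
  case empty
  have "covering_dim_le (subtopology X {}) 0"
    by (rule covering_dim_leI[OF X]) auto
  then show ?case by (auto simp: finite_dimensional_space_def)
next
  case (insert A \<A>)
  then obtain a b where "covering_dim_le (subtopology X A) a" "covering_dim_le (subtopology X (\<Union>\<A>)) b"
    unfolding finite_dimensional_space_def by (meson insertI1 insertI2)
  then have "covering_dim_le (subtopology X (A \<union> \<Union>\<A>)) (a + b + 1)"
    using insert.prems by (intro covering_dim_le_Un[OF X]) auto
  then show ?case by (auto simp: finite_dimensional_space_def)
qed

subsection \<open>Dimension bounds from refinements of closed shrinkings\<close>

text \<open>A cover with a closed shrinking is refined index by index; \<open>c\<close> bounds the
  number of indices at a point, that is, dimension plus one. The sets \<open>F U\<close> are closed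
  in \<open>Y\<close> and not just in \<open>M\<close>, so that Urysohn functions on
  \<open>Y\<close> are available.\<close>

definition refinable :: "'b topology \<Rightarrow> 'b set \<Rightarrow> nat \<Rightarrow> bool" where
  "refinable Y M c \<longleftrightarrow>
     (\<forall>\<U> F. finite \<U> \<longrightarrow> (\<forall>U\<in>\<U>. openin Y U \<and> closedin Y (F U) \<and> F U \<subseteq> U) \<longrightarrow> M \<subseteq> (\<Union>U\<in>\<U>. F U) \<longrightarrow>
       (\<exists>W. (\<forall>U\<in>\<U>. openin (subtopology Y M) (W U) \<and> W U \<subseteq> U) \<and> M \<subseteq> (\<Union>U\<in>\<U>. W U) \<and>
            (\<forall>y\<in>M. card {U\<in>\<U>. y \<in> W U} \<le> c)))"

text \<open>The open shells overlap and cover the interval from 0 to 1, and two shells whose indices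
  differ by at least 2 are disjoint.\<close>

lemma dyadic_shell:
  fixes s :: real
  assumes "0 < s" "s < 1"
  obtains l where "(1/2) ^ (l + 2) < s" "s < (1/2) ^ l"
proof -
  have ex: "\<exists>n. (1/2) ^ n \<le> s" using real_arch_pow_inv[of s "1/2"] assms by (auto intro: less_imp_le)
  define n where "n = (LEAST n. (1/2) ^ n \<le> s)"
  have n: "(1/2) ^ n \<le> s" unfolding n_def using ex by (rule LeastI_ex)
  then have "n \<noteq> 0" using assms by (cases n) auto
  then obtain l where l: "n = Suc l" by (cases n) auto
  then have "\<not> (1/2) ^ l \<le> s" using not_less_Least[of l] unfolding n_def by (metis lessI)
  moreover have "(1/2) ^ (l + 2) < (1/2::real) ^ n" unfolding l by simp
  ultimately show thesis using n by (intro that[of l]) linarith+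
qed

text \<open>The lower bound on \<open>s\<close> puts the closed sets \<open>F l U\<close> inside
  \<open>U\<close>; refinements on the \<open>M l\<close> are then glued along the shells
  \<open>H l\<close>. Distinct shells of equal parity are disjoint, so each parity contributes at
  most \<open>c\<close> sets at a point: 2 c in all, one fewer than dimension 2 c permits, which
  avoids subtraction.\<close>

lemma refinable_imp_covering_dim_le:
  assumes Y: "perfectly_normal_space Y" and N: "N \<subseteq> topspace Y"
    and ref: "\<And>M. M \<subseteq> N \<Longrightarrow> refinable Y M c"
  shows "covering_dim_le (subtopology Y N) (2 * c)"
proof (rule covering_dim_leI[OF Y N])
  fix \<U> assume fin: "finite \<U>" and op: "\<forall>U\<in>\<U>. openin Y U" and cov: "N \<subseteq> \<Union>\<U>"
  have "\<exists>k. continuous_map Y euclideanreal k \<and> (\<forall>y\<in>topspace Y. 0 \<le> k y \<and> k y \<le> 1) \<and>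
      U = {y \<in> topspace Y. 0 < k y}" if "U \<in> \<U>" for U
    using perfectly_normal_space_cozero[OF Y op[rule_format, OF that]] by metis
  then have "\<forall>U\<in>\<U>. \<exists>k. continuous_map Y euclideanreal k \<and> (\<forall>y\<in>topspace Y. 0 \<le> k y \<and> k y \<le> 1) \<and>
      U = {y \<in> topspace Y. 0 < k y}" by blast
  from bchoice[OF this] obtain k where k: "\<forall>U\<in>\<U>. continuous_map Y euclideanreal (k U) \<and>
      (\<forall>y\<in>topspace Y. 0 \<le> k U y \<and> k U y \<le> 1) \<and> U = {y \<in> topspace Y. 0 < k U y}" by blast
  \<comment> \<open>The denominator exceeds the number of sets: hence \<open>s < 1\<close> on
    \<open>Y\<close>, and wherever \<open>s\<close> is positive some \<open>k U\<close> is at least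
    \<open>s\<close>.\<close>
  define s where "s = (\<lambda>y. (\<Sum>U\<in>\<U>. k U y) * (1 / (real (card \<U>) + 1)))"
  have sc: "continuous_map Y euclideanreal s" unfolding s_def
    using k by (intro continuous_map_real_mult_right continuous_map_sum fin) blast
  have s1: "s y < 1" if "y \<in> topspace Y" for y
  proof -
    have "(\<Sum>U\<in>\<U>. k U y) \<le> (\<Sum>U\<in>\<U>. 1)" using k that by (intro sum_mono) blast
    then show ?thesis by (simp add: s_def field_simps)
  qed
  have s0: "0 < s y" if y: "y \<in> N" for y
  proof -
    obtain U where U: "U \<in> \<U>" "y \<in> U" using cov y by blast
    have "y \<in> topspace Y" using y N by blast
    then have "k U y \<le> (\<Sum>U\<in>\<U>. k U y)"
      using k by (intro member_le_sum[OF U(1), of "\<lambda>U. k U y"] fin) auto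
    moreover have "0 < k U y" using k U by blast
    ultimately show ?thesis by (simp add: s_def)
  qed
  define M where "M = (\<lambda>l. {y \<in> N. (1/2) ^ (l + 2) \<le> s y})"
  define F where "F = (\<lambda>l U. {y \<in> topspace Y. s y \<le> k U y} \<inter> {y \<in> topspace Y. (1/2) ^ (l + 2) \<le> s y})"
  have "\<exists>W. (\<forall>U\<in>\<U>. openin (subtopology Y (M l)) (W U) \<and> W U \<subseteq> U) \<and> M l \<subseteq> (\<Union>U\<in>\<U>. W U) \<and>
      (\<forall>y\<in>M l. card {U\<in>\<U>. y \<in> W U} \<le> c)" for l
  proof -
    have "refinable Y (M l) c" by (rule ref) (auto simp: M_def)
    moreover have "openin Y U \<and> closedin Y (F l U) \<and> F l U \<subseteq> U" if U: "U \<in> \<U>" for U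
    proof (intro conjI)
      show "openin Y U" using op U by blast
      have kc: "continuous_map Y euclideanreal (k U)" using k U by blast
      show "closedin Y (F l U)" unfolding F_def
        by (intro closedin_Int closedin_le sc kc continuous_map_canonical_const)
      show "F l U \<subseteq> U"
      proof
        fix y assume y: "y \<in> F l U"
        then have "(0::real) < (1/2) ^ (l + 2)" "(1/2) ^ (l + 2) \<le> k U y" "y \<in> topspace Y"
          by (auto simp: F_def)
        then have "y \<in> topspace Y \<and> 0 < k U y" by linarith
        then show "y \<in> U" using k U by blast
      qed
    qed
    moreover have "M l \<subseteq> (\<Union>U\<in>\<U>. F l U)"
    proof
      fix y assume "y \<in> M l"
      then have y: "y \<in> N" "(1/2) ^ (l + 2) \<le> s y" by (auto simp: M_def)
      have "\<exists>U\<in>\<U>. s y \<le> k U y"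
      proof (rule ccontr)
        assume "\<not> (\<exists>U\<in>\<U>. s y \<le> k U y)"
        then have "(\<Sum>U\<in>\<U>. k U y) \<le> (\<Sum>U\<in>\<U>. s y)" by (intro sum_mono) auto
        then have "s y * (real (card \<U>) + 1) \<le> real (card \<U>) * s y"
          by (simp add: s_def)
        then have "s y \<le> 0" by (simp add: algebra_simps)
        then show False using s0[OF y(1)] by linarith
      qed
      then show "y \<in> (\<Union>U\<in>\<U>. F l U)" using y N by (auto simp: F_def)
    qed
    ultimately show ?thesis using fin unfolding refinable_def by blast
  qed
  then have "\<forall>l. \<exists>W. (\<forall>U\<in>\<U>. openin (subtopology Y (M l)) (W U) \<and> W U \<subseteq> U) \<and> M l \<subseteq> (\<Union>U\<in>\<U>. W U) \<and>
      (\<forall>y\<in>M l. card {U\<in>\<U>. y \<in> W U} \<le> c)" ..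
  from choice[OF this] obtain W where Wall: "\<forall>l. (\<forall>U\<in>\<U>. openin (subtopology Y (M l)) (W l U) \<and> W l U \<subseteq> U) \<and>
      M l \<subseteq> (\<Union>U\<in>\<U>. W l U) \<and> (\<forall>y\<in>M l. card {U\<in>\<U>. y \<in> W l U} \<le> c)" ..
  have W: "\<And>l U. U \<in> \<U> \<Longrightarrow> openin (subtopology Y (M l)) (W l U)"
      "\<And>l U. U \<in> \<U> \<Longrightarrow> W l U \<subseteq> U" "\<And>l. M l \<subseteq> (\<Union>U\<in>\<U>. W l U)"
      "\<And>l y. y \<in> M l \<Longrightarrow> card {U\<in>\<U>. y \<in> W l U} \<le> c"
    by (simp_all add: Wall)
  define H where "H = (\<lambda>l. {y \<in> topspace Y. (1/2) ^ (l + 2) < s y} \<inter> {y \<in> topspace Y. s y < (1/2) ^ l})"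
  have Ho: "openin Y (H l)" for l unfolding H_def
    by (intro openin_Int openin_less sc continuous_map_canonical_const)
  have Hdisj: "l = m" if "y \<in> H l" "y \<in> H m" "even l = even m" for l m y
  proof -
    have False if lm: "i + 2 \<le> j" "y \<in> H i" "y \<in> H j" for i j
    proof -
      have "(1/2::real) ^ j \<le> (1/2) ^ (i + 2)" using lm(1) by (intro power_decreasing) auto
      then show False using lm(2,3) by (auto simp: H_def)
    qed
    from this[of l m] this[of m l] have "\<not> l + 2 \<le> m" "\<not> m + 2 \<le> l" using that(1,2) by blast+
    then have "l = m \<or> l = Suc m \<or> m = Suc l" by linarith
    then show ?thesis using that(3) by auto
  qed
  define V where "V = (\<lambda>(U, b). \<Union>l\<in>{l. even l = b}. W l U \<inter> H l)"
  define \<V> where "\<V> = V ` (\<U> \<times> (UNIV :: bool set))"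
  have fin2: "finite (\<U> \<times> (UNIV :: bool set))" using fin by simp
  have "finite \<V>" unfolding \<V>_def using fin2 by simp
  moreover have "openin (subtopology Y N) B \<and> (\<exists>U\<in>\<U>. B \<subseteq> U)" if B: "B \<in> \<V>" for B
  proof -
    obtain U b where Ub: "U \<in> \<U>" "B = V (U, b)" using B unfolding \<V>_def by blast
    have "openin (subtopology Y N) (W l U \<inter> H l)" for l
    proof -
      obtain G where G: "openin Y G" "W l U = G \<inter> M l"
        using W(1)[OF Ub(1)] unfolding openin_subtopology by blast
      \<comment> \<open>Inside \<open>H l\<close> the sets \<open>M l\<close> and \<open>N\<close>
        agree, so openness relative to \<open>M l\<close> becomes openness relative to
        \<open>N\<close>.\<close>
      have "H l \<inter> M l = H l \<inter> N" unfolding H_def M_def using N by auto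
      then have "W l U \<inter> H l = (G \<inter> H l) \<inter> N" unfolding G(2) by blast
      then show ?thesis unfolding openin_subtopology using openin_Int[OF G(1) Ho] by blast
    qed
    then have "openin (subtopology Y N) B" unfolding Ub(2) V_def prod.case by blast
    moreover have "B \<subseteq> U" unfolding Ub(2) V_def prod.case using W(2)[OF Ub(1)] by blast
    ultimately show ?thesis using Ub(1) by blast
  qed
  moreover have "N \<subseteq> \<Union>\<V>"
  proof
    fix y assume y: "y \<in> N"
    then have yY: "y \<in> topspace Y" using N by blast
    obtain l where l: "(1/2) ^ (l + 2) < s y" "s y < (1/2) ^ l"
      using dyadic_shell[OF s0[OF y] s1[OF yY]] by blast
    then have "y \<in> M l" "y \<in> H l" using y yY by (auto simp: M_def H_def)
    then obtain U where "U \<in> \<U>" "y \<in> W l U" using W(3)[of l] by blast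
    then have "y \<in> V (U, even l)" using \<open>y \<in> H l\<close> unfolding V_def by blast
    then show "y \<in> \<Union>\<V>" using \<open>U \<in> \<U>\<close> unfolding \<V>_def by blast
  qed
  moreover have "card {B \<in> \<V>. y \<in> B} \<le> 2 * c + 1" if y: "y \<in> N" for y
  proof -
    define P where "P = (\<lambda>b. {U \<in> \<U>. y \<in> V (U, b)})"
    have P: "card (P b) \<le> c" for b
    proof (cases "\<exists>l. even l = b \<and> y \<in> H l")
      case True
      then obtain l where l: "even l = b" "y \<in> H l" by blast
      have "P b \<subseteq> {U \<in> \<U>. y \<in> W l U}"
      proof
        fix U assume "U \<in> P b"
        then obtain m where m: "U \<in> \<U>" "even m = b" "y \<in> W m U" "y \<in> H m" by (auto simp: P_def V_def)
        then have "m = l" using Hdisj[of y m l] l by blast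
        then show "U \<in> {U \<in> \<U>. y \<in> W l U}" using m by blast
      qed
      then have "card (P b) \<le> card {U \<in> \<U>. y \<in> W l U}" using fin by (intro card_mono) auto
      also have "\<dots> \<le> c" using l y by (intro W(4)) (auto simp: H_def M_def)
      finally show ?thesis .
    next
      case False
      then have "P b = {}" by (auto simp: P_def V_def)
      then show ?thesis by simp
    qed
    have finP: "finite (P b)" for b using fin by (simp add: P_def)
    have "card {B \<in> \<V>. y \<in> B} \<le> card {i \<in> \<U> \<times> (UNIV :: bool set). y \<in> V i}"
      unfolding \<V>_def by (rule card_family_le[OF fin2])
    also have "\<dots> \<le> card (P True \<times> {True} \<union> P False \<times> {False})"
    proof (rule card_mono)
      show "finite (P True \<times> {True} \<union> P False \<times> {False})" using finP by auto
      show "{i \<in> \<U> \<times> (UNIV :: bool set). y \<in> V i} \<subseteq> P True \<times> {True} \<union> P False \<times> {False}"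
      proof
        fix i assume i: "i \<in> {i \<in> \<U> \<times> (UNIV :: bool set). y \<in> V i}"
        obtain U b where "i = (U, b)" by (cases i)
        then show "i \<in> P True \<times> {True} \<union> P False \<times> {False}" using i by (cases b) (auto simp: P_def)
      qed
    qed
    also have "\<dots> \<le> card (P True \<times> {True}) + card (P False \<times> {False})" by (rule card_Un_le)
    also have "\<dots> \<le> c + c" using P by (simp add: card_cartesian_product add_mono)
    finally show ?thesis by simp
  qed
  ultimately show "\<exists>\<V>. finite \<V> \<and> (\<forall>V\<in>\<V>. openin (subtopology Y N) V \<and> (\<exists>U\<in>\<U>. V \<subseteq> U)) \<and>
      N \<subseteq> \<Union>\<V> \<and> (\<forall>x\<in>N. card {V \<in> \<V>. x \<in> V} \<le> 2 * c + 1)"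
    by (intro exI[of _ \<V>]) simp
qed

subsection \<open>Separation by clopen sets\<close>

text \<open>A partition property of large inductive type: for closed \<open>N\<close>, having
  \<open>C\<close> and \<open>N - C\<close> closed in \<open>Y\<close> means that \<open>C\<close>
  is clopen in \<open>N\<close>. The sets \<open>A\<close> and \<open>B\<close> are closed in
  \<open>Y\<close>, so one pair can be followed through many sets \<open>N\<close>.\<close>

definition clopen_separated :: "'b topology \<Rightarrow> 'b set \<Rightarrow> bool" where
  "clopen_separated Y N \<longleftrightarrow> closedin Y N \<and>
     (\<forall>A B. closedin Y A \<and> closedin Y B \<and> disjnt A B \<longrightarrow>
        (\<exists>C. C \<subseteq> N \<and> closedin Y C \<and> closedin Y (N - C) \<and> A \<inter> N \<subseteq> C \<and> disjnt B C))"

text \<open>The complements of \<open>B\<close> and \<open>A\<close> cover \<open>Y\<close> and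
  shrink to \<open>h \<le> 1/2\<close> and \<open>1/2 \<le> h\<close>. A refinement with at most one
  index at each point splits \<open>N\<close> into two complementary open sets.\<close>

lemma refinable_1_imp_clopen_separated:
  assumes Y: "normal_space Y" and N: "closedin Y N" and ref: "refinable Y N 1"
  shows "clopen_separated Y N"
  unfolding clopen_separated_def
proof (intro conjI N allI impI)
  fix A B assume AB: "closedin Y A \<and> closedin Y B \<and> disjnt A B"
  have NY: "N \<subseteq> topspace Y" using N closedin_subset by blast
  show "\<exists>C. C \<subseteq> N \<and> closedin Y C \<and> closedin Y (N - C) \<and> A \<inter> N \<subseteq> C \<and> disjnt B C"
  \<comment> \<open>For empty \<open>A\<close> and \<open>B\<close> the two cover members would
    coincide as indices, and no disjointness could be read off.\<close>
  proof (cases "A = {}")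
    case True
    then show ?thesis using N by (intro exI[of _ "{}"]) auto
  next
    case False
    obtain h where h: "continuous_map Y euclideanreal h" "h ` A \<subseteq> {0}" "h ` B \<subseteq> {1::real}"
      using Urysohn_lemma_alt[OF Y, of A B 0 1] AB by blast
    define P where "P = topspace Y - B"
    define Q where "Q = topspace Y - A"
    have AY: "A \<subseteq> topspace Y" using AB closedin_subset by blast
    have PQ: "P \<noteq> Q" using False AB AY unfolding P_def Q_def disjnt_def by blast
    define F where "F = (\<lambda>U. if U = P then {y \<in> topspace Y. h y \<le> 1/2} else {y \<in> topspace Y. 1/2 \<le> h y})"
    have FP: "F P = {y \<in> topspace Y. h y \<le> 1/2}" and FQ: "F Q = {y \<in> topspace Y. 1/2 \<le> h y}"
      using PQ by (auto simp: F_def)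
    have "\<forall>U\<in>{P, Q}. openin Y U \<and> closedin Y (F U) \<and> F U \<subseteq> U"
    proof (intro ballI conjI)
      fix U assume "U \<in> {P, Q}"
      then show "openin Y U" using AB unfolding P_def Q_def by blast
      show "closedin Y (F U)" unfolding F_def
        using closedin_le[OF h(1), of "\<lambda>_. 1/2"] closedin_le[OF _ h(1), of "\<lambda>_. 1/2"]
        by (cases "U = P") (simp_all del: divide_const_simps)
      have "F P \<subseteq> P" unfolding FP using h(3) by (force simp: P_def)
      moreover have "F Q \<subseteq> Q" unfolding FQ using h(2) by (force simp: Q_def)
      ultimately show "F U \<subseteq> U" using \<open>U \<in> {P, Q}\<close> by blast
    qed
    moreover have "N \<subseteq> (\<Union>U\<in>{P, Q}. F U)" using NY FP FQ by auto
    ultimately obtain W where W: "\<forall>U\<in>{P, Q}. openin (subtopology Y N) (W U) \<and> W U \<subseteq> U"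
        "N \<subseteq> (\<Union>U\<in>{P, Q}. W U)" "\<forall>y\<in>N. card {U\<in>{P, Q}. y \<in> W U} \<le> 1"
      using ref[unfolded refinable_def, rule_format, of "{P, Q}" F] by blast
    have sub: "W P \<subseteq> N" "W Q \<subseteq> N" using W(1) openin_subset NY by fastforce+
    have "W P \<inter> W Q = {}"
    proof (rule ccontr)
      assume "W P \<inter> W Q \<noteq> {}"
      then obtain y where y: "y \<in> W P" "y \<in> W Q" by blast
      then have "{U\<in>{P, Q}. y \<in> W U} = {P, Q}" by blast
      moreover have "y \<in> N" using y sub by blast
      ultimately have "card {P, Q} \<le> 1" using W(3) by metis
      then show False using PQ by simp
    qed
    then have comp: "W P = N - W Q" "W Q = N - W P" using W(2) sub by blast+
    have cl: "closedin Y (N - V)" if "openin (subtopology Y N) V" for V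
    proof -
      have "closedin (subtopology Y N) (topspace (subtopology Y N) - V)" using that by blast
      then have "closedin (subtopology Y N) (N - V)" using NY by (simp add: Int_absorb1)
      then show ?thesis using N closedin_trans_full by blast
    qed
    have "closedin Y (W P)" "closedin Y (N - W P)" using cl comp(1) W(1) by auto
    moreover have "A \<inter> N \<subseteq> W P" using comp(1) W(1) unfolding Q_def by blast
    moreover have "disjnt B (W P)" using W(1) unfolding P_def disjnt_def by blast
    ultimately show ?thesis using sub(1) by blast
  qed
qed

text \<open>The classical countable sum argument. Open sets around \<open>A\<close> and
  \<open>B\<close> are enlarged step by step; at step \<open>i\<close> a clopen splitting of
  \<open>N i\<close> is distributed over the two sides. Keeping the closures disjoint lets the next
  step start, and the limits are complementary open sets.\<close>

lemma clopen_separated_countable_Union: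
  fixes N :: "nat \<Rightarrow> 'b set"
  assumes Y: "normal_space Y" and N: "\<And>i. clopen_separated Y (N i)"
    and cov: "(\<Union>i. N i) = topspace Y"
  shows "clopen_separated Y (topspace Y)"
  unfolding clopen_separated_def
proof (intro conjI allI impI closedin_topspace)
  fix A B assume AB: "closedin Y A \<and> closedin Y B \<and> disjnt A B"
  define ok where "ok = (\<lambda>(P, Q). openin Y P \<and> openin Y Q \<and> A \<subseteq> P \<and> B \<subseteq> Q \<and>
      disjnt (Y closure_of P) (Y closure_of Q))"
  define step where "step = (\<lambda>i (P, Q) (P', Q'). P \<subseteq> P' \<and> Q \<subseteq> Q' \<and> N i \<subseteq> P' \<union> Q')"
  have sep: "\<exists>P Q. openin Y P \<and> openin Y Q \<and> S \<subseteq> P \<and> T \<subseteq> Q \<and> disjnt (Y closure_of P) (Y closure_of Q)"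
    if "closedin Y S" "closedin Y T" "disjnt S T" for S T
    using Y that unfolding normal_space_disjoint_closures by blast
  have "\<exists>z. ok z"
    using sep[of A B] AB unfolding ok_def by (auto simp: split_paired_Ex)
  moreover have "\<exists>z'. ok z' \<and> step i z z'" if "ok z" for z i
  proof -
    obtain P Q where z: "z = (P, Q)" by (cases z)
    have PQ: "openin Y P" "openin Y Q" "A \<subseteq> P" "B \<subseteq> Q" "disjnt (Y closure_of P) (Y closure_of Q)"
      using that unfolding ok_def z by auto
    obtain C where C: "C \<subseteq> N i" "closedin Y C" "closedin Y (N i - C)"
        "(Y closure_of P) \<inter> N i \<subseteq> C" "disjnt (Y closure_of Q) C"
      using N[of i] PQ(5) closedin_closure_of unfolding clopen_separated_def by metis
    have "disjnt (Y closure_of P \<union> C) (Y closure_of Q \<union> (N i - C))"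
      using C PQ(5) unfolding disjnt_def by blast
    moreover have "closedin Y (Y closure_of P \<union> C)" "closedin Y (Y closure_of Q \<union> (N i - C))"
      using C by (auto intro: closedin_Un)
    ultimately obtain P' Q' where P': "openin Y P'" "openin Y Q'" "Y closure_of P \<union> C \<subseteq> P'"
        "Y closure_of Q \<union> (N i - C) \<subseteq> Q'" "disjnt (Y closure_of P') (Y closure_of Q')"
      using sep by meson
    have "P \<subseteq> Y closure_of P" "Q \<subseteq> Y closure_of Q"
      using PQ(1,2) by (auto intro!: closure_of_subset openin_subset)
    then have "P \<subseteq> P'" "Q \<subseteq> Q'" "N i \<subseteq> P' \<union> Q'" using P'(3,4) by blast+
    then have "ok (P', Q') \<and> step i z (P', Q')"
      unfolding ok_def step_def z using P' PQ by auto
    then show ?thesis by blast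
  qed
  ultimately obtain z where z: "\<And>i. ok (z i)" "\<And>i. step i (z i) (z (Suc i))"
    using dependent_nat_choice[of "\<lambda>_. ok" step] by metis
  define P where "P = (\<lambda>i. fst (z i))"
  define Q where "Q = (\<lambda>i. snd (z i))"
  have PQ: "openin Y (P i)" "openin Y (Q i)" "A \<subseteq> P i" "B \<subseteq> Q i"
     "disjnt (Y closure_of P i) (Y closure_of Q i)" for i
    using z(1)[of i] unfolding ok_def P_def Q_def by (auto simp: case_prod_beta)
  have st: "P i \<subseteq> P (Suc i)" "Q i \<subseteq> Q (Suc i)" "N i \<subseteq> P (Suc i) \<union> Q (Suc i)" for i
    using z(2)[of i] unfolding step_def P_def Q_def by (auto simp: case_prod_beta)
  have mono: "P i \<subseteq> P j" "Q i \<subseteq> Q j" if "i \<le> j" for i j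
    using lift_Suc_mono_le[of P, OF st(1) that] lift_Suc_mono_le[of Q, OF st(2) that] by auto
  have dj: "P i \<inter> Q i = {}" for i
  proof -
    have "P i \<subseteq> Y closure_of P i" "Q i \<subseteq> Y closure_of Q i"
      using PQ(1,2) by (auto intro!: closure_of_subset openin_subset)
    then show ?thesis using PQ(5)[of i] unfolding disjnt_def by blast
  qed
  define C where "C = (\<Union>i. P i)"
  define D where "D = (\<Union>i. Q i)"
  have opn: "openin Y C" "openin Y D" unfolding C_def D_def using PQ by blast+
  have CD: "C \<inter> D = {}"
  proof -
    have "P i \<inter> Q j = {}" for i j using mono(1)[of i "max i j"] mono(2)[of j "max i j"] dj[of "max i j"] by auto
    then show ?thesis unfolding C_def D_def by blast
  qed
  have "topspace Y \<subseteq> C \<union> D"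
  proof
    fix y assume "y \<in> topspace Y"
    then obtain i where "y \<in> N i" unfolding cov[symmetric] by blast
    then show "y \<in> C \<union> D" using st(3)[of i] unfolding C_def D_def by blast
  qed
  then have "topspace Y - D = C"
    using CD openin_subset[OF opn(1)] openin_subset[OF opn(2)] by blast
  then have "closedin Y C" using opn(2) by blast
  moreover have "closedin Y (topspace Y - C)" using opn by blast
  moreover have "A \<subseteq> C" "B \<subseteq> D" using PQ(3,4)[of 0] unfolding C_def D_def by blast+
  ultimately show "\<exists>C. C \<subseteq> topspace Y \<and> closedin Y C \<and> closedin Y (topspace Y - C) \<and>
      A \<inter> topspace Y \<subseteq> C \<and> disjnt B C"
    using CD openin_subset[OF opn(1)] unfolding disjnt_def by (intro exI[of _ C]) auto
qed

text \<open>Each set is diminished by its predecessors in some enumeration. The last conclusion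
  keeps the shape of \<open>D i\<close>, from which openness is derived in the applications.\<close>

lemma disjoint_refinement:
  assumes "finite I"
  obtains D where "\<And>i. i \<in> I \<Longrightarrow> D i \<subseteq> C i" "(\<Union>i\<in>I. D i) = (\<Union>i\<in>I. C i)"
    "\<And>i j. i \<in> I \<Longrightarrow> j \<in> I \<Longrightarrow> i \<noteq> j \<Longrightarrow> D i \<inter> D j = {}"
    "\<And>i. i \<in> I \<Longrightarrow> \<exists>K. K \<subseteq> I \<and> D i = C i - (\<Union>k\<in>K. C k)"
proof -
  obtain f :: "'a \<Rightarrow> nat" where f: "inj_on f I" using assms finite_imp_inj_to_nat_seg by metis
  define D where "D = (\<lambda>i. C i - (\<Union>k\<in>{k \<in> I. f k < f i}. C k))"
  show thesis
  proof (rule that[of D])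
    show "D i \<subseteq> C i" for i by (auto simp: D_def)
    show "(\<Union>i\<in>I. D i) = (\<Union>i\<in>I. C i)"
    proof (intro equalityI subsetI)
      fix x assume "x \<in> (\<Union>i\<in>I. C i)"
      then obtain i0 where i0: "i0 \<in> I" "x \<in> C i0" by blast
      define i where "i = arg_min_on f {i \<in> I. x \<in> C i}"
      have fin: "finite {i \<in> I. x \<in> C i}" "{i \<in> I. x \<in> C i} \<noteq> {}" using i0 assms by auto
      have "i \<in> {i \<in> I. x \<in> C i}" unfolding i_def by (rule arg_min_if_finite(1)[OF fin])
      moreover have "\<not> (\<exists>k\<in>{i \<in> I. x \<in> C i}. f k < f i)"
        unfolding i_def by (rule arg_min_if_finite(2)[OF fin])
      ultimately show "x \<in> (\<Union>i\<in>I. D i)" unfolding D_def by blast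
    qed (auto simp: D_def)
    show "D i \<inter> D j = {}" if "i \<in> I" "j \<in> I" "i \<noteq> j" for i j
    proof -
      have "f i < f j \<or> f j < f i" using f that unfolding inj_on_def by (metis linorder_neqE_nat)
      then show ?thesis unfolding D_def using that(1,2) by blast
    qed
    show "\<exists>K. K \<subseteq> I \<and> D i = C i - (\<Union>k\<in>K. C k)" if "i \<in> I" for i
      by (rule exI[of _ "{k \<in> I. f k < f i}"]) (auto simp: D_def)
  qed
qed

text \<open>The closed set \<open>s \<le> k U\<close> is separated from the complement of
  \<open>U\<close> by a clopen set; these clopen sets cover \<open>Y\<close> and are made disjoint
  by subtracting finitely many of them.\<close>

lemma clopen_separated_imp_covering_dim_le_0:
  assumes Y: "perfectly_normal_space Y" and sep: "clopen_separated Y (topspace Y)"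
  shows "covering_dim_le Y 0"
proof -
  have "covering_dim_le (subtopology Y (topspace Y)) 0"
  proof (rule covering_dim_leI[OF Y])
    fix \<U> assume fin: "finite \<U>" and op: "\<forall>U\<in>\<U>. openin Y U" and cov: "topspace Y \<subseteq> \<Union>\<U>"
    have "\<exists>k. continuous_map Y euclideanreal k \<and> (\<forall>y\<in>topspace Y. 0 \<le> k y \<and> k y \<le> 1) \<and>
      U = {y \<in> topspace Y. 0 < k y}" if "U \<in> \<U>" for U
      using perfectly_normal_space_cozero[OF Y op[rule_format, OF that]] by metis
    then have "\<forall>U\<in>\<U>. \<exists>k. continuous_map Y euclideanreal k \<and> (\<forall>y\<in>topspace Y. 0 \<le> k y \<and> k y \<le> 1) \<and>
      U = {y \<in> topspace Y. 0 < k y}" by blast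
    from bchoice[OF this] obtain k where k: "\<forall>U\<in>\<U>. continuous_map Y euclideanreal (k U) \<and>
      (\<forall>y\<in>topspace Y. 0 \<le> k U y \<and> k U y \<le> 1) \<and> U = {y \<in> topspace Y. 0 < k U y}" by blast
    define s where "s = (\<lambda>y. (\<Sum>U\<in>\<U>. k U y) * (1 / (real (card \<U>) + 1)))"
    have sc: "continuous_map Y euclideanreal s" unfolding s_def
      using k by (intro continuous_map_real_mult_right continuous_map_sum fin) blast
    have s0: "0 < s y" if y: "y \<in> topspace Y" for y
    proof -
      obtain U where U: "U \<in> \<U>" "y \<in> U" using cov y by blast
      then have "k U y \<le> (\<Sum>U\<in>\<U>. k U y)"
        using k y by (intro member_le_sum[OF U(1), of "\<lambda>U. k U y"] fin) auto
      moreover have "0 < k U y" using k U by blast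
      ultimately show ?thesis by (simp add: s_def)
    qed
    have kc: "continuous_map Y euclideanreal (k U)" if "U \<in> \<U>" for U using k that by blast
    have Ueq: "y \<in> U \<longleftrightarrow> y \<in> topspace Y \<and> 0 < k U y" if "U \<in> \<U>" for U y using k that by blast
    have "\<exists>C. closedin Y C \<and> openin Y C \<and> {y \<in> topspace Y. s y \<le> k U y} \<subseteq> C \<and> C \<subseteq> U" if U: "U \<in> \<U>" for U
    proof -
      have "closedin Y (topspace Y - U)" using op U by blast
      moreover have "closedin Y {y \<in> topspace Y. s y \<le> k U y}" by (intro closedin_le sc kc U)
      moreover have "disjnt {y \<in> topspace Y. s y \<le> k U y} (topspace Y - U)"
        unfolding disjnt_def using Ueq[OF U] s0 less_le_trans by blast
      ultimately obtain C where C: "C \<subseteq> topspace Y" "closedin Y C" "closedin Y (topspace Y - C)"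
         "{y \<in> topspace Y. s y \<le> k U y} \<inter> topspace Y \<subseteq> C" "disjnt (topspace Y - U) C"
        using sep unfolding clopen_separated_def by meson
      have "openin Y C" using C(1,3) by (simp add: openin_closedin)
      moreover have "C \<subseteq> U" using C(1,5) unfolding disjnt_def by blast
      ultimately show ?thesis using C(2,4) by blast
    qed
    then have "\<forall>U\<in>\<U>. \<exists>C. closedin Y C \<and> openin Y C \<and> {y \<in> topspace Y. s y \<le> k U y} \<subseteq> C \<and> C \<subseteq> U" by blast
    from bchoice[OF this] obtain C where C: "\<forall>U\<in>\<U>. closedin Y (C U) \<and> openin Y (C U) \<and>
       {y \<in> topspace Y. s y \<le> k U y} \<subseteq> C U \<and> C U \<subseteq> U" by blast
    obtain D where D: "\<And>i. i \<in> \<U> \<Longrightarrow> D i \<subseteq> C i" "(\<Union>i\<in>\<U>. D i) = (\<Union>i\<in>\<U>. C i)"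
      "\<And>i j. i \<in> \<U> \<Longrightarrow> j \<in> \<U> \<Longrightarrow> i \<noteq> j \<Longrightarrow> D i \<inter> D j = {}"
      "\<And>i. i \<in> \<U> \<Longrightarrow> \<exists>K. K \<subseteq> \<U> \<and> D i = C i - (\<Union>k\<in>K. C k)"
      by (rule disjoint_refinement[OF fin, of C]) (rule that; assumption)
    have Dop: "openin Y (D U)" if U: "U \<in> \<U>" for U
    proof -
      obtain K where K: "K \<subseteq> \<U>" "D U = C U - (\<Union>k\<in>K. C k)" using D(4)[OF U] by blast
      have "closedin Y (\<Union>k\<in>K. C k)"
        using K(1) C finite_subset[OF K(1) fin] by (intro closedin_Union) auto
      then show ?thesis unfolding K(2) using C U by (intro openin_diff) auto
    qed
    have covC: "topspace Y \<subseteq> (\<Union>U\<in>\<U>. C U)"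
    proof
      fix y assume y: "y \<in> topspace Y"
      have "\<exists>U\<in>\<U>. s y \<le> k U y"
      proof (rule ccontr)
        assume "\<not> (\<exists>U\<in>\<U>. s y \<le> k U y)"
        then have "(\<Sum>U\<in>\<U>. k U y) \<le> (\<Sum>U\<in>\<U>. s y)" by (intro sum_mono) auto
        then have "s y * (real (card \<U>) + 1) \<le> real (card \<U>) * s y"
          by (simp add: s_def)
        then have "s y \<le> 0" by (simp add: algebra_simps)
        then show False using s0[OF y] by linarith
      qed
      then show "y \<in> (\<Union>U\<in>\<U>. C U)" using C y by blast
    qed
    have one: "card {B \<in> D ` \<U>. y \<in> B} \<le> 0 + 1" for y
    proof -
      have "a = b" if "a \<in> {U \<in> \<U>. y \<in> D U}" "b \<in> {U \<in> \<U>. y \<in> D U}" for a b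
        using D(3)[of a b] that by blast
      then have "card {U \<in> \<U>. y \<in> D U} \<le> 1" using fin by (subst card_le_Suc0_iff_eq[unfolded One_nat_def[symmetric]]) auto
      then show ?thesis using card_family_le[OF fin, of D y] by linarith
    qed
    show "\<exists>\<V>. finite \<V> \<and> (\<forall>V\<in>\<V>. openin (subtopology Y (topspace Y)) V \<and> (\<exists>U\<in>\<U>. V \<subseteq> U)) \<and>
      topspace Y \<subseteq> \<Union>\<V> \<and> (\<forall>x\<in>topspace Y. card {V \<in> \<V>. x \<in> V} \<le> 0 + 1)"
    proof (intro exI[of _ "D ` \<U>"] conjI ballI one)
      show "finite (D ` \<U>)" using fin by simp
      show "topspace Y \<subseteq> \<Union>(D ` \<U>)" using covC D(2) by simp
      fix V assume "V \<in> D ` \<U>"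
      then obtain U where U: "U \<in> \<U>" "V = D U" by blast
      show "openin (subtopology Y (topspace Y)) V" unfolding U(2) subtopology_topspace by (rule Dop[OF U(1)])
      show "\<exists>U\<in>\<U>. V \<subseteq> U" using U D(1)[OF U(1)] C by blast
    qed
  qed simp
  then show ?thesis by simp
qed

subsection \<open>Limits of point evaluations\<close>

definition point_eval :: "'a topology \<Rightarrow> 'a \<Rightarrow> ('a \<Rightarrow> real) \<Rightarrow> real" where
  "point_eval X x = (\<lambda>f\<in>bdd_cont_funs X. f x)"

text \<open>For \<open>B\<close> the whole space this is the Stone--Cech compactification.\<close>

definition eval_closure :: "'a topology \<Rightarrow> 'a set \<Rightarrow> (('a \<Rightarrow> real) \<Rightarrow> real) set" where
  "eval_closure X B = powertop_real (bdd_cont_funs X) closure_of (point_eval X ` B)"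

lemma point_eval_apply [simp]: "f \<in> bdd_cont_funs X \<Longrightarrow> point_eval X x f = f x"
  by (simp add: point_eval_def)

lemma point_eval_in_topspace: "point_eval X x \<in> topspace (powertop_real (bdd_cont_funs X))"
  by (simp add: point_eval_def)

lemma point_eval_in_eval_closure: "x \<in> B \<Longrightarrow> point_eval X x \<in> eval_closure X B"
proof -
  assume "x \<in> B"
  have "point_eval X ` B \<subseteq> topspace (powertop_real (bdd_cont_funs X))"
    using point_eval_in_topspace by (rule image_subsetI)
  from closure_of_subset[OF this] show ?thesis
    unfolding eval_closure_def using \<open>x \<in> B\<close> by (rule subsetD[OF _ imageI])
qed

lemma eval_closure_mono: "A \<subseteq> B \<Longrightarrow> eval_closure X A \<subseteq> eval_closure X B"
  unfolding eval_closure_def by (intro closure_of_mono image_mono)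

lemma closedin_eval_closure: "closedin (powertop_real (bdd_cont_funs X)) (eval_closure X B)"
  by (simp add: eval_closure_def)

text \<open>Continuous inequalities pass from the point evaluations to their closure; most facts
  about limit points below are obtained in this way.\<close>

lemma eval_closure_le:
  assumes F: "continuous_map (powertop_real (bdd_cont_funs X)) euclideanreal F"
    and G: "continuous_map (powertop_real (bdd_cont_funs X)) euclideanreal G"
    and le: "\<And>x. x \<in> B \<Longrightarrow> F (point_eval X x) \<le> G (point_eval X x)"
    and \<xi>: "\<xi> \<in> eval_closure X B"
  shows "F \<xi> \<le> G \<xi>"
proof -
  let ?C = "{\<xi> \<in> topspace (powertop_real (bdd_cont_funs X)). F \<xi> \<le> G \<xi>}"
  have "closedin (powertop_real (bdd_cont_funs X)) ?C" by (rule closedin_le[OF F G])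
  moreover have "point_eval X ` B \<subseteq> ?C"
    by (intro image_subsetI CollectI conjI point_eval_in_topspace le)
  ultimately have "eval_closure X B \<subseteq> ?C" unfolding eval_closure_def by (rule closure_of_minimal[rotated])
  then have "\<xi> \<in> ?C" using \<xi> by (rule subsetD)
  then show ?thesis by simp
qed

lemma eval_closure_eq:
  assumes F: "continuous_map (powertop_real (bdd_cont_funs X)) euclideanreal F"
    and G: "continuous_map (powertop_real (bdd_cont_funs X)) euclideanreal G"
    and eq: "\<And>x. x \<in> B \<Longrightarrow> F (point_eval X x) = G (point_eval X x)"
    and \<xi>: "\<xi> \<in> eval_closure X B"
  shows "F \<xi> = G \<xi>"
proof (rule antisym)
  show "F \<xi> \<le> G \<xi>" by (rule eval_closure_le[OF F G _ \<xi>]) (simp add: eq)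
  show "G \<xi> \<le> F \<xi>" by (rule eval_closure_le[OF G F _ \<xi>]) (simp add: eq)
qed

lemma continuous_map_eval:
  "f \<in> bdd_cont_funs X \<Longrightarrow> continuous_map (powertop_real (bdd_cont_funs X)) euclideanreal (\<lambda>\<xi>. \<xi> f)"
  by (rule continuous_map_product_projection)

lemma eval_closure_bound:
  assumes \<xi>: "\<xi> \<in> eval_closure X B" and f: "f \<in> bdd_cont_funs X" and M: "\<And>x. x \<in> B \<Longrightarrow> \<bar>f x\<bar> \<le> M"
  shows "\<bar>\<xi> f\<bar> \<le> M"
  using eval_closure_le[of X "\<lambda>\<xi>. \<bar>\<xi> f\<bar>" "\<lambda>_. M" B \<xi>]
  by (simp add: assms continuous_map_eval continuous_map_real_abs)

text \<open>The sum of the \<open>\<bar>\<xi> f - \<eta> f\<bar>\<close> is continuous in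
  \<open>\<eta>\<close>. If it were at least \<open>e\<close> at all evaluations, it would be so at
  \<open>\<xi>\<close> itself, where it is 0.\<close>

lemma eval_closure_approx:
  assumes \<xi>: "\<xi> \<in> eval_closure X B" and F: "finite F" "F \<subseteq> bdd_cont_funs X" and e: "0 < e"
  obtains x where "x \<in> B" "\<And>f. f \<in> F \<Longrightarrow> \<bar>\<xi> f - f x\<bar> < e"
proof (rule ccontr)
  assume "\<not> thesis"
  then have no: "\<exists>f\<in>F. e \<le> \<bar>\<xi> f - f x\<bar>" if "x \<in> B" for x
    using that \<open>\<not> thesis\<close> \<open>\<And>x. \<lbrakk>x \<in> B; \<And>f. f \<in> F \<Longrightarrow> \<bar>\<xi> f - f x\<bar> < e\<rbrakk> \<Longrightarrow> thesis\<close> by (meson not_le)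
  have "e \<le> (\<Sum>f\<in>F. \<bar>\<xi> f - \<xi> f\<bar>)"
  proof (rule eval_closure_le[of X "\<lambda>_. e" "\<lambda>\<eta>. \<Sum>f\<in>F. \<bar>\<xi> f - \<eta> f\<bar>" B \<xi>])
    show "continuous_map (powertop_real (bdd_cont_funs X)) euclideanreal (\<lambda>\<eta>. \<Sum>f\<in>F. \<bar>\<xi> f - \<eta> f\<bar>)"
      using F by (intro continuous_map_sum continuous_map_real_abs continuous_map_diff
          continuous_map_canonical_const continuous_map_eval) auto
    show "e \<le> (\<Sum>f\<in>F. \<bar>\<xi> f - point_eval X x f\<bar>)" if "x \<in> B" for x
    proof -
      obtain f where f: "f \<in> F" "e \<le> \<bar>\<xi> f - f x\<bar>" using no[OF \<open>x \<in> B\<close>] by blast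
      have "\<bar>\<xi> f - point_eval X x f\<bar> \<le> (\<Sum>f\<in>F. \<bar>\<xi> f - point_eval X x f\<bar>)"
        by (rule member_le_sum[OF f(1) _ F(1)]) simp
      then show ?thesis using f F(2) by (simp add: subsetD)
    qed
  qed (use \<xi> in auto)
  then show False using e by simp
qed

lemma eval_closure_approx_nonzero:
  assumes \<xi>: "\<xi> \<in> eval_closure X B" and F: "finite F" "F \<subseteq> bdd_cont_funs X" and e: "0 < e"
    and P: "finite P" "P \<subseteq> bdd_cont_funs X" "\<And>p. p \<in> P \<Longrightarrow> \<xi> p \<noteq> 0"
  obtains x where "x \<in> B" "\<And>f. f \<in> F \<Longrightarrow> \<bar>\<xi> f - f x\<bar> < e" "\<And>p. p \<in> P \<Longrightarrow> p x \<noteq> 0"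
proof -
  define \<delta> where "\<delta> = Min (insert e ((\<lambda>p. \<bar>\<xi> p\<bar>) ` P))"
  have \<delta>0: "0 < \<delta>" unfolding \<delta>_def using P e by (subst Min_gr_iff) auto
  have \<delta>e: "\<delta> \<le> e" "\<And>p. p \<in> P \<Longrightarrow> \<delta> \<le> \<bar>\<xi> p\<bar>" unfolding \<delta>_def using P(1) by auto
  have fin: "finite (F \<union> P)" "F \<union> P \<subseteq> bdd_cont_funs X" using F P by auto
  obtain x where x: "x \<in> B" "\<And>f. f \<in> F \<union> P \<Longrightarrow> \<bar>\<xi> f - f x\<bar> < \<delta>"
    using eval_closure_approx[OF \<xi> fin \<delta>0] by blast
  show thesis
  proof (rule that[OF x(1)])
    show "\<bar>\<xi> f - f x\<bar> < e" if "f \<in> F" for f using x(2)[of f] that \<delta>e(1) by auto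
    show "p x \<noteq> 0" if "p \<in> P" for p using x(2)[of p] that \<delta>e(2)[OF that] by auto
  qed
qed

text \<open>A closed subset of a product of compact intervals, one for each bounded
  function.\<close>

lemma compactin_eval_closure:
  assumes B: "B \<subseteq> topspace X"
  shows "compactin (powertop_real (bdd_cont_funs X)) (eval_closure X B)"
proof -
  have "\<forall>f\<in>bdd_cont_funs X. \<exists>M. \<forall>x\<in>topspace X. \<bar>f x\<bar> \<le> M" by (simp add: bdd_cont_funs_iff)
  then obtain M where M: "\<And>f x. f \<in> bdd_cont_funs X \<Longrightarrow> x \<in> topspace X \<Longrightarrow> \<bar>f x\<bar> \<le> M f"
    by metis
  let ?K = "\<Pi>\<^sub>E f\<in>bdd_cont_funs X. {- M f..M f}"
  have "compactin (powertop_real (bdd_cont_funs X)) ?K" by (simp add: compactin_PiE)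
  moreover have "eval_closure X B \<subseteq> ?K"
  proof
    fix \<xi> assume \<xi>: "\<xi> \<in> eval_closure X B"
    then have "\<xi> \<in> extensional (bdd_cont_funs X)"
      using closedin_subset[OF closedin_eval_closure] by (fastforce simp: PiE_def)
    moreover have "\<bar>\<xi> f\<bar> \<le> M f" if "f \<in> bdd_cont_funs X" for f
      using eval_closure_bound[OF \<xi> that] M[OF that] B by blast
    ultimately show "\<xi> \<in> ?K" unfolding PiE_iff atLeastAtMost_iff abs_le_iff
      by (simp add: minus_le_iff)
  qed
  ultimately show ?thesis using closedin_eval_closure by (rule closed_compactin)
qed

lemma eval_closure_separated:
  assumes "\<xi> \<in> eval_closure X B" "\<eta> \<in> eval_closure X B" "\<xi> \<noteq> \<eta>"
  obtains f where "f \<in> bdd_cont_funs X" "\<xi> f \<noteq> \<eta> f"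
proof -
  have "\<xi> \<in> extensional (bdd_cont_funs X)" "\<eta> \<in> extensional (bdd_cont_funs X)"
    using assms closedin_subset[OF closedin_eval_closure] by (fastforce simp: PiE_def)+
  then show thesis using that assms(3) extensionalityI by metis
qed

section \<open>Algebra and interpolation at limits of evaluations\<close>

lemma bdd_cont_funs_times:
  assumes "f \<in> bdd_cont_funs X" "g \<in> bdd_cont_funs X"
  shows "(\<lambda>x\<in>topspace X. f x * g x) \<in> bdd_cont_funs X"
proof -
  obtain M N where "\<And>x. x \<in> topspace X \<Longrightarrow> \<bar>f x\<bar> \<le> M" "\<And>x. x \<in> topspace X \<Longrightarrow> \<bar>g x\<bar> \<le> N"
    using assms by (auto simp: bdd_cont_funs_iff)
  then have "\<bar>f x * g x\<bar> \<le> M * N" if "x \<in> topspace X" for x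
    unfolding abs_mult using that by (intro mult_mono) (auto intro: order_trans[OF abs_ge_zero])
  then show ?thesis using assms
    by (intro restrict_in_bdd_cont_funs continuous_map_real_mult) (auto simp: bdd_cont_funs_iff)
qed

lemma bdd_cont_funs_affine:
  assumes "f \<in> bdd_cont_funs X" "g \<in> bdd_cont_funs X"
  shows "(\<lambda>x\<in>topspace X. a * f x + b * g x + c) \<in> bdd_cont_funs X"
proof -
  obtain M N where MN: "\<And>x. x \<in> topspace X \<Longrightarrow> \<bar>f x\<bar> \<le> M" "\<And>x. x \<in> topspace X \<Longrightarrow> \<bar>g x\<bar> \<le> N"
    using assms by (auto simp: bdd_cont_funs_iff)
  have "\<bar>a * f x + b * g x + c\<bar> \<le> \<bar>a\<bar> * M + \<bar>b\<bar> * N + \<bar>c\<bar>" if "x \<in> topspace X" for x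
  proof -
    have "\<bar>a * f x\<bar> \<le> \<bar>a\<bar> * M" "\<bar>b * g x\<bar> \<le> \<bar>b\<bar> * N"
      unfolding abs_mult using MN that by (auto intro: mult_left_mono)
    then show ?thesis by linarith
  qed
  then show ?thesis using assms
    by (intro restrict_in_bdd_cont_funs continuous_map_add continuous_map_real_mult_left
        continuous_map_canonical_const) (auto simp: bdd_cont_funs_iff)
qed

text \<open>Together with the affine rule: points of the closure act as multiplicative linear
  functionals, which makes interpolation at finitely many of them possible.\<close>

lemma eval_closure_times:
  assumes f: "f \<in> bdd_cont_funs X" and g: "g \<in> bdd_cont_funs X" and \<xi>: "\<xi> \<in> eval_closure X (topspace X)"
  shows "\<xi> (\<lambda>x\<in>topspace X. f x * g x) = \<xi> f * \<xi> g"
proof (rule eval_closure_eq[OF _ _ _ \<xi>])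
  show "point_eval X x (\<lambda>x\<in>topspace X. f x * g x) = point_eval X x f * point_eval X x g"
    if "x \<in> topspace X" for x
    unfolding point_eval_apply[OF bdd_cont_funs_times[OF f g]] using f g that by simp
qed (intro continuous_map_eval continuous_map_real_mult bdd_cont_funs_times f g)+

lemma eval_closure_affine:
  assumes f: "f \<in> bdd_cont_funs X" and g: "g \<in> bdd_cont_funs X" and \<xi>: "\<xi> \<in> eval_closure X (topspace X)"
  shows "\<xi> (\<lambda>x\<in>topspace X. a * f x + b * g x + c) = a * \<xi> f + b * \<xi> g + c"
proof (rule eval_closure_eq[OF _ _ _ \<xi>])
  show "point_eval X x (\<lambda>x\<in>topspace X. a * f x + b * g x + c) = a * point_eval X x f + b * point_eval X x g + c"
    if "x \<in> topspace X" for x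
    unfolding point_eval_apply[OF bdd_cont_funs_affine[OF f g]] using f g that by simp
qed (intro continuous_map_eval continuous_map_real_mult_left continuous_map_add bdd_cont_funs_affine
    continuous_map_canonical_const f g)+

text \<open>The Lagrange product: for each \<open>\<xi>\<close> in \<open>E\<close> one factor
  \<open>c * (f - \<xi> f)\<close>, normalised to 1 at \<open>\<eta>\<close>.\<close>

lemma eval_closure_separating_function:
  assumes "finite E" "E \<subseteq> eval_closure X (topspace X)" and \<eta>: "\<eta> \<in> eval_closure X (topspace X)" "\<eta> \<notin> E"
  shows "\<exists>u\<in>bdd_cont_funs X. \<eta> u = 1 \<and> (\<forall>\<xi>\<in>E. \<xi> u = 0)"
  using assms(1,2,4)
proof (induction rule: finite_induct)
  case empty
  have z: "(\<lambda>x\<in>topspace X. 0) \<in> bdd_cont_funs X" by (rule restrict_in_bdd_cont_funs[of _ _ 0]) auto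
  show ?case
    using eval_closure_affine[OF z z \<eta>(1), of 0 0 1] bdd_cont_funs_affine[OF z z, of 0 0 1] by auto
next
  case (insert \<xi> E)
  then obtain u where u: "u \<in> bdd_cont_funs X" "\<eta> u = 1" "\<forall>\<zeta>\<in>E. \<zeta> u = 0" by auto
  have \<xi>: "\<xi> \<in> eval_closure X (topspace X)" "\<eta> \<noteq> \<xi>" using insert.prems by auto
  obtain f where f: "f \<in> bdd_cont_funs X" "\<eta> f \<noteq> \<xi> f"
    using eval_closure_separated[OF \<eta>(1) \<xi>] by blast
  define c where "c = 1 / (\<eta> f - \<xi> f)"
  define v where "v = (\<lambda>x\<in>topspace X. c * f x + 0 * f x + - (c * \<xi> f))"
  define w where "w = (\<lambda>x\<in>topspace X. u x * v x)"
  have v: "v \<in> bdd_cont_funs X" unfolding v_def by (rule bdd_cont_funs_affine[OF f(1) f(1)])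
  have w: "w \<in> bdd_cont_funs X" unfolding w_def by (rule bdd_cont_funs_times[OF u(1) v])
  have wz: "\<zeta> w = \<zeta> u * (c * (\<zeta> f - \<xi> f))" if "\<zeta> \<in> eval_closure X (topspace X)" for \<zeta>
  proof -
    have "\<zeta> v = c * \<zeta> f + 0 * \<zeta> f + - (c * \<xi> f)"
      unfolding v_def by (rule eval_closure_affine[OF f(1) f(1) that])
    then have "\<zeta> v = c * (\<zeta> f - \<xi> f)" by (simp add: right_diff_distrib)
    moreover have "\<zeta> w = \<zeta> u * \<zeta> v" unfolding w_def by (rule eval_closure_times[OF u(1) v that])
    ultimately show ?thesis by simp
  qed
  have "\<eta> w = 1" using wz[OF \<eta>(1)] u f(2) by (simp add: c_def)
  moreover have "\<zeta> w = 0" if "\<zeta> \<in> insert \<xi> E" for \<zeta>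
    using wz[of \<zeta>] that insert.prems(1) u(3) by auto
  ultimately show ?case using w by blast
qed

text \<open>Newton style: the value at a new point is corrected by a multiple of a function that
  vanishes at the old ones.\<close>

lemma eval_closure_interpolation:
  assumes "finite E" "E \<subseteq> eval_closure X (topspace X)"
  shows "\<exists>h\<in>bdd_cont_funs X. \<forall>\<xi>\<in>E. \<xi> h = a \<xi>"
  using assms
proof (induction rule: finite_induct)
  case empty
  have "(\<lambda>x\<in>topspace X. 0) \<in> bdd_cont_funs X" by (rule restrict_in_bdd_cont_funs[of _ _ 0]) auto
  then show ?case by blast
next
  case (insert \<eta> E)
  then obtain h where h: "h \<in> bdd_cont_funs X" "\<forall>\<xi>\<in>E. \<xi> h = a \<xi>" by auto
  have \<eta>: "\<eta> \<in> eval_closure X (topspace X)" and E: "E \<subseteq> eval_closure X (topspace X)" using insert.prems by auto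
  obtain u where u: "u \<in> bdd_cont_funs X" "\<eta> u = 1" "\<forall>\<xi>\<in>E. \<xi> u = 0"
    using eval_closure_separating_function[OF insert.hyps(1) E \<eta> insert.hyps(2)] by blast
  define g where "g = (\<lambda>x\<in>topspace X. 1 * h x + (a \<eta> - \<eta> h) * u x + 0)"
  have "g \<in> bdd_cont_funs X" unfolding g_def by (rule bdd_cont_funs_affine[OF h(1) u(1)])
  moreover have gz: "\<zeta> g = \<zeta> h + (a \<eta> - \<eta> h) * \<zeta> u" if "\<zeta> \<in> eval_closure X (topspace X)" for \<zeta>
    unfolding g_def using eval_closure_affine[OF h(1) u(1) that, of 1 "a \<eta> - \<eta> h" 0] by simp
  moreover have "\<eta> g = a \<eta>" using gz[OF \<eta>] u(2) by simp
  moreover have "\<xi> g = a \<xi>" if "\<xi> \<in> E" for \<xi> using gz[of \<xi>] E that h(2) u(3) by auto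
  ultimately show ?case by blast
qed

section \<open>Fine covers of sets of limit points\<close>

text \<open>Covers of \<open>S\<close> of dimension at most \<open>d\<close> that are fine for
  finitely many given functions. Coding the members by functions gives them a meaning on the whole
  compactification. The bound 1/4 leaves room for two such errors and one of 1/2 below the threshold
  1.\<close>

definition small_covers :: "'a topology \<Rightarrow> (('a \<Rightarrow> real) \<Rightarrow> real) set \<Rightarrow> nat \<Rightarrow> bool" where
  "small_covers X S d \<longleftrightarrow>
     (\<forall>\<F>. finite \<F> \<and> \<F> \<subseteq> bdd_cont_funs X \<longrightarrow>
        (\<exists>\<Q>. finite \<Q> \<and> \<Q> \<subseteq> bdd_cont_funs X \<and> (\<forall>\<xi>\<in>S. \<exists>q\<in>\<Q>. \<xi> q \<noteq> 0) \<and>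
             (\<forall>\<xi>\<in>S. card {q\<in>\<Q>. \<xi> q \<noteq> 0} \<le> d + 1) \<and>
             (\<forall>q\<in>\<Q>. \<forall>\<xi>\<in>S. \<forall>\<eta>\<in>S. \<xi> q \<noteq> 0 \<and> \<eta> q \<noteq> 0 \<longrightarrow> (\<forall>f\<in>\<F>. \<bar>\<xi> f - \<eta> f\<bar> < 1/4))))"

text \<open>Values within 1/16 of the same multiple of 1/16 differ by less than 1/8. Passing to
  limit points costs another 1/16 at either end, in all the 1/4 of
  \<open>small_covers\<close>.\<close>

lemma small_oscillation_cover:
  assumes "finite \<F>" "\<F> \<subseteq> bdd_cont_funs X"
  shows "\<exists>\<U>. finite \<U> \<and> (\<forall>U\<in>\<U>. openin X U) \<and> topspace X \<subseteq> \<Union>\<U> \<and>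
     (\<forall>U\<in>\<U>. \<forall>f\<in>\<F>. \<forall>x\<in>U. \<forall>y\<in>U. \<bar>f x - f y\<bar> < 1/8)"
  using assms
proof (induction rule: finite_induct)
  case empty
  show ?case by (intro exI[of _ "{topspace X}"]) auto
next
  case (insert f \<F>)
  then obtain \<U> where U: "finite \<U>" "\<forall>U\<in>\<U>. openin X U" "topspace X \<subseteq> \<Union>\<U>"
     "\<forall>U\<in>\<U>. \<forall>f\<in>\<F>. \<forall>x\<in>U. \<forall>y\<in>U. \<bar>f x - f y\<bar> < 1/8" by auto
  have f: "f \<in> bdd_cont_funs X" using insert.prems by simp
  then obtain M where M: "\<And>x. x \<in> topspace X \<Longrightarrow> \<bar>f x\<bar> \<le> M" by (auto simp: bdd_cont_funs_iff)
  have fc: "continuous_map X euclideanreal f" using f by (simp add: bdd_cont_funs_iff)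
  define J where "J = {\<lfloor>16 * - M\<rfloor>..\<lfloor>16 * M\<rfloor>}"
  define I where "I = (\<lambda>j::int. {x \<in> topspace X. \<bar>f x - real_of_int j / 16\<bar> < 1/16})"
  define \<V> where "\<V> = (\<lambda>(U, j). U \<inter> I j) ` (\<U> \<times> J)"
  have Io: "openin X (I j)" for j unfolding I_def
    by (intro openin_less continuous_map_real_abs continuous_map_diff continuous_map_canonical_const fc)
  have "finite \<V>" unfolding \<V>_def J_def using U(1) by simp
  moreover have "\<forall>V\<in>\<V>. openin X V" unfolding \<V>_def using U(2) Io by (auto intro: openin_Int)
  moreover have "topspace X \<subseteq> \<Union>\<V>"
  proof
    fix x assume x: "x \<in> topspace X"
    then obtain U where Ux: "U \<in> \<U>" "x \<in> U" using U(3) by blast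
    have "\<lfloor>16 * f x\<rfloor> \<in> J" unfolding J_def using M[OF x] by (auto intro!: floor_mono)
    moreover have "x \<in> I \<lfloor>16 * f x\<rfloor>"
    proof -
      have "of_int \<lfloor>16 * f x\<rfloor> \<le> 16 * f x" "16 * f x < of_int \<lfloor>16 * f x\<rfloor> + 1" by linarith+
      then have "\<bar>f x - of_int \<lfloor>16 * f x\<rfloor> / 16\<bar> < 1/16" by linarith
      then show ?thesis using x unfolding I_def by blast
    qed
    ultimately show "x \<in> \<Union>\<V>" unfolding \<V>_def using Ux by blast
  qed
  moreover have "\<forall>V\<in>\<V>. \<forall>g\<in>insert f \<F>. \<forall>x\<in>V. \<forall>y\<in>V. \<bar>g x - g y\<bar> < 1/8"
  proof (intro ballI)
    fix V g x y assume V: "V \<in> \<V>" and g: "g \<in> insert f \<F>" and xy: "x \<in> V" "y \<in> V"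
    obtain U j where Uj: "U \<in> \<U>" "V = U \<inter> I j" using V unfolding \<V>_def by auto
    show "\<bar>g x - g y\<bar> < 1/8"
    proof (cases "g = f")
      case True
      have "\<bar>f x - real_of_int j / 16\<bar> < 1/16" "\<bar>f y - real_of_int j / 16\<bar> < 1/16"
        using xy unfolding Uj(2) I_def by auto
      then show ?thesis unfolding True by linarith
    next
      case False
      then show ?thesis using g xy Uj U(4) by auto
    qed
  qed
  ultimately show ?case by blast
qed

lemma small_oscillation_relative_cover:
  assumes X: "perfectly_normal_space X" and B: "B \<subseteq> topspace X"
    and dim: "covering_dim_le (subtopology X B) d"
    and F: "finite \<F>" "\<F> \<subseteq> bdd_cont_funs X"
  obtains \<V> k where "finite \<V>" "\<And>V. V \<in> \<V> \<Longrightarrow> continuous_map X euclideanreal (k V)"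
    "\<And>V x. V \<in> \<V> \<Longrightarrow> x \<in> topspace X \<Longrightarrow> 0 \<le> k V x \<and> k V x \<le> 1"
    "\<And>V x. V \<in> \<V> \<Longrightarrow> x \<in> B \<Longrightarrow> x \<in> V \<longleftrightarrow> 0 < k V x"
    "B = \<Union>\<V>" "\<And>x. x \<in> B \<Longrightarrow> card {V\<in>\<V>. x \<in> V} \<le> d + 1"
    "\<And>V f x y. V \<in> \<V> \<Longrightarrow> f \<in> \<F> \<Longrightarrow> x \<in> V \<Longrightarrow> y \<in> V \<Longrightarrow> \<bar>f x - f y\<bar> < 1/8"
proof -
  obtain \<U> where U: "finite \<U>" "\<forall>U\<in>\<U>. openin X U" "topspace X \<subseteq> \<Union>\<U>"
     "\<forall>U\<in>\<U>. \<forall>f\<in>\<F>. \<forall>x\<in>U. \<forall>y\<in>U. \<bar>f x - f y\<bar> < 1/8"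
    using small_oscillation_cover[OF F] by blast
  have covB: "B \<subseteq> \<Union>\<U>" using B U(3) by blast
  obtain \<V> where V: "finite \<V>" "\<And>V. V \<in> \<V> \<Longrightarrow> openin (subtopology X B) V"
    "\<And>V. V \<in> \<V> \<Longrightarrow> \<exists>U\<in>\<U>. V \<subseteq> U" "B = \<Union>\<V>" "\<And>x. x \<in> B \<Longrightarrow> card {V\<in>\<V>. x \<in> V} \<le> d + 1"
    using covering_dim_leD[OF X B dim U(1) U(2)[rule_format] covB] by blast
  have "\<exists>k. continuous_map X euclideanreal k \<and> (\<forall>x\<in>topspace X. 0 \<le> k x \<and> k x \<le> 1) \<and>
      (\<forall>x\<in>B. x \<in> V \<longleftrightarrow> 0 < k x)" if VV: "V \<in> \<V>" for V
  proof -
    obtain k where k: "continuous_map X euclideanreal k" "\<And>x. x \<in> topspace X \<Longrightarrow> 0 \<le> k x \<and> k x \<le> 1"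
      "V = {x \<in> topspace X \<inter> B. 0 < k x}"
      using perfectly_normal_space_relative_cozero[OF X V(2)[OF VV]] by metis
    have "x \<in> V \<longleftrightarrow> 0 < k x" if "x \<in> B" for x unfolding k(3) using that B by blast
    then show ?thesis using k(1,2) by blast
  qed
  then have "\<forall>V\<in>\<V>. \<exists>k. continuous_map X euclideanreal k \<and> (\<forall>x\<in>topspace X. 0 \<le> k x \<and> k x \<le> 1) \<and>
      (\<forall>x\<in>B. x \<in> V \<longleftrightarrow> 0 < k x)" by blast
  from bchoice[OF this] obtain k where k: "\<forall>V\<in>\<V>. continuous_map X euclideanreal (k V) \<and>
      (\<forall>x\<in>topspace X. 0 \<le> k V x \<and> k V x \<le> 1) \<and> (\<forall>x\<in>B. x \<in> V \<longleftrightarrow> 0 < k V x)" by blast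
  show thesis
  proof (rule that[of \<V> k])
    show "\<bar>f x - f y\<bar> < 1/8" if "V \<in> \<V>" "f \<in> \<F>" "x \<in> V" "y \<in> V" for V f x y
      using V(3)[OF that(1)] U(4) that by blast
    show "card {V\<in>\<V>. x \<in> V} \<le> d + 1" if "x \<in> B" for x by (rule V(5)[OF that])
    show "continuous_map X euclideanreal (k V)" if "V \<in> \<V>" for V using k that by blast
    show "0 \<le> k V x \<and> k V x \<le> 1" if "V \<in> \<V>" "x \<in> topspace X" for V x using k that by blast
    show "x \<in> V \<longleftrightarrow> 0 < k V x" if "V \<in> \<V>" "x \<in> B" for V x using k that by blast
  qed (fact V(1) V(4))+
qed

text \<open>At evaluations in points of \<open>B\<close> the functions \<open>k V\<close> serve
  directly, and \<open>B\<close> may be arbitrary. This is the form for countable dimension.\<close>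

lemma small_covers_point_eval:
  assumes X: "perfectly_normal_space X" and B: "B \<subseteq> topspace X"
    and dim: "covering_dim_le (subtopology X B) d"
  shows "small_covers X (point_eval X ` B) d"
  unfolding small_covers_def
proof (intro allI impI)
  fix \<F> :: "('a \<Rightarrow> real) set" assume F: "finite \<F> \<and> \<F> \<subseteq> bdd_cont_funs X"
  obtain \<V> k where V: "finite \<V>" and kc: "\<And>V. V \<in> \<V> \<Longrightarrow> continuous_map X euclideanreal (k V)"
    and k01: "\<And>V x. V \<in> \<V> \<Longrightarrow> x \<in> topspace X \<Longrightarrow> 0 \<le> k V x \<and> k V x \<le> 1"
    and kV: "\<And>V x. V \<in> \<V> \<Longrightarrow> x \<in> B \<Longrightarrow> x \<in> V \<longleftrightarrow> 0 < k V x"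
    and cov: "B = \<Union>\<V>" and crd: "\<And>x. x \<in> B \<Longrightarrow> card {V\<in>\<V>. x \<in> V} \<le> d + 1"
    and osc: "\<And>V f x y. V \<in> \<V> \<Longrightarrow> f \<in> \<F> \<Longrightarrow> x \<in> V \<Longrightarrow> y \<in> V \<Longrightarrow> \<bar>f x - f y\<bar> < 1/8"
    by (rule small_oscillation_relative_cover[OF X B dim F[THEN conjunct1] F[THEN conjunct2]])
      (rule that; assumption)
  define q where "q = (\<lambda>V. restrict (k V) (topspace X))"
  have q: "q V \<in> bdd_cont_funs X" if "V \<in> \<V>" for V
    unfolding q_def using k01[OF that] by (intro restrict_in_bdd_cont_funs[of _ _ 1] kc[OF that]) auto
  have qV: "q V x \<noteq> 0 \<longleftrightarrow> x \<in> V" if "V \<in> \<V>" "x \<in> B" for V x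
    using kV[OF that] k01[OF that(1), of x] that(2) B by (auto simp: q_def)
  define \<Q> where "\<Q> = q ` \<V>"
  have Q: "\<Q> \<subseteq> bdd_cont_funs X" unfolding \<Q>_def using q by (rule image_subsetI)
  have e: "point_eval X x p = p x" if "p \<in> \<Q>" for x p using Q that by (simp add: subsetD)
  show "\<exists>\<Q>. finite \<Q> \<and> \<Q> \<subseteq> bdd_cont_funs X \<and> (\<forall>\<xi>\<in>point_eval X ` B. \<exists>q\<in>\<Q>. \<xi> q \<noteq> 0) \<and>
     (\<forall>\<xi>\<in>point_eval X ` B. card {q\<in>\<Q>. \<xi> q \<noteq> 0} \<le> d + 1) \<and>
     (\<forall>q\<in>\<Q>. \<forall>\<xi>\<in>point_eval X ` B. \<forall>\<eta>\<in>point_eval X ` B. \<xi> q \<noteq> 0 \<and> \<eta> q \<noteq> 0 \<longrightarrow>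
        (\<forall>f\<in>\<F>. \<bar>\<xi> f - \<eta> f\<bar> < 1/4))"
  proof (intro exI[of _ \<Q>] conjI Q)
    show "finite \<Q>" unfolding \<Q>_def using V by simp
    show "\<forall>\<xi>\<in>point_eval X ` B. \<exists>q\<in>\<Q>. \<xi> q \<noteq> 0"
    proof (rule ballI, erule imageE)
      fix \<xi> x assume x: "\<xi> = point_eval X x" "x \<in> B"
      obtain V where "V \<in> \<V>" "x \<in> V" using x(2) cov by blast
      then have "q V \<in> \<Q>" "q V x \<noteq> 0" using qV[of V x] x(2) by (simp_all add: \<Q>_def)
      then show "\<exists>q\<in>\<Q>. \<xi> q \<noteq> 0" unfolding x(1) using e by (intro bexI[of _ "q V"]) auto
    qed
    show "\<forall>\<xi>\<in>point_eval X ` B. card {q\<in>\<Q>. \<xi> q \<noteq> 0} \<le> d + 1"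
    proof (rule ballI, erule imageE)
      fix \<xi> x assume x: "\<xi> = point_eval X x" "x \<in> B"
      have "{p\<in>\<Q>. \<xi> p \<noteq> 0} = {p\<in>\<Q>. p x \<noteq> 0}" unfolding x(1) using e by auto
      also have "\<dots> = q ` {V\<in>\<V>. x \<in> V}" unfolding \<Q>_def using qV[OF _ x(2)] by auto
      also have "card \<dots> \<le> card {V\<in>\<V>. x \<in> V}" using V by (intro card_image_le) simp
      finally show "card {p\<in>\<Q>. \<xi> p \<noteq> 0} \<le> d + 1" using crd[OF x(2)] by linarith
    qed
    show "\<forall>q\<in>\<Q>. \<forall>\<xi>\<in>point_eval X ` B. \<forall>\<eta>\<in>point_eval X ` B. \<xi> q \<noteq> 0 \<and> \<eta> q \<noteq> 0 \<longrightarrow>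
        (\<forall>f\<in>\<F>. \<bar>\<xi> f - \<eta> f\<bar> < 1/4)"
    proof (intro ballI impI, elim imageE)
      fix p \<xi> \<eta> f x y assume p: "p \<in> \<Q>" "\<xi> p \<noteq> 0 \<and> \<eta> p \<noteq> 0" and f: "f \<in> \<F>"
        and x: "\<xi> = point_eval X x" "x \<in> B" and y: "\<eta> = point_eval X y" "y \<in> B"
      have "p \<in> q ` \<V>" using p(1) by (simp only: \<Q>_def)
      then obtain V where VV: "V \<in> \<V>" "p = q V" by (rule imageE) (rule that)
      have "x \<in> V" using p(2) e[OF p(1)] qV[OF VV(1) x(2)] unfolding x(1) VV(2) by simp
      moreover have "y \<in> V" using p(2) e[OF p(1)] qV[OF VV(1) y(2)] unfolding y(1) VV(2) by simp
      ultimately have "\<bar>f x - f y\<bar> < 1/8" by (rule osc[OF VV(1) f])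
      moreover have "f \<in> bdd_cont_funs X" using f F by (rule subsetD[rotated, OF _ conjunct2])
      ultimately show "\<bar>\<xi> f - \<eta> f\<bar> < 1/4" unfolding x(1) y(1) by simp
    qed
  qed
qed

text \<open>At a limit point all \<open>k V\<close> could vanish although their sum is positive on
  \<open>B\<close>. The quotients \<open>k V / s\<close> sum to 1, and this survives the limit; as
  \<open>s\<close> may vanish off \<open>B\<close>, they are extended from the closed set
  \<open>B\<close> by Tietze.\<close>

lemma small_covers_eval_closure:
  assumes X: "perfectly_normal_space X" and B: "closedin X B"
    and dim: "covering_dim_le (subtopology X B) d"
  shows "small_covers X (eval_closure X B) d"
  unfolding small_covers_def
proof (intro allI impI)
  fix \<F> :: "('a \<Rightarrow> real) set" assume F: "finite \<F> \<and> \<F> \<subseteq> bdd_cont_funs X"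
  have BX: "B \<subseteq> topspace X" using B by (rule closedin_subset)
  obtain \<V> k where V: "finite \<V>" and kc: "\<And>V. V \<in> \<V> \<Longrightarrow> continuous_map X euclideanreal (k V)"
    and k01: "\<And>V x. V \<in> \<V> \<Longrightarrow> x \<in> topspace X \<Longrightarrow> 0 \<le> k V x \<and> k V x \<le> 1"
    and kV: "\<And>V x. V \<in> \<V> \<Longrightarrow> x \<in> B \<Longrightarrow> x \<in> V \<longleftrightarrow> 0 < k V x"
    and cov: "B = \<Union>\<V>" and crd: "\<And>x. x \<in> B \<Longrightarrow> card {V\<in>\<V>. x \<in> V} \<le> d + 1"
    and osc: "\<And>V f x y. V \<in> \<V> \<Longrightarrow> f \<in> \<F> \<Longrightarrow> x \<in> V \<Longrightarrow> y \<in> V \<Longrightarrow> \<bar>f x - f y\<bar> < 1/8"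
    by (rule small_oscillation_relative_cover[OF X BX dim F[THEN conjunct1] F[THEN conjunct2]])
      (rule that; assumption)
  define s where "s = (\<lambda>x. \<Sum>V\<in>\<V>. k V x)"
  have sc: "continuous_map X euclideanreal s" unfolding s_def by (intro continuous_map_sum V kc)
  have s0: "0 < s x" if x: "x \<in> B" for x
  proof -
    have xX: "x \<in> topspace X" using x BX by blast
    obtain V where VV: "V \<in> \<V>" "x \<in> V" using x cov by blast
    have "k V x \<le> s x" unfolding s_def
      using k01[OF _ xX] by (intro member_le_sum[OF VV(1), of "\<lambda>V. k V x"] V) auto
    then show ?thesis using kV[OF VV(1) x] VV(2) by simp
  qed
  have "\<exists>q. q \<in> bdd_cont_funs X \<and> (\<forall>x\<in>B. q x = k V x / s x)" if VV: "V \<in> \<V>" for V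
  proof -
    have "continuous_map (subtopology X B) euclideanreal (\<lambda>x. k V x / s x)"
      using s0 BX by (intro continuous_map_real_divide continuous_map_from_subtopology kc[OF VV] sc) force
    moreover have "(\<lambda>x. k V x / s x) ` B \<subseteq> {0..1}"
    proof (rule image_subsetI)
      fix x assume x: "x \<in> B"
      then have xX: "x \<in> topspace X" using BX by blast
      have "k V x \<le> s x" unfolding s_def
        using k01[OF _ xX] by (intro member_le_sum[OF VV, of "\<lambda>V. k V x"] V) auto
      then show "k V x / s x \<in> {0..1}" using s0[OF x] k01[OF VV xX] by simp
    qed
    moreover have "normal_space X" using X by (simp add: perfectly_normal_space_def)
    ultimately obtain g where g: "continuous_map X euclideanreal g" "\<And>x. x \<in> B \<Longrightarrow> g x = k V x / s x"
        "g ` topspace X \<subseteq> {0..1}"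
      using Tietze_extension_closed_real_interval[OF _ B, of "\<lambda>x. k V x / s x" 0 1]
      by (metis zero_le_one)
    have "restrict g (topspace X) \<in> bdd_cont_funs X"
      using g(3) by (intro restrict_in_bdd_cont_funs[of _ _ 1] g(1)) force
    moreover have "restrict g (topspace X) x = k V x / s x" if "x \<in> B" for x using g(2)[OF that] that BX by auto
    ultimately show ?thesis by blast
  qed
  then have "\<forall>V\<in>\<V>. \<exists>q. q \<in> bdd_cont_funs X \<and> (\<forall>x\<in>B. q x = k V x / s x)" ..
  from bchoice[OF this] obtain q where q: "\<forall>V\<in>\<V>. q V \<in> bdd_cont_funs X \<and> (\<forall>x\<in>B. q V x = k V x / s x)" ..
  have qb: "q V \<in> bdd_cont_funs X" if "V \<in> \<V>" for V using q that by simp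
  have qV: "q V x \<noteq> 0 \<longleftrightarrow> x \<in> V" if "V \<in> \<V>" "x \<in> B" for V x
  proof -
    have "x \<in> topspace X" using that BX by blast
    then show ?thesis
      using kV[OF that] k01[OF that(1), of x] q[rule_format, OF that(1)] that(2) s0[OF that(2)] by auto
  qed
  have q1: "(\<Sum>V\<in>\<V>. q V x) = 1" if "x \<in> B" for x
  proof -
    have "(\<Sum>V\<in>\<V>. q V x) = (\<Sum>V\<in>\<V>. k V x / s x)" using q that by (intro sum.cong) auto
    also have "\<dots> = s x / s x" by (simp only: s_def sum_divide_distrib[symmetric])
    finally show ?thesis using s0[OF that] by simp
  qed
  define \<Q> where "\<Q> = q ` \<V>"
  have Q: "\<Q> \<subseteq> bdd_cont_funs X" unfolding \<Q>_def using qb by (rule image_subsetI)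
  have finQ: "finite \<Q>" unfolding \<Q>_def using V by simp
  show "\<exists>\<Q>. finite \<Q> \<and> \<Q> \<subseteq> bdd_cont_funs X \<and> (\<forall>\<xi>\<in>eval_closure X B. \<exists>q\<in>\<Q>. \<xi> q \<noteq> 0) \<and>
     (\<forall>\<xi>\<in>eval_closure X B. card {q\<in>\<Q>. \<xi> q \<noteq> 0} \<le> d + 1) \<and>
     (\<forall>q\<in>\<Q>. \<forall>\<xi>\<in>eval_closure X B. \<forall>\<eta>\<in>eval_closure X B. \<xi> q \<noteq> 0 \<and> \<eta> q \<noteq> 0 \<longrightarrow>
        (\<forall>f\<in>\<F>. \<bar>\<xi> f - \<eta> f\<bar> < 1/4))"
  proof (intro exI[of _ \<Q>] conjI Q finQ)
    show "\<forall>\<xi>\<in>eval_closure X B. \<exists>q\<in>\<Q>. \<xi> q \<noteq> 0"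
    proof
      fix \<xi> assume \<xi>: "\<xi> \<in> eval_closure X B"
      have "(\<Sum>V\<in>\<V>. \<xi> (q V)) = 1"
      proof (rule eval_closure_eq[OF _ _ _ \<xi>])
        show "continuous_map (powertop_real (bdd_cont_funs X)) euclideanreal (\<lambda>\<xi>. \<Sum>V\<in>\<V>. \<xi> (q V))"
          by (intro continuous_map_sum V continuous_map_eval qb)
        show "(\<Sum>V\<in>\<V>. point_eval X x (q V)) = 1" if "x \<in> B" for x
          using q1[OF that] qb by simp
      qed simp
      then obtain V where "V \<in> \<V>" "\<xi> (q V) \<noteq> 0" by (metis sum.neutral zero_neq_one)
      then show "\<exists>q\<in>\<Q>. \<xi> q \<noteq> 0" unfolding \<Q>_def by (intro bexI[of _ "q V"] imageI)
    qed
    show "\<forall>\<xi>\<in>eval_closure X B. card {q\<in>\<Q>. \<xi> q \<noteq> 0} \<le> d + 1"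
    proof
      fix \<xi> assume \<xi>: "\<xi> \<in> eval_closure X B"
      define P where "P = {p\<in>\<Q>. \<xi> p \<noteq> 0}"
      have P: "finite P" "P \<subseteq> bdd_cont_funs X" "\<And>p. p \<in> P \<Longrightarrow> \<xi> p \<noteq> 0"
        using finQ Q unfolding P_def by auto
      \<comment> \<open>Finitely many functions not vanishing at \<open>\<xi>\<close> are
        simultaneously nonzero at one point of \<open>B\<close>, so the order on \<open>B\<close>
        bounds the order at \<open>\<xi>\<close>.\<close>
      obtain x where x: "x \<in> B" "\<And>p. p \<in> P \<Longrightarrow> p x \<noteq> 0"
        by (rule eval_closure_approx_nonzero[OF \<xi> finite.emptyI empty_subsetI zero_less_one P(1,2)])
          (erule P(3), rule that)
      have "P \<subseteq> {p\<in>\<Q>. p x \<noteq> 0}" using x(2) unfolding P_def by auto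
      also have "\<dots> = q ` {V\<in>\<V>. x \<in> V}" unfolding \<Q>_def using qV[OF _ x(1)] by auto
      finally have "card P \<le> card (q ` {V\<in>\<V>. x \<in> V})" using V by (intro card_mono) auto
      also have "\<dots> \<le> card {V\<in>\<V>. x \<in> V}" using V by (intro card_image_le) simp
      finally show "card {p\<in>\<Q>. \<xi> p \<noteq> 0} \<le> d + 1" using crd[OF x(1)] unfolding P_def by linarith
    qed
    show "\<forall>q\<in>\<Q>. \<forall>\<xi>\<in>eval_closure X B. \<forall>\<eta>\<in>eval_closure X B. \<xi> q \<noteq> 0 \<and> \<eta> q \<noteq> 0 \<longrightarrow>
        (\<forall>f\<in>\<F>. \<bar>\<xi> f - \<eta> f\<bar> < 1/4)"
    proof (intro ballI impI)
      fix p \<xi> \<eta> f assume p: "p \<in> \<Q>" "\<xi> p \<noteq> 0 \<and> \<eta> p \<noteq> 0" and f: "f \<in> \<F>"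
        and \<xi>: "\<xi> \<in> eval_closure X B" and \<eta>: "\<eta> \<in> eval_closure X B"
      have pp: "{p} \<subseteq> bdd_cont_funs X" "finite {p}" using Q p(1) by auto
      have ff: "{f} \<subseteq> bdd_cont_funs X" "finite {f}" using F f by auto
      have "p \<in> q ` \<V>" using p(1) by (simp only: \<Q>_def)
      then obtain V where VV: "V \<in> \<V>" "p = q V" by (rule imageE) (rule that)
      obtain x where x: "x \<in> B" "\<bar>\<xi> f - f x\<bar> < 1/16" "p x \<noteq> 0"
        using eval_closure_approx_nonzero[OF \<xi> ff(2,1) _ pp(2,1), of "1/16"] p(2) by auto
      obtain y where y: "y \<in> B" "\<bar>\<eta> f - f y\<bar> < 1/16" "p y \<noteq> 0"
        using eval_closure_approx_nonzero[OF \<eta> ff(2,1) _ pp(2,1), of "1/16"] p(2) by auto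
      have "x \<in> V" "y \<in> V" using qV[OF VV(1)] x y unfolding VV(2) by simp_all
      then have "\<bar>f x - f y\<bar> < 1/8" by (rule osc[OF VV(1) f])
      then show "\<bar>\<xi> f - \<eta> f\<bar> < 1/4" using x(2) y(2) by linarith
    qed
  qed
qed

subsection \<open>Finite supports in the compactification\<close>

text \<open>Repetitions are allowed, so every nonempty set of at most \<open>n\<close> points comes
  from an \<open>n\<close>-tuple.\<close>

lemma finite_enumeration:
  assumes "finite K" "K \<noteq> {}" "card K \<le> n"
  obtains e where "e \<in> {..<n} \<rightarrow>\<^sub>E K" "e ` {..<n} = K"
proof -
  obtain b where b: "bij_betw b {0..<card K} K" using ex_bij_betw_nat_finite[OF assms(1)] by blast
  obtain k where k: "k \<in> K" using assms(2) by blast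
  define e where "e = (\<lambda>i\<in>{..<n}. if i < card K then b i else k)"
  have bK: "b i \<in> K" if "i < card K" for i using bij_betwE[OF b] that by auto
  have "e \<in> {..<n} \<rightarrow>\<^sub>E K" unfolding e_def using bK k by auto
  moreover have "K \<subseteq> e ` {..<n}"
  proof
    fix x assume "x \<in> K"
    then obtain i where "i < card K" "x = b i" using bij_betw_imp_surj_on[OF b] by force
    then have "x = e i" "i < n" using assms(3) by (simp_all add: e_def)
    then show "x \<in> e ` {..<n}" by blast
  qed
  ultimately show thesis by (intro that[of e]) auto
qed

lemma openin_finite_Ball:
  assumes "finite A" "\<And>i. i \<in> A \<Longrightarrow> openin Z {z \<in> topspace Z. P i z}"
  shows "openin Z {z \<in> topspace Z. \<forall>i\<in>A. P i z}"
  using assms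
proof (induction rule: finite_induct)
  case (insert i A)
  have "{z \<in> topspace Z. \<forall>j\<in>insert i A. P j z} = {z \<in> topspace Z. P i z} \<inter> {z \<in> topspace Z. \<forall>j\<in>A. P j z}"
    by blast
  then show ?case using insert by (simp add: openin_Int)
qed simp

lemma openin_Bex:
  assumes "\<And>i. i \<in> A \<Longrightarrow> openin Z {z \<in> topspace Z. P i z}"
  shows "openin Z {z \<in> topspace Z. \<exists>i\<in>A. P i z}"
proof -
  have "{z \<in> topspace Z. \<exists>i\<in>A. P i z} = (\<Union>i\<in>A. {z \<in> topspace Z. P i z})" by blast
  then show ?thesis using assms by auto
qed

lemma openin_neq_0:
  assumes "continuous_map Z euclideanreal f"
  shows "openin Z {z \<in> topspace Z. f z \<noteq> 0}"
proof -
  have "openin Z {z \<in> topspace Z. f z \<in> - {0}}"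
    by (rule openin_continuous_map_preimage[OF assms]) auto
  then show ?thesis by simp
qed

text \<open>This form covers all choices of \<open>DX\<close> and \<open>DY\<close>:
  \<open>T\<close> is applied to bounded functions only. The bound \<open>N\<close> of the lifts
  does not depend on the index, which is the substance of inverse boundedness.\<close>

locale inversely_bounded_operator =
  fixes X :: "'a topology" and Y :: "'b topology" and T :: "('a \<Rightarrow> real) \<Rightarrow> 'b \<Rightarrow> real"
  assumes T_continuous: "f \<in> bdd_cont_funs X \<Longrightarrow> continuous_map Y euclideanreal (T f)"
    and finite_support: "y \<in> topspace Y \<Longrightarrow> \<exists>K p. finite K \<and> K \<subseteq> topspace X \<and>
      (\<forall>f\<in>bdd_cont_funs X. \<forall>g\<in>bdd_cont_funs X. (\<forall>x\<in>K. \<bar>f x - g x\<bar> < 1) \<longrightarrow> \<bar>T f y - T g y\<bar> \<le> real p)"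
    and bounded_preimages: "\<lbrakk>\<And>i::nat. continuous_map Y euclideanreal (g i);
        \<And>i y. y \<in> topspace Y \<Longrightarrow> \<bar>g i y\<bar> \<le> M\<rbrakk> \<Longrightarrow>
      \<exists>f N. \<forall>i. f i \<in> bdd_cont_funs X \<and> (\<forall>x\<in>topspace X. \<bar>f i x\<bar> \<le> N) \<and> (\<forall>y\<in>topspace Y. T (f i) y = g i y)"
begin

abbreviation "\<beta>X \<equiv> eval_closure X (topspace X)"

text \<open>In the notation of the overview: a(y, K) is at most \<open>p\<close>. Integer bounds
  keep the number of pieces of \<open>Y\<close> countable.\<close>

definition good :: "'b \<Rightarrow> (('a \<Rightarrow> real) \<Rightarrow> real) set \<Rightarrow> nat \<Rightarrow> bool" where
  "good y K p \<longleftrightarrow> (\<forall>f\<in>bdd_cont_funs X. \<forall>g\<in>bdd_cont_funs X.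
     (\<forall>\<xi>\<in>K. \<bar>\<xi> f - \<xi> g\<bar> < 1) \<longrightarrow> \<bar>T f y - T g y\<bar> \<le> real p)"

text \<open>For \<open>S = \<beta>X\<close> this is M(p, n). A smaller \<open>S\<close> confines the
  supports to a part of controlled dimension.\<close>

definition supported :: "(('a \<Rightarrow> real) \<Rightarrow> real) set \<Rightarrow> nat \<Rightarrow> nat \<Rightarrow> 'b set" where
  "supported S p n = {y \<in> topspace Y. \<exists>K. finite K \<and> K \<subseteq> S \<and> card K \<le> n \<and> good y K p}"

lemma ex_good:
  assumes "y \<in> topspace Y"
  obtains K p where "finite K" "K \<subseteq> topspace X" "good y (point_eval X ` K) p"
proof -
  obtain K p where K: "finite K" "K \<subseteq> topspace X"
      "\<forall>f\<in>bdd_cont_funs X. \<forall>g\<in>bdd_cont_funs X. (\<forall>x\<in>K. \<bar>f x - g x\<bar> < 1) \<longrightarrow> \<bar>T f y - T g y\<bar> \<le> real p"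
    using finite_support[OF assms] by (elim exE conjE) (rule that)
  have "good y (point_eval X ` K) p" unfolding good_def using K(3) by simp
  then show thesis using that K by blast
qed

text \<open>The constants 0 and p + 1 have preimages, and with empty support their values at
  \<open>y\<close> could differ by at most \<open>p\<close>.\<close>

lemma not_good_empty:
  assumes "y \<in> topspace Y"
  shows "\<not> good y {} p"
proof
  assume *: "good y {} p"
  define g where "g = (\<lambda>(i::nat) (y::'b). if i = 0 then 0 else real p + 1)"
  have "continuous_map Y euclideanreal (g i)" for i by (cases i) (auto simp: g_def)
  moreover have "\<bar>g i y\<bar> \<le> real p + 1" for i y by (auto simp: g_def)
  ultimately obtain f N where f: "\<forall>i. f i \<in> bdd_cont_funs X \<and> (\<forall>x\<in>topspace X. \<bar>f i x\<bar> \<le> N) \<and>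
      (\<forall>y\<in>topspace Y. T (f i) y = g i y)"
    using bounded_preimages[of g "real p + 1"] by blast
  have "\<bar>T (f 1) y - T (f 0) y\<bar> \<le> real p" using * f unfolding good_def by blast
  then show False using f assms by (simp add: g_def)
qed

text \<open>An interpolating \<open>h\<close> agrees with \<open>f\<close> on \<open>K\<close> and
  with \<open>g\<close> on the rest of \<open>L\<close>; on \<open>L\<close> it stays within 1 of
  \<open>g\<close> because \<open>f\<close> does so on the intersection. The two bounds then add
  up.\<close>

lemma good_Int:
  assumes K: "finite K" "K \<subseteq> \<beta>X" "good y K p" and L: "finite L" "L \<subseteq> \<beta>X" "good y L q"
  shows "good y (K \<inter> L) (p + q)"
  unfolding good_def
proof (intro ballI impI)
  fix f g assume f: "f \<in> bdd_cont_funs X" and g: "g \<in> bdd_cont_funs X"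
    and fg: "\<forall>\<xi>\<in>K \<inter> L. \<bar>\<xi> f - \<xi> g\<bar> < 1"
  obtain h where h: "h \<in> bdd_cont_funs X" "\<forall>\<xi>\<in>K \<union> L. \<xi> h = (if \<xi> \<in> K then \<xi> f else \<xi> g)"
    using eval_closure_interpolation[of "K \<union> L" X "\<lambda>\<xi>. if \<xi> \<in> K then \<xi> f else \<xi> g"] K L by auto
  have "\<bar>T f y - T h y\<bar> \<le> real p"
  proof -
    have "\<bar>\<xi> f - \<xi> h\<bar> < 1" if "\<xi> \<in> K" for \<xi> using that h(2)[rule_format, of \<xi>] by simp
    then show ?thesis using K(3) f h(1) unfolding good_def by blast
  qed
  moreover have "\<bar>T h y - T g y\<bar> \<le> real q"
  proof -
    have "\<bar>\<xi> h - \<xi> g\<bar> < 1" if "\<xi> \<in> L" for \<xi>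
      using that h(2)[rule_format, of \<xi>] fg[rule_format, of \<xi>] by (cases "\<xi> \<in> K") simp_all
    then show ?thesis using L(3) g h(1) unfolding good_def by blast
  qed
  ultimately show "\<bar>T f y - T g y\<bar> \<le> real (p + q)" by simp
qed

text \<open>The intersection of both sets has bound 2 p. As \<open>y\<close> lies outside
  \<open>supported \<beta>X (2 * p) n\<close>, it has n + 1 points and so equals both sets.\<close>

lemma good_unique:
  assumes y: "y \<in> topspace Y" "y \<notin> supported \<beta>X (2 * p) n"
    and K: "finite K" "K \<subseteq> \<beta>X" "card K \<le> Suc n" "good y K p"
    and L: "finite L" "L \<subseteq> \<beta>X" "card L \<le> Suc n" "good y L p"
  shows "K = L"
proof -
  have KL: "good y (K \<inter> L) (2 * p)" using good_Int[OF K(1,2,4) L(1,2,4)] by (simp add: mult_2)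
  have fin: "finite (K \<inter> L)" "K \<inter> L \<subseteq> \<beta>X" using K by auto
  have "\<not> card (K \<inter> L) \<le> n" using y KL fin unfolding supported_def by blast
  then have "card (K \<inter> L) = card K" "card (K \<inter> L) = card L"
    using K(3) L(3) card_mono[OF K(1), of "K \<inter> L"] card_mono[OF L(1), of "K \<inter> L"] by auto
  then have "K \<inter> L = K" "K \<inter> L = L"
    using card_subset_eq[OF K(1), of "K \<inter> L"] card_subset_eq[OF L(1), of "K \<inter> L"] by auto
  then show ?thesis by simp
qed

section \<open>Closedness of the sets of supported points\<close>

definition tuples :: "nat \<Rightarrow> (nat \<Rightarrow> ('a \<Rightarrow> real) \<Rightarrow> real) topology" where
  "tuples n = product_topology (\<lambda>_. subtopology (powertop_real (bdd_cont_funs X)) \<beta>X) {..<n}"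

lemma topspace_tuples: "topspace (tuples n) = {..<n} \<rightarrow>\<^sub>E \<beta>X"
proof -
  have "topspace (subtopology (powertop_real (bdd_cont_funs X)) \<beta>X) = \<beta>X"
    by (rule topspace_subtopology_subset) (rule closedin_subset[OF closedin_eval_closure])
  then show ?thesis unfolding tuples_def topspace_product_topology by simp
qed

lemma compact_space_tuples: "compact_space (tuples n)"
  unfolding tuples_def compact_space_product_topology
  by (intro disjI2 ballI compact_space_subtopology compactin_eval_closure order_refl)

lemma continuous_map_tuples:
  assumes "i < n" "f \<in> bdd_cont_funs X"
  shows "continuous_map (tuples n) euclideanreal (\<lambda>\<xi>. \<xi> i f)"
proof -
  have 1: "continuous_map (tuples n) (subtopology (powertop_real (bdd_cont_funs X)) \<beta>X) (\<lambda>\<xi>. \<xi> i)"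
    unfolding tuples_def by (rule continuous_map_product_projection) (use assms in simp)
  have 2: "continuous_map (subtopology (powertop_real (bdd_cont_funs X)) \<beta>X) euclideanreal (\<lambda>\<eta>. \<eta> f)"
    by (rule continuous_map_from_subtopology[OF continuous_map_eval[OF assms(2)]])
  show ?thesis using continuous_map_compose[OF 1 2] by (simp add: o_def)
qed

text \<open>For a tuple and a point \<open>y\<close>, being good is jointly a closed condition: for
  all \<open>f\<close>, \<open>g\<close> some coordinate separates them by at least 1, or
  \<open>T f y\<close> and \<open>T g y\<close> are within \<open>p\<close>. Projection along the
  compact space of tuples is closed. The parameter \<open>R\<close> adds a closed condition on
  supports: membership in a closed set, or not hitting a family.\<close>

lemma closedin_supported_tuples:
  assumes C: "closedin (tuples n) {\<xi> \<in> topspace (tuples n). R (\<xi> ` {..<n})}"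
  shows "closedin Y {y \<in> topspace Y. \<exists>K. finite K \<and> K \<subseteq> \<beta>X \<and> card K \<le> n \<and> good y K p \<and> R K}"
proof -
  let ?Z = "prod_topology (tuples n) Y"
  let ?C = "{\<xi> \<in> topspace (tuples n). R (\<xi> ` {..<n})}"
  define D where "D = (\<lambda>(f, g). {z \<in> topspace ?Z. \<exists>i\<in>{..<n}. 1 \<le> \<bar>fst z i f - fst z i g\<bar>} \<union>
     {z \<in> topspace ?Z. \<bar>T f (snd z) - T g (snd z)\<bar> \<le> real p})"
  define W where "W = \<Inter>(insert (?C \<times> topspace Y) (D ` (bdd_cont_funs X \<times> bdd_cont_funs X)))"
  have cf: "continuous_map ?Z euclideanreal (\<lambda>z. fst z i f)" if "i < n" "f \<in> bdd_cont_funs X" for i f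
    using continuous_map_compose[OF continuous_map_fst continuous_map_tuples[OF that]] by (simp add: o_def)
  have cT: "continuous_map ?Z euclideanreal (\<lambda>z. T f (snd z))" if "f \<in> bdd_cont_funs X" for f
    using continuous_map_compose[OF continuous_map_snd T_continuous[OF that]] by (simp add: o_def)
  have Dcl: "closedin ?Z (D (f, g))" if f: "f \<in> bdd_cont_funs X" and g: "g \<in> bdd_cont_funs X" for f g
    unfolding D_def prod.case
  proof (rule closedin_Un)
    have eq: "{z \<in> topspace ?Z. \<exists>i\<in>{..<n}. 1 \<le> \<bar>fst z i f - fst z i g\<bar>} =
        (\<Union>i\<in>{..<n}. {z \<in> topspace ?Z. 1 \<le> \<bar>fst z i f - fst z i g\<bar>})" by blast
    show "closedin ?Z {z \<in> topspace ?Z. \<exists>i\<in>{..<n}. 1 \<le> \<bar>fst z i f - fst z i g\<bar>}"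
      unfolding eq
    proof (rule closedin_Union)
      fix A assume "A \<in> (\<lambda>i. {z \<in> topspace ?Z. 1 \<le> \<bar>fst z i f - fst z i g\<bar>}) ` {..<n}"
      then obtain i where i: "i < n" "A = {z \<in> topspace ?Z. 1 \<le> \<bar>fst z i f - fst z i g\<bar>}" by auto
      show "closedin ?Z A" unfolding i(2)
        by (intro closedin_le continuous_map_real_abs continuous_map_diff cf f g i(1) continuous_map_canonical_const)
    qed simp
    show "closedin ?Z {z \<in> topspace ?Z. \<bar>T f (snd z) - T g (snd z)\<bar> \<le> real p}"
      by (intro closedin_le continuous_map_real_abs continuous_map_diff cT f g continuous_map_canonical_const)
  qed
  have "closedin ?Z W" unfolding W_def
  proof (rule closedin_Inter)
    fix A assume "A \<in> insert (?C \<times> topspace Y) (D ` (bdd_cont_funs X \<times> bdd_cont_funs X))"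
    then show "closedin ?Z A"
    proof
      assume "A = ?C \<times> topspace Y"
      then show ?thesis using C closedin_topspace by (simp add: closedin_prod_Times_iff)
    next
      assume "A \<in> D ` (bdd_cont_funs X \<times> bdd_cont_funs X)"
      then show ?thesis using Dcl by auto
    qed
  qed simp
  then have "closedin Y (snd ` W)"
    using closed_map_snd[OF compact_space_tuples] unfolding closed_map_def by blast
  moreover have "snd ` W = {y \<in> topspace Y. \<exists>K. finite K \<and> K \<subseteq> \<beta>X \<and> card K \<le> n \<and> good y K p \<and> R K}"
  proof (intro equalityI subsetI)
    fix y assume "y \<in> snd ` W"
    then obtain \<xi> where \<xi>: "(\<xi>, y) \<in> W" by auto
    then have \<xi>C: "\<xi> \<in> topspace (tuples n)" "R (\<xi> ` {..<n})" "y \<in> topspace Y" by (auto simp: W_def)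
    have "good y (\<xi> ` {..<n}) p"
      unfolding good_def
    proof (intro ballI impI)
      fix f g assume f: "f \<in> bdd_cont_funs X" and g: "g \<in> bdd_cont_funs X"
        and fg: "\<forall>\<zeta>\<in>\<xi> ` {..<n}. \<bar>\<zeta> f - \<zeta> g\<bar> < 1"
      have "(\<xi>, y) \<in> D (f, g)" using \<xi> f g unfolding W_def by blast
      then show "\<bar>T f y - T g y\<bar> \<le> real p" using fg by (auto simp: D_def not_le[symmetric])
    qed
    moreover have "\<xi> ` {..<n} \<subseteq> \<beta>X" using \<xi>C(1) unfolding topspace_tuples by blast
    moreover have "card (\<xi> ` {..<n}) \<le> n" using card_image_le[of "{..<n}" \<xi>] by simp
    ultimately show "y \<in> {y \<in> topspace Y. \<exists>K. finite K \<and> K \<subseteq> \<beta>X \<and> card K \<le> n \<and> good y K p \<and> R K}"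
      using \<xi>C by (intro CollectI conjI exI[of _ "\<xi> ` {..<n}"]) auto
  next
    fix y assume "y \<in> {y \<in> topspace Y. \<exists>K. finite K \<and> K \<subseteq> \<beta>X \<and> card K \<le> n \<and> good y K p \<and> R K}"
    then obtain K where y: "y \<in> topspace Y" and K: "finite K" "K \<subseteq> \<beta>X" "card K \<le> n" "good y K p" "R K"
      by blast
    \<comment> \<open>The empty set is not the image of a tuple unless n = 0, so it must be
      excluded.\<close>
    have "K \<noteq> {}" using not_good_empty[OF y] K(4) by blast
    obtain e where e: "e \<in> {..<n} \<rightarrow>\<^sub>E K" "e ` {..<n} = K"
      by (rule finite_enumeration[OF K(1) \<open>K \<noteq> {}\<close> K(3)])
    have eZ: "e \<in> topspace (tuples n)" using e(1) K(2) unfolding topspace_tuples by (auto simp: PiE_iff)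
    have "(e, y) \<in> D (f, g)" if f: "f \<in> bdd_cont_funs X" and g: "g \<in> bdd_cont_funs X" for f g
    proof (cases "\<exists>i\<in>{..<n}. 1 \<le> \<bar>e i f - e i g\<bar>")
      case True
      then show ?thesis using eZ y by (simp add: D_def)
    next
      case False
      then have "\<forall>\<zeta>\<in>K. \<bar>\<zeta> f - \<zeta> g\<bar> < 1" unfolding e(2)[symmetric] by (auto simp: not_le)
      then have "\<bar>T f y - T g y\<bar> \<le> real p" using K(4) f g unfolding good_def by blast
      then show ?thesis using eZ y by (simp add: D_def)
    qed
    then have "(e, y) \<in> W" unfolding W_def using eZ y K(5) e(2) by auto
    then show "y \<in> snd ` W" by force
  qed
  ultimately show ?thesis by simp
qed

lemma closedin_supported:
  assumes S: "closedin (powertop_real (bdd_cont_funs X)) S" "S \<subseteq> \<beta>X"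
  shows "closedin Y (supported S p n)"
proof -
  have "{\<xi> \<in> topspace (tuples n). \<xi> ` {..<n} \<subseteq> S} = {..<n} \<rightarrow>\<^sub>E S"
  proof (intro equalityI subsetI)
    fix \<xi> assume "\<xi> \<in> {\<xi> \<in> topspace (tuples n). \<xi> ` {..<n} \<subseteq> S}"
    then have "\<xi> \<in> extensional {..<n}" "\<xi> ` {..<n} \<subseteq> S" by (simp_all add: topspace_tuples PiE_iff)
    then show "\<xi> \<in> {..<n} \<rightarrow>\<^sub>E S" unfolding PiE_iff image_subset_iff by blast
  next
    fix \<xi> assume "\<xi> \<in> {..<n} \<rightarrow>\<^sub>E S"
    then show "\<xi> \<in> {\<xi> \<in> topspace (tuples n). \<xi> ` {..<n} \<subseteq> S}"
      using S(2) unfolding topspace_tuples PiE_iff image_subset_iff mem_Collect_eq by blast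
  qed
  moreover have "closedin (tuples n) ({..<n} \<rightarrow>\<^sub>E S)"
    unfolding tuples_def closedin_product_topology using S by (simp add: closedin_subset_topspace)
  ultimately have "closedin (tuples n) {\<xi> \<in> topspace (tuples n). \<xi> ` {..<n} \<subseteq> S}" by simp
  from closedin_supported_tuples[OF this, of p]
  moreover have "{y \<in> topspace Y. \<exists>K. finite K \<and> K \<subseteq> \<beta>X \<and> card K \<le> n \<and> good y K p \<and> K \<subseteq> S} = supported S p n"
    unfolding supported_def using S(2) by blast
  ultimately show ?thesis by simp
qed

text \<open>A basic neighbourhood of the Vietoris topology: the nonvanishing sets of the members of
  \<open>I\<close> cover \<open>K\<close>, and \<open>K\<close> meets each of them.\<close>

definition hits :: "(('a \<Rightarrow> real) \<Rightarrow> real) set \<Rightarrow> ('a \<Rightarrow> real) set \<Rightarrow> bool" where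
  "hits K I \<longleftrightarrow> (\<forall>\<xi>\<in>K. \<exists>q\<in>I. \<xi> q \<noteq> 0) \<and> (\<forall>q\<in>I. \<exists>\<xi>\<in>K. \<xi> q \<noteq> 0)"

text \<open>On a piece where supports are unique, the complement of this set consists of the
  \<open>y\<close> whose support hits \<open>I\<close>; this is the continuous dependence of the
  support on \<open>y\<close>.\<close>

lemma closedin_not_hits:
  assumes I: "finite I" "I \<subseteq> bdd_cont_funs X"
  shows "closedin Y {y \<in> topspace Y. \<exists>K. finite K \<and> K \<subseteq> \<beta>X \<and> card K \<le> n \<and> good y K p \<and> \<not> hits K I}"
proof (rule closedin_supported_tuples)
  let ?Z = "tuples n"
  have o: "openin ?Z {\<xi> \<in> topspace ?Z. \<xi> i q \<noteq> 0}" if "i \<in> {..<n}" "q \<in> I" for i q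
    by (rule openin_neq_0[OF continuous_map_tuples]) (use that I in auto)
  have 1: "openin ?Z {\<xi> \<in> topspace ?Z. \<forall>i\<in>{..<n}. \<exists>q\<in>I. \<xi> i q \<noteq> 0}"
    by (intro openin_finite_Ball openin_Bex o finite_lessThan)
  have 2: "openin ?Z {\<xi> \<in> topspace ?Z. \<forall>q\<in>I. \<exists>i\<in>{..<n}. \<xi> i q \<noteq> 0}"
    by (intro openin_finite_Ball openin_Bex o I(1))
  have "{\<xi> \<in> topspace ?Z. \<not> hits (\<xi> ` {..<n}) I} = topspace ?Z -
     ({\<xi> \<in> topspace ?Z. \<forall>i\<in>{..<n}. \<exists>q\<in>I. \<xi> i q \<noteq> 0} \<inter> {\<xi> \<in> topspace ?Z. \<forall>q\<in>I. \<exists>i\<in>{..<n}. \<xi> i q \<noteq> 0})"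
    unfolding hits_def by auto
  then show "closedin ?Z {\<xi> \<in> topspace ?Z. \<not> hits (\<xi> ` {..<n}) I}"
    using openin_Int[OF 1 2] by auto
qed

end

section \<open>Lifting, pigeonhole and the splitting of pieces\<close>

context inversely_bounded_operator
begin

text \<open>One bound \<open>N\<close> for all \<open>U\<close>, obtained by summing: the number of
  lifts that the pigeonhole argument needs is then the same for all of them.\<close>

lemma bounded_preimages_family:
  assumes "finite \<U>"
    and "\<And>U i. U \<in> \<U> \<Longrightarrow> continuous_map Y euclideanreal (g U (i::nat))"
    and "\<And>U i y. U \<in> \<U> \<Longrightarrow> y \<in> topspace Y \<Longrightarrow> \<bar>g U i y\<bar> \<le> M"
  shows "\<exists>f N. \<forall>U\<in>\<U>. \<forall>i. f U i \<in> bdd_cont_funs X \<and> (\<forall>x\<in>topspace X. \<bar>f U i x\<bar> \<le> N) \<and>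
    (\<forall>y\<in>topspace Y. T (f U i) y = g U i y)"
proof -
  have "\<exists>z. \<forall>i. fst z i \<in> bdd_cont_funs X \<and> (\<forall>x\<in>topspace X. \<bar>fst z i x\<bar> \<le> snd z) \<and>
      (\<forall>y\<in>topspace Y. T (fst z i) y = g U i y)" if U: "U \<in> \<U>" for U
    using bounded_preimages[OF assms(2,3)[OF U]] by auto
  then have "\<forall>U\<in>\<U>. \<exists>z. \<forall>i. fst z i \<in> bdd_cont_funs X \<and> (\<forall>x\<in>topspace X. \<bar>fst z i x\<bar> \<le> snd z) \<and>
      (\<forall>y\<in>topspace Y. T (fst z i) y = g U i y)" ..
  from bchoice[OF this] obtain z where z: "\<forall>U\<in>\<U>. \<forall>i. fst (z U) i \<in> bdd_cont_funs X \<and>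
      (\<forall>x\<in>topspace X. \<bar>fst (z U) i x\<bar> \<le> snd (z U)) \<and> (\<forall>y\<in>topspace Y. T (fst (z U) i) y = g U i y)" ..
  define N where "N = (\<Sum>U\<in>\<U>. \<bar>snd (z U)\<bar>)"
  have N: "snd (z U) \<le> N" if "U \<in> \<U>" for U
  proof -
    have "\<bar>snd (z U)\<bar> \<le> N" unfolding N_def by (rule member_le_sum[OF that _ assms(1)]) simp
    then show ?thesis by linarith
  qed
  show ?thesis
  proof (intro exI[of _ "\<lambda>U. fst (z U)"] exI[of _ N] ballI allI conjI)
    fix U i assume U: "U \<in> \<U>"
    show "fst (z U) i \<in> bdd_cont_funs X" using z U by simp
    show "T (fst (z U) i) y = g U i y" if "y \<in> topspace Y" for y using z U that by simp
    show "\<bar>fst (z U) i x\<bar> \<le> N" if "x \<in> topspace X" for x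
      using z[rule_format, OF U, of i] that N[OF U] order_trans by blast
  qed
qed

text \<open>Rounding the numbers \<open>4 * \<xi> (f i)\<close> down leaves at most \<open>D\<close>
  values for each of at most \<open>n\<close> points, so two of the indices up to
  \<open>D ^ n\<close> agree. The bound depends only on \<open>N\<close> and \<open>n\<close>, not
  on \<open>K\<close>, so a finite set of lifts serves all supports.\<close>

lemma pigeonhole_close:
  fixes f :: "nat \<Rightarrow> 'a \<Rightarrow> real" and N :: real
  assumes f: "\<And>i. f i \<in> bdd_cont_funs X" and N: "\<And>i x. x \<in> topspace X \<Longrightarrow> \<bar>f i x\<bar> \<le> N"
    and K: "finite K" "K \<subseteq> \<beta>X" "card K \<le> n"
  obtains l m where "l < m" "m \<le> (nat \<lceil>16 * \<bar>N\<bar> + 4\<rceil>) ^ n" "\<And>\<xi>. \<xi> \<in> K \<Longrightarrow> \<bar>\<xi> (f l) - \<xi> (f m)\<bar> < 1/2"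
proof -
  define J where "J = {\<lfloor>- 4 * \<bar>N\<bar>\<rfloor>..\<lfloor>4 * \<bar>N\<bar>\<rfloor>}"
  define D where "D = nat \<lceil>16 * \<bar>N\<bar> + 4\<rceil>"
  define v where "v = (\<lambda>i. \<lambda>\<xi>\<in>K. \<lfloor>4 * \<xi> (f i)\<rfloor>)"
  have D1: "1 \<le> D" unfolding D_def by linarith
  have cardJ: "card J \<le> D" unfolding J_def D_def card_atLeastAtMost_int by linarith
  have vJ: "v i \<in> K \<rightarrow>\<^sub>E J" for i
  proof -
    have "\<lfloor>4 * \<xi> (f i)\<rfloor> \<in> J" if "\<xi> \<in> K" for \<xi>
    proof -
      have "\<bar>\<xi> (f i)\<bar> \<le> N" by (rule eval_closure_bound[OF subsetD[OF K(2) that] f N])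
      then have "\<lfloor>- 4 * \<bar>N\<bar>\<rfloor> \<le> \<lfloor>4 * \<xi> (f i)\<rfloor>" "\<lfloor>4 * \<xi> (f i)\<rfloor> \<le> \<lfloor>4 * \<bar>N\<bar>\<rfloor>" by (intro floor_mono; linarith)+
      then show ?thesis unfolding J_def by simp
    qed
    then show ?thesis unfolding v_def by (rule restrict_PiE_iff[THEN iffD2, rule_format])
  qed
  have "card (K \<rightarrow>\<^sub>E J) = card J ^ card K" using K(1) by (simp add: card_PiE)
  also have "\<dots> \<le> D ^ card K" using cardJ by (rule power_mono) simp
  also have "\<dots> \<le> D ^ n" using D1 K(3) by (intro power_increasing)
  finally have "card (K \<rightarrow>\<^sub>E J) < card {..D ^ n}" by simp
  moreover have "finite (K \<rightarrow>\<^sub>E J)" using K(1) by (intro finite_PiE) (auto simp: J_def)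
  ultimately have "\<not> inj_on v {..D ^ n}"
    using vJ card_inj_on_le[of v "{..D ^ n}" "K \<rightarrow>\<^sub>E J"] by fastforce
  then obtain a b where "a \<in> {..D ^ n}" "b \<in> {..D ^ n}" "v a = v b" "a \<noteq> b" unfolding inj_on_def by blast
  then obtain l m where lm: "l < m" "m \<le> D ^ n" "v l = v m" by (metis atMost_iff linorder_neqE_nat)
  have "\<bar>\<xi> (f l) - \<xi> (f m)\<bar> < 1/2" if "\<xi> \<in> K" for \<xi>
  proof -
    have "\<lfloor>4 * \<xi> (f l)\<rfloor> = \<lfloor>4 * \<xi> (f m)\<rfloor>" using fun_cong[OF lm(3), of \<xi>] that by (simp add: v_def)
    then show ?thesis by linarith
  qed
  then show thesis using that[of l m] lm unfolding D_def by blast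
qed

text \<open>A family hit by \<open>K\<close> lies inside the set \<open>J\<close> of functions that
  are nonzero somewhere on \<open>K\<close>, and \<open>J\<close> has at most n (d + 1) elements.
  For d = 0 each point has at most one such function, which must belong to \<open>I\<close>, so only
  \<open>I = J\<close> is left; this is what preserves dimension 0.\<close>

lemma card_hits_le:
  assumes Q: "finite \<Q>" and K: "finite K" "card K \<le> n"
    and ord: "\<And>\<xi>. \<xi> \<in> K \<Longrightarrow> card {q \<in> \<Q>. \<xi> q \<noteq> 0} \<le> d + 1"
  shows "card {I. I \<subseteq> \<Q> \<and> hits K I} \<le> (if d = 0 then 1 else 2 ^ (n * (d + 1)))"
proof -
  define J where "J = (\<Union>\<xi>\<in>K. {q \<in> \<Q>. \<xi> q \<noteq> 0})"
  have finJ: "finite J" unfolding J_def using Q K by simp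
  have sub: "I \<subseteq> J" if "I \<subseteq> \<Q>" "hits K I" for I using that unfolding hits_def J_def by blast
  show ?thesis
  proof (cases "d = 0")
    case True
    have "J \<subseteq> I" if I: "I \<subseteq> \<Q>" "hits K I" for I
    proof
      fix q assume "q \<in> J"
      then obtain \<xi> where \<xi>: "\<xi> \<in> K" "q \<in> \<Q>" "\<xi> q \<noteq> 0" unfolding J_def by blast
      obtain q' where q': "q' \<in> I" "\<xi> q' \<noteq> 0" using I(2) \<xi>(1) unfolding hits_def by blast
      have "card {q \<in> \<Q>. \<xi> q \<noteq> 0} \<le> Suc 0" using ord[OF \<xi>(1)] True by simp
      then have "q = q'" using card_le_Suc0_iff_eq[of "{q \<in> \<Q>. \<xi> q \<noteq> 0}"] Q \<xi> q' I(1) by auto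
      then show "q \<in> I" using q' by simp
    qed
    then have "{I. I \<subseteq> \<Q> \<and> hits K I} \<subseteq> {J}" using sub by blast
    then have "card {I. I \<subseteq> \<Q> \<and> hits K I} \<le> card {J}" by (intro card_mono) simp
    then show ?thesis using True by simp
  next
    case False
    have "card J \<le> (\<Sum>\<xi>\<in>K. card {q \<in> \<Q>. \<xi> q \<noteq> 0})" unfolding J_def by (rule card_UN_le[OF K(1)])
    also have "\<dots> \<le> (\<Sum>\<xi>\<in>K. d + 1)" by (intro sum_mono ord)
    also have "\<dots> = card K * (d + 1)" by simp
    also have "\<dots> \<le> n * (d + 1)" using K(2) by (rule mult_le_mono1)
    finally have J: "card J \<le> n * (d + 1)" .
    have "card {I. I \<subseteq> \<Q> \<and> hits K I} \<le> card (Pow J)"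
      using sub finJ by (intro card_mono) auto
    also have "\<dots> = 2 ^ card J" using finJ by (rule card_Pow)
    also have "\<dots> \<le> 2 ^ (n * (d + 1))" using J by (intro power_increasing) auto
    finally show ?thesis using False by simp
  qed
qed

text \<open>
  If infinitely many bounded functions of \<open>h\<close> that are far apart at the values \<open>(1/3) ^ m\<close> are
  lifted, two of the lifts are close on a small piece of the supports, so \<open>h\<close> must omit one of
  these values on the corresponding piece of \<open>N\<close>, which therefore splits there.
\<close>

lemma omitted_value:
  fixes h :: real
  assumes h: "h = (1/3) ^ m" and lm: "l < m"
    and fl: "T fl y = 2 * (real p + 1) * min 1 (3 ^ l * h)" "fl \<in> bdd_cont_funs X"
    and fm: "T fm y = 2 * (real p + 1) * min 1 (3 ^ m * h)" "fm \<in> bdd_cont_funs X"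
    and good: "good y K p" and close: "\<And>\<xi>. \<xi> \<in> K \<Longrightarrow> \<bar>\<xi> fl - \<xi> fm\<bar> < 1"
  shows False
proof -
  \<comment> \<open>At the value \<open>h = (1/3) ^ m\<close> the lift with index \<open>m\<close>
    reaches the full height 2 (p + 1), the one with index \<open>l\<close> at most a third of it;
    the gap of 4 (p + 1) / 3 exceeds \<open>p\<close>.\<close>
  have m: "3 ^ m * h = 1" unfolding h by (simp add: power_mult_distrib[symmetric])
  have "(3::real) ^ l * 3 \<le> 3 ^ m" using power_increasing[of "Suc l" m "3::real"] lm by simp
  then have "3 ^ l * h * 3 \<le> 3 ^ m * h" unfolding h by (simp add: field_simps)
  then have "min 1 (3 ^ l * h) \<le> 1/3" using m by simp
  then have "T fl y \<le> 2 * (real p + 1) * (1/3)" unfolding fl(1) by (intro mult_left_mono) auto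
  moreover have "T fm y = 2 * (real p + 1)" using fm m by simp
  moreover have "\<bar>T fl y - T fm y\<bar> \<le> real p" using good fl(2) fm(2) close unfolding good_def by blast
  moreover have "0 \<le> real p" by simp
  ultimately show False by argo
qed

text \<open>On \<open>N\<close> the support \<open>K y\<close> is unique, and \<open>N\<close> is
  the union of the relatively open sets \<open>V I\<close> of points whose support hits
  \<open>I\<close>. On each \<open>V I\<close> every \<open>h U\<close> omits a value, so the sets
  where \<open>h U\<close> exceeds it are clopen in \<open>V I\<close> and can be made disjoint.
  Uniting over \<open>I\<close> yields at most as many indices at \<open>y\<close> as there are
  families hit by \<open>K y\<close>.\<close>

lemma refinable_supported:
  assumes Y: "normal_space Y" and S: "S \<subseteq> \<beta>X" and sc: "small_covers X S d"
    and N: "N \<subseteq> supported S p (Suc n)" and Nn: "N \<inter> supported \<beta>X (2 * p) n = {}"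
  shows "refinable Y N (if d = 0 then 1 else 2 ^ (Suc n * (d + 1)))"
  unfolding refinable_def
proof (intro allI impI)
  fix \<U> F assume fin: "finite \<U>" and UF: "\<forall>U\<in>\<U>. openin Y U \<and> closedin Y (F U) \<and> F U \<subseteq> U"
    and cov: "N \<subseteq> (\<Union>U\<in>\<U>. F U)"
  have NY: "N \<subseteq> topspace Y" using N unfolding supported_def by blast
  have "\<forall>y\<in>N. \<exists>K. finite K \<and> K \<subseteq> S \<and> card K \<le> Suc n \<and> good y K p"
    using N unfolding supported_def by blast
  from bchoice[OF this] obtain K where K: "\<forall>y\<in>N. finite (K y) \<and> K y \<subseteq> S \<and> card (K y) \<le> Suc n \<and> good y (K y) p" ..
  have K\<beta>: "K y \<subseteq> \<beta>X" if "y \<in> N" for y using K S that by blast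
  \<comment> \<open>Uniqueness holds among all supports in \<open>\<beta>X\<close>, the range over
    which \<open>closedin_not_hits\<close> quantifies.\<close>
  have uniq: "L = K y" if "y \<in> N" "finite L" "L \<subseteq> \<beta>X" "card L \<le> Suc n" "good y L p" for y L
    by (rule good_unique[of y p n]) (use that K K\<beta> NY Nn in auto)
  have "\<exists>h. continuous_map Y euclideanreal h \<and> (\<forall>y\<in>topspace Y. 0 \<le> h y \<and> h y \<le> 1) \<and>
      (\<forall>y\<in>F U. h y = 1) \<and> (\<forall>y\<in>topspace Y - U. h y = 0)" if U: "U \<in> \<U>" for U
  proof -
    have "closedin Y (topspace Y - U)" "closedin Y (F U)" "disjnt (topspace Y - U) (F U)"
      using UF U unfolding disjnt_def by blast+
    then obtain h :: "'b \<Rightarrow> real" where h: "continuous_map Y (top_of_set {0..1}) h" "h ` (topspace Y - U) \<subseteq> {0}" "h ` F U \<subseteq> {1}"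
      using Urysohn_lemma[OF Y, of "topspace Y - U" "F U" 0 1] by (metis zero_le_one)
    have "continuous_map Y euclideanreal h \<and> h \<in> topspace Y \<rightarrow> {0..1}"
      using h(1) unfolding continuous_map_in_subtopology by auto
    then show ?thesis using h(2,3) by (intro exI[of _ h]) auto
  qed
  then have "\<forall>U\<in>\<U>. \<exists>h. continuous_map Y euclideanreal h \<and> (\<forall>y\<in>topspace Y. 0 \<le> h y \<and> h y \<le> 1) \<and>
      (\<forall>y\<in>F U. h y = 1) \<and> (\<forall>y\<in>topspace Y - U. h y = 0)" ..
  from bchoice[OF this] obtain h where h: "\<forall>U\<in>\<U>. continuous_map Y euclideanreal (h U) \<and>
      (\<forall>y\<in>topspace Y. 0 \<le> h U y \<and> h U y \<le> 1) \<and> (\<forall>y\<in>F U. h U y = 1) \<and> (\<forall>y\<in>topspace Y - U. h U y = 0)" ..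
  have hc: "continuous_map Y euclideanreal (h U)" if "U \<in> \<U>" for U using h that by simp
  \<comment> \<open>Two thirds of the height 2 (p + 1) exceed \<open>p\<close>; the slope
    \<open>3 ^ i\<close> moves the transition to values of \<open>h U\<close> below
    \<open>(1/3) ^ i\<close>.\<close>
  define g where "g = (\<lambda>U (i::nat) y. 2 * (real p + 1) * min 1 (3 ^ i * h U y))"
  have gc: "continuous_map Y euclideanreal (g U i)" if "U \<in> \<U>" for U i unfolding g_def
    by (intro continuous_map_real_mult_left continuous_map_real_min continuous_map_canonical_const hc that)
  have gb: "\<bar>g U i y\<bar> \<le> 2 * (real p + 1)" if "U \<in> \<U>" "y \<in> topspace Y" for U i y
  proof -
    have "0 \<le> h U y" using h that by simp
    then have "0 \<le> min 1 (3 ^ i * h U y)" "min 1 (3 ^ i * h U y) \<le> 1" by auto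
    then have "0 \<le> g U i y" "g U i y \<le> 2 * (real p + 1) * 1"
      unfolding g_def by (auto intro!: mult_left_mono mult_nonneg_nonneg simp del: mult_1_right)
    then show ?thesis by simp
  qed
  obtain f M where f: "\<forall>U\<in>\<U>. \<forall>i. f U i \<in> bdd_cont_funs X \<and> (\<forall>x\<in>topspace X. \<bar>f U i x\<bar> \<le> M) \<and>
    (\<forall>y\<in>topspace Y. T (f U i) y = g U i y)"
    using bounded_preimages_family[of \<U> g, OF fin gc gb] by blast
  \<comment> \<open>The pigeonhole bound is known before the cover \<open>\<Q>\<close> is chosen;
    \<open>\<F>\<close> collects all lifts that can occur.\<close>
  define L where "L = (nat \<lceil>16 * \<bar>M\<bar> + 4\<rceil>) ^ Suc n"
  define \<F> where "\<F> = (\<lambda>(U, i). f U i) ` (\<U> \<times> {..L})"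
  have fF: "f U i \<in> \<F>" if "U \<in> \<U>" "i \<le> L" for U i unfolding \<F>_def using that by force
  have "finite \<F> \<and> \<F> \<subseteq> bdd_cont_funs X" unfolding \<F>_def using fin f by auto
  from sc[unfolded small_covers_def, rule_format, OF this]
  obtain \<Q> where Q: "finite \<Q>" "\<Q> \<subseteq> bdd_cont_funs X" "\<forall>\<xi>\<in>S. \<exists>q\<in>\<Q>. \<xi> q \<noteq> 0"
     "\<forall>\<xi>\<in>S. card {q\<in>\<Q>. \<xi> q \<noteq> 0} \<le> d + 1"
     "\<forall>q\<in>\<Q>. \<forall>\<xi>\<in>S. \<forall>\<eta>\<in>S. \<xi> q \<noteq> 0 \<and> \<eta> q \<noteq> 0 \<longrightarrow> (\<forall>f\<in>\<F>. \<bar>\<xi> f - \<eta> f\<bar> < 1/4)"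
    by (elim exE conjE) (rule that)
  define V where "V = (\<lambda>I. {y \<in> N. hits (K y) I})"
  have Vo: "openin (subtopology Y N) (V I)" if I: "I \<subseteq> \<Q>" for I
  proof -
    let ?C = "{y \<in> topspace Y. \<exists>K. finite K \<and> K \<subseteq> \<beta>X \<and> card K \<le> Suc n \<and> good y K p \<and> \<not> hits K I}"
    have "closedin Y ?C"
      by (rule closedin_not_hits) (use I Q finite_subset in blast)+
    moreover have "V I = (topspace Y - ?C) \<inter> N"
    proof (intro equalityI subsetI)
      fix y assume "y \<in> V I"
      then have y: "y \<in> N" "hits (K y) I" by (auto simp: V_def)
      have "y \<notin> ?C" using uniq[OF y(1)] y(2) by blast
      then show "y \<in> (topspace Y - ?C) \<inter> N" using y NY by blast
    next
      fix y assume y: "y \<in> (topspace Y - ?C) \<inter> N"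
      have "finite (K y) \<and> K y \<subseteq> \<beta>X \<and> card (K y) \<le> Suc n \<and> good y (K y) p"
        using K K\<beta> y by blast
      then have "hits (K y) I" using y by blast
      then show "y \<in> V I" using y unfolding V_def by blast
    qed
    ultimately show ?thesis unfolding openin_subtopology by blast
  qed
  have "\<exists>t. 0 < t \<and> t < 1 \<and> (\<forall>y\<in>V I. h U y \<noteq> t)" if I: "I \<subseteq> \<Q>" and U: "U \<in> \<U>" for I U
  proof (cases "V I = {}")
    case True
    then show ?thesis by (intro exI[of _ "1/2"]) auto
  next
    case False
    then obtain y0 where y0: "y0 \<in> N" "hits (K y0) I" unfolding V_def by blast
    \<comment> \<open>One reference point suffices: each \<open>\<xi>\<close> in the support of
      another point of \<open>V I\<close> shares a member of \<open>I\<close> with some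
      \<open>\<eta>\<close> in \<open>K y0\<close>. The errors, below 1/4, 1/2 and 1/4, add up to
      less than 1.\<close>
    obtain l m where lm: "l < m" "m \<le> (nat \<lceil>16 * \<bar>M\<bar> + 4\<rceil>) ^ Suc n"
        "\<And>\<xi>. \<xi> \<in> K y0 \<Longrightarrow> \<bar>\<xi> (f U l) - \<xi> (f U m)\<bar> < 1/2"
    proof (rule pigeonhole_close[of "f U" M "K y0" "Suc n"])
      show "f U i \<in> bdd_cont_funs X" for i using f U by simp
      show "\<bar>f U i x\<bar> \<le> M" if "x \<in> topspace X" for i x using f U that by simp
      show "finite (K y0)" "card (K y0) \<le> Suc n" using K y0(1) by simp_all
      show "K y0 \<subseteq> \<beta>X" using K\<beta> y0(1) by simp
    qed (rule that)
    have "h U y \<noteq> (1/3) ^ m" if y: "y \<in> V I" for y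
    proof
      assume hy: "h U y = (1/3) ^ m"
      have yN: "y \<in> N" "hits (K y) I" using y by (simp_all add: V_def)
      then have yY: "y \<in> topspace Y" using NY by blast
      show False
      proof (rule omitted_value[OF hy lm(1)])
        show "T (f U l) y = 2 * (real p + 1) * min 1 (3 ^ l * h U y)"
          "T (f U m) y = 2 * (real p + 1) * min 1 (3 ^ m * h U y)"
          using f U yY by (simp_all add: g_def)
        show "f U l \<in> bdd_cont_funs X" "f U m \<in> bdd_cont_funs X" using f U by simp_all
        show "good y (K y) p" using K yN(1) by simp
        show "\<bar>\<xi> (f U l) - \<xi> (f U m)\<bar> < 1" if \<xi>: "\<xi> \<in> K y" for \<xi>
        proof -
          obtain q where q: "q \<in> I" "\<xi> q \<noteq> 0" using yN(2) \<xi> unfolding hits_def by blast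
          obtain \<eta> where \<eta>: "\<eta> \<in> K y0" "\<eta> q \<noteq> 0" using y0(2) q(1) unfolding hits_def by blast
          have "\<xi> \<in> S" "\<eta> \<in> S" "q \<in> \<Q>" using K yN(1) \<xi> y0(1) \<eta> I q by blast+
          then have "\<forall>f\<in>\<F>. \<bar>\<xi> f - \<eta> f\<bar> < 1/4" using Q(5) q(2) \<eta>(2) by blast
          moreover have "f U l \<in> \<F>" "f U m \<in> \<F>" using fF[OF U] lm(1,2) unfolding L_def by auto
          ultimately have "\<bar>\<xi> (f U l) - \<eta> (f U l)\<bar> < 1/4" "\<bar>\<xi> (f U m) - \<eta> (f U m)\<bar> < 1/4" by blast+
          then show ?thesis using lm(3)[OF \<eta>(1)] by linarith
        qed
      qed
    qed
    moreover have "(1/3::real) ^ m < 1"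
    proof -
      have "(1/3::real) ^ m \<le> (1/3) ^ 1" using lm(1) by (intro power_decreasing) auto
      then show ?thesis by simp
    qed
    ultimately show ?thesis by (intro exI[of _ "(1/3) ^ m"]) auto
  qed
  then have "\<forall>z\<in>Pow \<Q> \<times> \<U>. \<exists>t. 0 < t \<and> t < 1 \<and> (\<forall>y\<in>V (fst z). h (snd z) y \<noteq> t)" by auto
  from bchoice[OF this] obtain t0 where t0: "\<forall>z\<in>Pow \<Q> \<times> \<U>. 0 < t0 z \<and> t0 z < 1 \<and> (\<forall>y\<in>V (fst z). h (snd z) y \<noteq> t0 z)" ..
  define t where "t = (\<lambda>I U. t0 (I, U))"
  have t: "0 < t I U" "t I U < 1" "\<And>y. y \<in> V I \<Longrightarrow> h U y \<noteq> t I U" if "I \<subseteq> \<Q>" "U \<in> \<U>" for I U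
    using t0[rule_format, of "(I, U)"] that by (simp_all add: t_def)
  define P where "P = (\<lambda>I U. {y \<in> V I. t I U < h U y})"
  have "\<exists>D. (\<forall>U\<in>\<U>. openin (subtopology Y N) (D U) \<and> D U \<subseteq> P I U) \<and> V I \<subseteq> (\<Union>U\<in>\<U>. D U) \<and>
      (\<forall>U\<in>\<U>. \<forall>U'\<in>\<U>. U \<noteq> U' \<longrightarrow> D U \<inter> D U' = {})" if I: "I \<subseteq> \<Q>" for I
  proof -
    obtain D where D: "\<And>i. i \<in> \<U> \<Longrightarrow> D i \<subseteq> P I i" "(\<Union>i\<in>\<U>. D i) = (\<Union>i\<in>\<U>. P I i)"
      "\<And>i j. i \<in> \<U> \<Longrightarrow> j \<in> \<U> \<Longrightarrow> i \<noteq> j \<Longrightarrow> D i \<inter> D j = {}"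
      "\<And>i. i \<in> \<U> \<Longrightarrow> \<exists>K. K \<subseteq> \<U> \<and> D i = P I i - (\<Union>k\<in>K. P I k)"
      by (rule disjoint_refinement[OF fin, of "P I"]) (rule that; assumption)
    have "openin (subtopology Y N) (D U)" if U: "U \<in> \<U>" for U
    proof -
      obtain B where B: "B \<subseteq> \<U>" "D U = P I U - (\<Union>k\<in>B. P I k)" using D(4)[OF U] by blast
      \<comment> \<open>Because \<open>h k\<close> omits \<open>t I k\<close> on \<open>V I\<close>,
        not exceeding that value means staying below it, an open condition; this makes the
        differences open.\<close>
      let ?G = "{y \<in> topspace Y. t I U < h U y} \<inter> {y \<in> topspace Y. \<forall>k\<in>B. h k y < t I k}"
      have "openin Y ?G"
        using B(1) finite_subset[OF B(1) fin]
        by (intro openin_Int openin_finite_Ball openin_less continuous_map_canonical_const hc U) blast+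
      then have "openin (subtopology Y N) (?G \<inter> N)" unfolding openin_subtopology by blast
      from openin_Int[OF this Vo[OF I]] have "openin (subtopology Y N) (?G \<inter> N \<inter> V I)" .
      moreover have "D U = ?G \<inter> N \<inter> V I"
      proof (intro equalityI subsetI)
        fix y assume y: "y \<in> D U"
        then have yV: "y \<in> V I" "t I U < h U y" "\<And>k. k \<in> B \<Longrightarrow> y \<notin> P I k" unfolding B(2) by (auto simp: P_def)
        have "h k y < t I k" if k: "k \<in> B" for k
          using yV(3)[OF k] yV(1) t(3)[OF I _ yV(1), of k] k B(1) by (force simp: P_def)
        moreover have "y \<in> N" using yV(1) by (simp add: V_def)
        moreover have "y \<in> topspace Y" using \<open>y \<in> N\<close> NY by blast
        ultimately show "y \<in> ?G \<inter> N \<inter> V I" using yV by blast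
      next
        fix y assume "y \<in> ?G \<inter> N \<inter> V I"
        then show "y \<in> D U" unfolding B(2) P_def by force
      qed
      ultimately show ?thesis by simp
    qed
    moreover have "V I \<subseteq> (\<Union>U\<in>\<U>. D U)"
    proof
      fix y assume y: "y \<in> V I"
      then have "y \<in> N" by (simp add: V_def)
      then obtain U where U: "U \<in> \<U>" "y \<in> F U" using cov by blast
      then have "h U y = 1" using h by simp
      then have "y \<in> P I U" using y t(2)[OF I U(1)] by (simp add: P_def)
      then show "y \<in> (\<Union>U\<in>\<U>. D U)" using U(1) unfolding D(2) by blast
    qed
    ultimately have "(\<forall>U\<in>\<U>. openin (subtopology Y N) (D U) \<and> D U \<subseteq> P I U) \<and> V I \<subseteq> (\<Union>U\<in>\<U>. D U) \<and>
      (\<forall>U\<in>\<U>. \<forall>U'\<in>\<U>. U \<noteq> U' \<longrightarrow> D U \<inter> D U' = {})"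
      by (intro conjI ballI impI D(1,3))
    then show ?thesis by (rule exI[of _ D])
  qed
  then have "\<forall>I\<in>Pow \<Q>. \<exists>D. (\<forall>U\<in>\<U>. openin (subtopology Y N) (D U) \<and> D U \<subseteq> P I U) \<and> V I \<subseteq> (\<Union>U\<in>\<U>. D U) \<and>
      (\<forall>U\<in>\<U>. \<forall>U'\<in>\<U>. U \<noteq> U' \<longrightarrow> D U \<inter> D U' = {})" by simp
  from bchoice[OF this] obtain D where D: "\<forall>I\<in>Pow \<Q>. (\<forall>U\<in>\<U>. openin (subtopology Y N) (D I U) \<and> D I U \<subseteq> P I U) \<and>
      V I \<subseteq> (\<Union>U\<in>\<U>. D I U) \<and> (\<forall>U\<in>\<U>. \<forall>U'\<in>\<U>. U \<noteq> U' \<longrightarrow> D I U \<inter> D I U' = {})" ..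
  have Do: "openin (subtopology Y N) (D I U)" and DP: "D I U \<subseteq> P I U" if "I \<in> Pow \<Q>" "U \<in> \<U>" for I U
    using D that by simp_all
  have Dcov: "V I \<subseteq> (\<Union>U\<in>\<U>. D I U)" if "I \<in> Pow \<Q>" for I using D that by simp
  have Ddisj: "D I U \<inter> D I U' = {}" if "I \<in> Pow \<Q>" "U \<in> \<U>" "U' \<in> \<U>" "U \<noteq> U'" for I U U'
    using D that by simp
  define W where "W = (\<lambda>U. \<Union>I\<in>Pow \<Q>. D I U)"
  show "\<exists>W. (\<forall>U\<in>\<U>. openin (subtopology Y N) (W U) \<and> W U \<subseteq> U) \<and> N \<subseteq> (\<Union>U\<in>\<U>. W U) \<and>
      (\<forall>y\<in>N. card {U\<in>\<U>. y \<in> W U} \<le> (if d = 0 then 1 else 2 ^ (Suc n * (d + 1))))"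
  proof (intro exI[of _ W] conjI ballI)
    fix U assume U: "U \<in> \<U>"
    show "openin (subtopology Y N) (W U)" unfolding W_def using Do[OF _ U] by (intro openin_Union) blast
    show "W U \<subseteq> U"
    proof
      fix y assume "y \<in> W U"
      then obtain I where I: "I \<subseteq> \<Q>" "y \<in> D I U" unfolding W_def by blast
      then have "y \<in> P I U" using DP[of I U] U by blast
      then have y: "y \<in> N" "t I U < h U y" by (simp_all add: P_def V_def)
      then have "0 < h U y" using t(1)[OF I(1) U] by linarith
      show "y \<in> U"
      proof (rule ccontr)
        assume "y \<notin> U"
        then have "h U y = 0" using h U y(1) NY by blast
        then show False using \<open>0 < h U y\<close> by simp
      qed
    qed
  next
    show "N \<subseteq> (\<Union>U\<in>\<U>. W U)"
    proof
      fix y assume y: "y \<in> N"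
      define I where "I = {q \<in> \<Q>. \<exists>\<xi>\<in>K y. \<xi> q \<noteq> 0}"
      have "hits (K y) I" unfolding hits_def I_def using Q(3) K y by blast
      then have "y \<in> V I" using y by (simp add: V_def)
      moreover have IQ: "I \<in> Pow \<Q>" by (auto simp: I_def)
      ultimately obtain U where "U \<in> \<U>" "y \<in> D I U" using Dcov[of I] by blast
      then show "y \<in> (\<Union>U\<in>\<U>. W U)" unfolding W_def using IQ by blast
    qed
  next
    fix y assume y: "y \<in> N"
    \<comment> \<open>Each index \<open>U\<close> at \<open>y\<close> is charged to a family
      \<open>I\<close> with \<open>y\<close> in \<open>D I U\<close>; for fixed \<open>I\<close>
      these sets are disjoint, so no family is charged twice.\<close>
    have "\<forall>U\<in>{U\<in>\<U>. y \<in> W U}. \<exists>I. I \<in> Pow \<Q> \<and> y \<in> D I U" unfolding W_def by blast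
    from bchoice[OF this] obtain J where J: "\<forall>U\<in>{U\<in>\<U>. y \<in> W U}. J U \<in> Pow \<Q> \<and> y \<in> D (J U) U" ..
    have "inj_on J {U\<in>\<U>. y \<in> W U}"
    proof (rule inj_onI)
      fix U U' assume UU: "U \<in> {U\<in>\<U>. y \<in> W U}" "U' \<in> {U\<in>\<U>. y \<in> W U}" "J U = J U'"
      have a: "J U \<in> Pow \<Q>" "y \<in> D (J U) U" using J UU(1) by blast+
      have b: "y \<in> D (J U) U'" using J UU(2) unfolding UU(3) by blast
      show "U = U'"
      proof (rule ccontr)
        assume "U \<noteq> U'"
        then have "D (J U) U \<inter> D (J U) U' = {}" using UU(1,2) by (intro Ddisj a(1)) simp_all
        then show False using a(2) b by blast
      qed
    qed
    moreover have "J ` {U\<in>\<U>. y \<in> W U} \<subseteq> {I. I \<subseteq> \<Q> \<and> hits (K y) I}"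
    proof (rule image_subsetI)
      fix U assume U: "U \<in> {U\<in>\<U>. y \<in> W U}"
      then have a: "J U \<in> Pow \<Q>" "y \<in> D (J U) U" using J by blast+
      then have "y \<in> P (J U) U" using DP[of "J U" U] U by blast
      then show "J U \<in> {I. I \<subseteq> \<Q> \<and> hits (K y) I}" using a(1) by (simp add: P_def V_def)
    qed
    moreover have "finite {I. I \<subseteq> \<Q> \<and> hits (K y) I}" using Q(1) by simp
    ultimately have "card {U\<in>\<U>. y \<in> W U} \<le> card {I. I \<subseteq> \<Q> \<and> hits (K y) I}" by (rule card_inj_on_le)
    also have "\<dots> \<le> (if d = 0 then 1 else 2 ^ (Suc n * (d + 1)))"
    proof (rule card_hits_le[OF Q(1)])
      show "finite (K y)" "card (K y) \<le> Suc n" using K y by simp_all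
      show "card {q \<in> \<Q>. \<xi> q \<noteq> 0} \<le> d + 1" if "\<xi> \<in> K y" for \<xi> using Q(4) K y that by blast
    qed
    finally show "card {U\<in>\<U>. y \<in> W U} \<le> (if d = 0 then 1 else 2 ^ (Suc n * (d + 1)))" .
  qed
qed

end

subsection \<open>From supports to dimension\<close>

context inversely_bounded_operator
begin

lemma supported_mono: "S \<subseteq> S' \<Longrightarrow> supported S p n \<subseteq> supported S' p n"
  unfolding supported_def by blast

text \<open>Take the least \<open>m\<close> such that some \<open>K\<close> in
  \<open>\<beta>X\<close> with at most \<open>m\<close> points is good at \<open>y\<close> for some
  bound. Intersecting with a good finite set of evaluations cannot lower the count below
  \<open>m\<close>, so \<open>K\<close> itself consists of evaluations at points of
  \<open>X\<close>.\<close>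

lemma ex_supported:
  assumes y: "y \<in> topspace Y"
  obtains p n K where "finite K" "K \<subseteq> topspace X"
    "y \<in> supported (point_eval X ` K) p (Suc n) - supported \<beta>X (2 * p) n"
proof -
  obtain K0 p0 where K0: "finite K0" "K0 \<subseteq> topspace X" "good y (point_eval X ` K0) p0"
    by (rule ex_good[OF y])
  have K0\<beta>: "point_eval X ` K0 \<subseteq> \<beta>X"
    using K0(2) by (intro image_subsetI point_eval_in_eval_closure) (rule subsetD)
  have "\<exists>n. \<exists>p. y \<in> supported \<beta>X p n"
    using y K0 K0\<beta> unfolding supported_def
    by (intro exI[of _ "card (point_eval X ` K0)"] exI[of _ p0] CollectI conjI exI[of _ "point_eval X ` K0"]) auto
  define m where "m = (LEAST n. \<exists>p. y \<in> supported \<beta>X p n)"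
  have "\<exists>p. y \<in> supported \<beta>X p m" unfolding m_def by (rule LeastI_ex) fact
  then obtain p where "y \<in> supported \<beta>X p m" ..
  then obtain K where K: "finite K" "K \<subseteq> \<beta>X" "card K \<le> m" "good y K p" unfolding supported_def by blast
  have least: "y \<notin> supported \<beta>X q i" if "i < m" for q i
    using not_less_Least[of i "\<lambda>n. \<exists>p. y \<in> supported \<beta>X p n"] that unfolding m_def by blast
  have "K \<noteq> {}" using K(4) not_good_empty[OF y] by blast
  then have "m \<noteq> 0" using K(1,3) by auto
  then obtain n where n: "m = Suc n" by (cases m) auto
  have "good y (K \<inter> point_eval X ` K0) (p + p0)"
    using good_Int[OF K(1,2,4) _ K0\<beta> K0(3)] K0(1) by simp
  then have "\<not> card (K \<inter> point_eval X ` K0) < m"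
    using least y K(1,2) unfolding supported_def by blast
  then have "card K \<le> card (K \<inter> point_eval X ` K0)" using K(3) by linarith
  then have "K \<inter> point_eval X ` K0 = K" using card_seteq[OF K(1), of "K \<inter> point_eval X ` K0"] by blast
  then have "y \<in> supported (point_eval X ` K0) p (Suc n)" using y K unfolding supported_def n by blast
  then show thesis using that[OF K0(1,2), of p n] least[of n "2 * p"] by (simp add: n)
qed

text \<open>A finite support lies in a finite union of parts of \<open>X\<close>; there are
  countably many such unions, and they are again finite dimensional. As the parts are arbitrary
  sets, supports are kept among genuine evaluations.\<close>

lemma countable_dimensional_image:
  assumes X: "perfectly_normal_space X" and Y: "perfectly_normal_space Y"
    and cd: "countable_dimensional_space X"
  shows "countable_dimensional_space Y"
proof -
  obtain \<A> where A: "countable \<A>" "\<Union>\<A> = topspace X"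
     "\<And>A. A \<in> \<A> \<Longrightarrow> finite_dimensional_space (subtopology X A)"
    using cd unfolding countable_dimensional_space_def by blast
  define Z where "Z = (\<lambda>(p, n, \<C>). supported (point_eval X ` \<Union>\<C>) p (Suc n) - supported \<beta>X (2 * p) n)"
  define I where "I = (UNIV :: nat set) \<times> (UNIV :: nat set) \<times> {\<C>. finite \<C> \<and> \<C> \<subseteq> \<A>}"
  have "countable I" unfolding I_def by (intro countable_SIGMA countable_Collect_finite_subset A(1)) auto
  then have "countable (Z ` I)" by (rule countable_image)
  moreover have "\<Union>(Z ` I) = topspace Y"
  proof (intro equalityI subsetI)
    fix y assume "y \<in> \<Union>(Z ` I)"
    then show "y \<in> topspace Y" unfolding Z_def supported_def by auto
  next
    fix y assume y: "y \<in> topspace Y"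
    obtain p n K where K: "finite K" "K \<subseteq> topspace X"
      "y \<in> supported (point_eval X ` K) p (Suc n) - supported \<beta>X (2 * p) n"
      by (rule ex_supported[OF y])
    have "K \<subseteq> \<Union>\<A>" using K(2) A(2) by simp
    then obtain \<C> where C: "finite \<C>" "\<C> \<subseteq> \<A>" "K \<subseteq> \<Union>\<C>"
      by (rule finite_subset_Union[OF K(1)])
    have "y \<in> Z (p, n, \<C>)" unfolding Z_def prod.case
      using K(3) supported_mono[OF image_mono[OF C(3)]] by blast
    moreover have "(p, n, \<C>) \<in> I" unfolding I_def using C by simp
    ultimately show "y \<in> \<Union>(Z ` I)" by blast
  qed
  moreover have "finite_dimensional_space (subtopology Y B)" if B: "B \<in> Z ` I" for B
  proof -
    obtain p n \<C> where C: "finite \<C>" "\<C> \<subseteq> \<A>" "B = Z (p, n, \<C>)" using B unfolding I_def by auto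
    have sub: "\<Union>\<C> \<subseteq> topspace X" using C(2) A(2) by blast
    have "finite_dimensional_space (subtopology X (\<Union>\<C>))"
      using C A sub by (intro finite_dimensional_space_Union[OF X]) auto
    then obtain d where "covering_dim_le (subtopology X (\<Union>\<C>)) d" unfolding finite_dimensional_space_def ..
    then have sc: "small_covers X (point_eval X ` \<Union>\<C>) d" by (rule small_covers_point_eval[OF X sub])
    have S: "point_eval X ` \<Union>\<C> \<subseteq> \<beta>X"
      using sub by (intro image_subsetI point_eval_in_eval_closure) (rule subsetD)
    have norm: "normal_space Y" using Y by (simp add: perfectly_normal_space_def)
    have "covering_dim_le (subtopology Y B) (2 * (if d = 0 then 1 else 2 ^ (Suc n * (d + 1))))"
    proof (rule refinable_imp_covering_dim_le[OF Y])
      show "B \<subseteq> topspace Y" unfolding C(3) Z_def supported_def by auto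
      show "refinable Y M (if d = 0 then 1 else 2 ^ (Suc n * (d + 1)))" if "M \<subseteq> B" for M
        by (rule refinable_supported[OF norm S sc, of _ p]) (use that in \<open>auto simp: C(3) Z_def\<close>)
    qed
    then show ?thesis unfolding finite_dimensional_space_def by blast
  qed
  moreover have "normal_space (subtopology Y B)" for B
    by (rule perfectly_normal_space_imp_normal_subtopology[OF Y])
  moreover have "normal_space Y" using Y by (simp add: perfectly_normal_space_def)
  ultimately show ?thesis unfolding countable_dimensional_space_def
    by (intro conjI exI[of _ "Z ` I"] ballI)
qed

text \<open>Perfect normality of \<open>Y\<close> turns the removed closed set into a
  G-delta.\<close>

lemma supported_Diff_fsigma:
  assumes Y: "perfectly_normal_space Y"
    and S: "closedin (powertop_real (bdd_cont_funs X)) S" "S \<subseteq> \<beta>X"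
  shows "\<exists>C. (\<forall>l::nat. closedin Y (C l)) \<and> (\<Union>l. C l) = supported S p (Suc n) - supported \<beta>X (2 * p) n"
proof -
  have "closedin Y (supported \<beta>X (2 * p) n)"
    by (rule closedin_supported[OF closedin_eval_closure order_refl])
  then have "gdelta_in Y (supported \<beta>X (2 * p) n)" using Y by (simp add: perfectly_normal_space_def)
  with closed_imp_fsigma_in[OF closedin_supported[OF S]]
  have "fsigma_in Y (supported S p (Suc n) - supported \<beta>X (2 * p) n)" by (rule fsigma_in_diff)
  then show ?thesis unfolding fsigma_in_ascending by blast
qed

text \<open>Closures of the sets of evaluations take their place: then \<open>supported\<close> is
  closed by compactness, and the difference is an F-sigma set whose closed members are the parts of
  \<open>Y\<close>. The fine covers extend to these closures because finite unions of the parts of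
  \<open>X\<close> are closed.\<close>

lemma strongly_countable_dimensional_image:
  assumes X: "perfectly_normal_space X" and Y: "perfectly_normal_space Y"
    and scd: "strongly_countable_dimensional_space X"
  shows "strongly_countable_dimensional_space Y"
proof -
  obtain \<A> where A: "countable \<A>" "\<Union>\<A> = topspace X"
     "\<And>A. A \<in> \<A> \<Longrightarrow> closedin X A \<and> finite_dimensional_space (subtopology X A)"
    using scd unfolding strongly_countable_dimensional_space_def by blast
  define Z where "Z = (\<lambda>(p, n, \<C>). supported (eval_closure X (\<Union>\<C>)) p (Suc n) - supported \<beta>X (2 * p) n)"
  define J where "J = {\<C>. finite \<C> \<and> \<C> \<subseteq> \<A>}"
  define I where "I = (UNIV :: nat set) \<times> (UNIV :: nat set) \<times> J"
  have JX: "\<Union>\<C> \<subseteq> topspace X" if "\<C> \<in> J" for \<C> using that A(2) unfolding J_def by blast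
  have S: "eval_closure X (\<Union>\<C>) \<subseteq> \<beta>X" if "\<C> \<in> J" for \<C> using JX[OF that] by (rule eval_closure_mono)
  have "\<exists>C. (\<forall>l::nat. closedin Y (C l)) \<and> (\<Union>l. C l) = Z i" if i: "i \<in> I" for i
  proof -
    obtain p n \<C> where "i = (p, n, \<C>)" "\<C> \<in> J" using i unfolding I_def by auto
    then show ?thesis using supported_Diff_fsigma[OF Y closedin_eval_closure S] unfolding Z_def by simp
  qed
  then have "\<forall>i\<in>I. \<exists>C. (\<forall>l::nat. closedin Y (C l)) \<and> (\<Union>l. C l) = Z i" ..
  from bchoice[OF this] obtain C where C: "\<forall>i\<in>I. (\<forall>l::nat. closedin Y (C i l)) \<and> (\<Union>l. C i l) = Z i" ..
  define \<B> where "\<B> = (\<lambda>(i, l). C i l) ` (I \<times> UNIV)"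
  have "countable I" unfolding I_def J_def by (intro countable_SIGMA countable_Collect_finite_subset A(1)) auto
  then have "countable \<B>" unfolding \<B>_def by (intro countable_image countable_SIGMA) auto
  moreover have "\<Union>\<B> = topspace Y"
  proof (intro equalityI subsetI)
    fix y assume "y \<in> \<Union>\<B>"
    then obtain i l where i: "i \<in> I" "y \<in> C i l" unfolding \<B>_def by auto
    then show "y \<in> topspace Y" using C closedin_subset by blast
  next
    fix y assume y: "y \<in> topspace Y"
    obtain p n K where K: "finite K" "K \<subseteq> topspace X"
      "y \<in> supported (point_eval X ` K) p (Suc n) - supported \<beta>X (2 * p) n"
      by (rule ex_supported[OF y])
    have "K \<subseteq> \<Union>\<A>" using K(2) A(2) by simp
    then obtain \<C> where \<C>: "finite \<C>" "\<C> \<subseteq> \<A>" "K \<subseteq> \<Union>\<C>"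
      by (rule finite_subset_Union[OF K(1)])
    have "point_eval X ` K \<subseteq> eval_closure X (\<Union>\<C>)"
      using \<C>(3) by (intro image_subsetI point_eval_in_eval_closure) (rule subsetD)
    then have yZ: "y \<in> Z (p, n, \<C>)" unfolding Z_def prod.case
      using K(3) supported_mono by blast
    have i: "(p, n, \<C>) \<in> I" unfolding I_def J_def using \<C> by simp
    then have "(\<Union>l. C (p, n, \<C>) l) = Z (p, n, \<C>)" using C by blast
    then obtain l where "y \<in> C (p, n, \<C>) l" using yZ by blast
    then show "y \<in> \<Union>\<B>" unfolding \<B>_def using i by force
  qed
  moreover have "closedin Y B \<and> finite_dimensional_space (subtopology Y B)" if B: "B \<in> \<B>" for B
  proof -
    obtain p n \<C> l where \<C>: "\<C> \<in> J" "B = C (p, n, \<C>) l" using B unfolding I_def \<B>_def by auto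
    have i: "(p, n, \<C>) \<in> I" unfolding I_def using \<C> by simp
    have cl: "closedin Y B" using C i unfolding \<C>(2) by blast
    have "(\<Union>l. C (p, n, \<C>) l) = Z (p, n, \<C>)" using C i by blast
    then have BZ: "B \<subseteq> Z (p, n, \<C>)" unfolding \<C>(2) by blast
    have fC: "finite \<C>" "\<C> \<subseteq> \<A>" using \<C>(1) by (simp_all add: J_def)
    have "finite_dimensional_space (subtopology X (\<Union>\<C>))"
    proof (rule finite_dimensional_space_Union[OF X fC(1)])
      fix A assume "A \<in> \<C>"
      then show "A \<subseteq> topspace X \<and> finite_dimensional_space (subtopology X A)"
        using A(3) fC(2) closedin_subset by blast
    qed
    then obtain d where d: "covering_dim_le (subtopology X (\<Union>\<C>)) d" unfolding finite_dimensional_space_def ..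
    have "closedin X (\<Union>\<C>)" by (rule closedin_Union[OF fC(1)]) (use A(3) fC(2) in blast)
    from small_covers_eval_closure[OF X this d]
    have sc: "small_covers X (eval_closure X (\<Union>\<C>)) d" .
    have norm: "normal_space Y" using Y by (simp add: perfectly_normal_space_def)
    have "covering_dim_le (subtopology Y B) (2 * (if d = 0 then 1 else 2 ^ (Suc n * (d + 1))))"
    proof (rule refinable_imp_covering_dim_le[OF Y closedin_subset[OF cl]])
      show "refinable Y M (if d = 0 then 1 else 2 ^ (Suc n * (d + 1)))" if "M \<subseteq> B" for M
        by (rule refinable_supported[OF norm S[OF \<C>(1)] sc, of _ p]) (use that BZ in \<open>auto simp: Z_def\<close>)
    qed
    then show ?thesis using cl unfolding finite_dimensional_space_def by blast
  qed
  moreover have "normal_space Y" using Y by (simp add: perfectly_normal_space_def)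
  ultimately show ?thesis unfolding strongly_countable_dimensional_space_def
    by (intro conjI exI[of _ \<B>] ballI) auto
qed

text \<open>Passing through \<open>refinable_imp_covering_dim_le\<close> would only give dimension
  2. Instead the closed pieces are partitioned directly and the partitions are summed over
  \<open>Y\<close>.\<close>

lemma zero_dimensional_image:
  assumes X: "perfectly_normal_space X" and Y: "perfectly_normal_space Y"
    and zd: "zero_dimensional_space X"
  shows "zero_dimensional_space Y"
proof -
  have norm: "normal_space Y" using Y by (simp add: perfectly_normal_space_def)
  have sc: "small_covers X \<beta>X 0"
    using zd by (intro small_covers_eval_closure[OF X]) (simp_all add: zero_dimensional_space_def)
  define Z where "Z = (\<lambda>p n. supported \<beta>X p (Suc n) - supported \<beta>X (2 * p) n)"
  have "\<exists>C. (\<forall>l::nat. closedin Y (C l)) \<and> (\<Union>l. C l) = Z (fst i) (snd i)" for i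
    unfolding Z_def by (rule supported_Diff_fsigma[OF Y closedin_eval_closure order_refl])
  then have "\<forall>i. \<exists>C. (\<forall>l::nat. closedin Y (C l)) \<and> (\<Union>l. C l) = Z (fst i) (snd i)" ..
  from choice[OF this] obtain C where C: "\<forall>i. (\<forall>l::nat. closedin Y (C i l)) \<and> (\<Union>l. C i l) = Z (fst i) (snd i)" ..
  \<comment> \<open>A single number encodes \<open>p\<close>, \<open>n\<close> and the index of the
    closed member.\<close>
  define N where "N = (\<lambda>k. C (prod_decode (fst (prod_decode k))) (snd (prod_decode k)))"
  have "clopen_separated Y (N k)" for k
  proof (rule refinable_1_imp_clopen_separated[OF norm])
    obtain p n where pn: "prod_decode (fst (prod_decode k)) = (p, n)" by (cases "prod_decode (fst (prod_decode k))")
    show "closedin Y (N k)" unfolding N_def using C by blast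
    have "(\<Union>l. C (p, n) l) = Z p n" using C by simp
    then have "N k \<subseteq> Z p n" unfolding N_def pn by blast
    then have "N k \<subseteq> supported \<beta>X p (Suc n)" "N k \<inter> supported \<beta>X (2 * p) n = {}" unfolding Z_def by blast+
    from refinable_supported[OF norm order_refl sc this] show "refinable Y (N k) 1" by simp
  qed
  moreover have "(\<Union>k. N k) = topspace Y"
  proof (intro equalityI subsetI)
    fix y assume "y \<in> (\<Union>k. N k)"
    then obtain k where "y \<in> N k" by blast
    then show "y \<in> topspace Y" unfolding N_def using C closedin_subset by blast
  next
    fix y assume y: "y \<in> topspace Y"
    obtain p n K where K: "finite K" "K \<subseteq> topspace X"
      "y \<in> supported (point_eval X ` K) p (Suc n) - supported \<beta>X (2 * p) n"
      by (rule ex_supported[OF y])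
    have "point_eval X ` K \<subseteq> \<beta>X"
      using K(2) by (intro image_subsetI point_eval_in_eval_closure) (rule subsetD)
    then have "y \<in> Z p n" unfolding Z_def using K(3) supported_mono by blast
    moreover have "(\<Union>l. C (p, n) l) = Z p n" using C by simp
    ultimately obtain l where "y \<in> C (p, n) l" by blast
    then have "y \<in> N (prod_encode (prod_encode (p, n), l))" by (simp add: N_def)
    then show "y \<in> (\<Union>k. N k)" by blast
  qed
  ultimately have "clopen_separated Y (topspace Y)" by (rule clopen_separated_countable_Union[OF norm])
  then show ?thesis unfolding zero_dimensional_space_def by (rule clopen_separated_imp_covering_dim_le_0[OF Y])
qed

end

section \<open>Extracting the properties of \<open>T\<close> from the hypotheses\<close>

lemma abs_le_sup_norm:
  assumes "f \<in> bdd_cont_funs X" "x \<in> topspace X"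
  shows "\<bar>f x\<bar> \<le> sup_norm X f"
proof -
  obtain M where M: "\<And>x. x \<in> topspace X \<Longrightarrow> \<bar>f x\<bar> \<le> M" using assms(1) by (auto simp: bdd_cont_funs_iff)
  have "bdd_above (insert 0 ((\<lambda>x. \<bar>f x\<bar>) ` topspace X))"
    by (rule bdd_aboveI[of _ "max 0 M"]) (use M in \<open>auto simp: le_max_iff_disj\<close>)
  then show ?thesis unfolding sup_norm_def using assms(2) by (intro cSup_upper) auto
qed

lemma sup_norm_le:
  assumes "0 \<le> M" "\<And>x. x \<in> topspace X \<Longrightarrow> \<bar>f x\<bar> \<le> M"
  shows "sup_norm X f \<le> M"
  unfolding sup_norm_def by (rule cSup_least) (use assms in auto)

lemma pointwise_nhds_zero:
  assumes V: "openin (pointwise_topology X D) V" "zero_fun X \<in> V"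
  obtains K e where "finite K" "K \<subseteq> topspace X" "0 < e"
    "\<And>f. f \<in> D \<Longrightarrow> f \<in> extensional (topspace X) \<Longrightarrow> \<forall>x\<in>K. \<bar>f x\<bar> < e \<Longrightarrow> f \<in> V"
proof -
  obtain G where G: "openin (powertop_real (topspace X)) G" "V = G \<inter> D"
    using V(1) unfolding pointwise_topology_def openin_subtopology by blast
  then have "zero_fun X \<in> G" using V(2) by blast
  then obtain U where U: "finite {x \<in> topspace X. U x \<noteq> topspace euclideanreal}"
      "\<forall>x\<in>topspace X. openin euclideanreal (U x)" "zero_fun X \<in> Pi\<^sub>E (topspace X) U" "Pi\<^sub>E (topspace X) U \<subseteq> G"
    using G(1) unfolding openin_product_topology_alt by meson
  define K where "K = {x \<in> topspace X. U x \<noteq> UNIV}"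
  have K: "finite K" using U(1) by (simp add: K_def)
  have "\<exists>e>0. \<forall>r. \<bar>r\<bar> < e \<longrightarrow> r \<in> U x" if x: "x \<in> K" for x
  proof -
    have "x \<in> topspace X" using x by (simp add: K_def)
    then have "open (U x)" "0 \<in> U x" using U(2,3) by (auto simp: zero_fun_def PiE_iff)
    then obtain e where "0 < e" "ball 0 e \<subseteq> U x" by (meson openE)
    then show ?thesis by (intro exI[of _ e]) (auto simp: subset_iff)
  qed
  then have "\<forall>x\<in>K. \<exists>e. 0 < e \<and> (\<forall>r. \<bar>r\<bar> < e \<longrightarrow> r \<in> U x)" by blast
  from bchoice[OF this] obtain \<epsilon> where \<epsilon>: "\<forall>x\<in>K. 0 < \<epsilon> x \<and> (\<forall>r. \<bar>r\<bar> < \<epsilon> x \<longrightarrow> r \<in> U x)" ..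
  \<comment> \<open>The inserted 1 covers the case of empty \<open>K\<close>.\<close>
  define e where "e = Min (insert 1 (\<epsilon> ` K))"
  show thesis
  proof (rule that[OF K])
    show "K \<subseteq> topspace X" by (auto simp: K_def)
    show "0 < e" unfolding e_def using K \<epsilon> by (subst Min_gr_iff) auto
    fix f assume f: "f \<in> D" "f \<in> extensional (topspace X)" "\<forall>x\<in>K. \<bar>f x\<bar> < e"
    have "f x \<in> U x" if x: "x \<in> topspace X" for x
    proof (cases "x \<in> K")
      case True
      have "e \<le> \<epsilon> x" unfolding e_def using K True by simp
      then have "\<bar>f x\<bar> < \<epsilon> x" using f(3) True by fastforce
      then show ?thesis using \<epsilon> True by blast
    next
      case False
      then show ?thesis using x by (simp add: K_def)
    qed
    then have "f \<in> Pi\<^sub>E (topspace X) U" using f(2) by (simp add: PiE_iff)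
    then show "f \<in> V" using U(4) G(2) f(1) by blast
  qed
qed

text \<open>Uniform continuity gives for each \<open>y\<close> a finite \<open>K\<close> and an
  \<open>e\<close> such that differences below \<open>e\<close> on \<open>K\<close> change the value
  at \<open>y\<close> by less than 1. Going from \<open>g\<close> to \<open>f\<close> along a
  segment in n > 1/e equal steps turns this into the threshold 1 with bound
  \<open>n\<close>.\<close>

lemma inversely_bounded_operatorI:
  assumes DX: "DX = cont_funs X \<or> DX = bdd_cont_funs X"
    and DY: "DY = cont_funs Y \<or> DY = bdd_cont_funs Y"
    and uc: "uniformly_continuous_p X DX Y DY T"
    and ib: "inversely_bounded X DX Y DY T"
  shows "inversely_bounded_operator X Y T"
proof
  have bX: "f \<in> DX" if "f \<in> bdd_cont_funs X" for f using that DX by (auto simp: bdd_cont_funs_def)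
  have cY: "continuous_map Y euclideanreal h" if "h \<in> DY" for h
    using that DY by (auto simp: bdd_cont_funs_def cont_funs_def)
  have TD: "T f \<in> DY" if "f \<in> bdd_cont_funs X" for f
    using uc bX[OF that] unfolding uniformly_continuous_p_def by blast
  show "continuous_map Y euclideanreal (T f)" if "f \<in> bdd_cont_funs X" for f
    by (rule cY[OF TD[OF that]])
  show "\<exists>K p. finite K \<and> K \<subseteq> topspace X \<and> (\<forall>f\<in>bdd_cont_funs X. \<forall>g\<in>bdd_cont_funs X.
      (\<forall>x\<in>K. \<bar>f x - g x\<bar> < 1) \<longrightarrow> \<bar>T f y - T g y\<bar> \<le> real p)" if y: "y \<in> topspace Y" for y
  proof -
    define U where "U = {h \<in> topspace (powertop_real (topspace Y)). \<bar>h y\<bar> < 1} \<inter> DY"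
    have "openin (powertop_real (topspace Y)) {h \<in> topspace (powertop_real (topspace Y)). \<bar>h y\<bar> < 1}"
      by (intro openin_less continuous_map_real_abs continuous_map_product_projection y continuous_map_canonical_const)
    then have Uo: "openin (pointwise_topology Y DY) U"
      unfolding pointwise_topology_def openin_subtopology U_def by blast
    have "zero_fun Y \<in> bdd_cont_funs Y"
      unfolding zero_fun_def by (rule restrict_in_bdd_cont_funs[of _ _ 0]) auto
    then have "zero_fun Y \<in> DY" using DY by (auto simp: bdd_cont_funs_def)
    then have "zero_fun Y \<in> U" using y by (simp add: U_def zero_fun_def)
    with uc Uo obtain V where V: "openin (pointwise_topology X DX) V" "zero_fun X \<in> V"
        "\<forall>f\<in>DX. \<forall>g\<in>DX. diff_fun X f g \<in> V \<longrightarrow> diff_fun Y (T f) (T g) \<in> U"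
      unfolding uniformly_continuous_p_def by blast
    obtain K e where K: "finite K" "K \<subseteq> topspace X" "0 < e"
      "\<And>f. f \<in> DX \<Longrightarrow> f \<in> extensional (topspace X) \<Longrightarrow> \<forall>x\<in>K. \<bar>f x\<bar> < e \<Longrightarrow> f \<in> V"
      by (rule pointwise_nhds_zero[OF V(1,2)]) (rule that; assumption)
    have close: "\<bar>T f y - T g y\<bar> < 1" if f: "f \<in> bdd_cont_funs X" and g: "g \<in> bdd_cont_funs X"
      and fg: "\<And>x. x \<in> K \<Longrightarrow> \<bar>f x - g x\<bar> < e" for f g
    proof -
      have eq: "diff_fun X f g = (\<lambda>x\<in>topspace X. 1 * f x + (- 1) * g x + 0)" by (simp add: diff_fun_def)
      have "diff_fun X f g \<in> V"
      proof (rule K(4))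
        show "diff_fun X f g \<in> DX" unfolding eq by (rule bX[OF bdd_cont_funs_affine[OF f g]])
        show "diff_fun X f g \<in> extensional (topspace X)" by (simp add: diff_fun_def)
        show "\<forall>x\<in>K. \<bar>diff_fun X f g x\<bar> < e"
          using fg K(2) by (simp add: diff_fun_def subset_iff)
      qed
      then have "diff_fun Y (T f) (T g) \<in> U" using V(3) bX f g by blast
      then show ?thesis using y by (simp add: U_def diff_fun_def)
    qed
    define n where "n = Suc (nat \<lceil>1 / e\<rceil>)"
    have n: "0 < real n" "1 / real n < e"
    proof -
      show "0 < real n" by (simp add: n_def)
      have "1 / e < real n" unfolding n_def by linarith
      then show "1 / real n < e" using K(3) \<open>0 < real n\<close> by (simp add: field_simps)
    qed
    have "\<bar>T f y - T g y\<bar> \<le> real n" if f: "f \<in> bdd_cont_funs X" and g: "g \<in> bdd_cont_funs X"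
      and fg: "\<forall>x\<in>K. \<bar>f x - g x\<bar> < 1" for f g
    proof -
      define w where "w = (\<lambda>j::nat. \<lambda>x\<in>topspace X. (real j / real n) * f x + (1 - real j / real n) * g x + 0)"
      have w: "w j \<in> bdd_cont_funs X" for j unfolding w_def by (rule bdd_cont_funs_affine[OF f g])
      have ext: "f \<in> extensional (topspace X)" "g \<in> extensional (topspace X)"
        using f g by (simp_all add: bdd_cont_funs_iff)
      have w0: "w 0 = g" by (rule extensionalityI[of _ "topspace X"]) (use ext in \<open>auto simp: w_def\<close>)
      have wn: "w n = f" by (rule extensionalityI[of _ "topspace X"]) (use ext n in \<open>auto simp: w_def\<close>)
      have step: "\<bar>T (w (Suc j)) y - T (w j) y\<bar> < 1" for j
      proof (rule close[OF w w])
        fix x assume x: "x \<in> K"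
        then have xX: "x \<in> topspace X" using K(2) by blast
        have "w (Suc j) x - w j x = (f x - g x) / real n"
          using xX n(1) by (simp add: w_def field_simps)
        then have "\<bar>w (Suc j) x - w j x\<bar> = \<bar>f x - g x\<bar> / real n" using n(1) by simp
        also have "\<dots> \<le> 1 / real n" using fg x n(1) by (intro divide_right_mono) auto
        finally show "\<bar>w (Suc j) x - w j x\<bar> < e" using n(2) by linarith
      qed
      have "\<bar>T (w j) y - T (w 0) y\<bar> \<le> real j" for j
      proof (induction j)
        case (Suc j)
        then show ?case using step[of j] by simp
      qed simp
      from this[of n] show ?thesis by (simp only: w0 wn)
    qed
    then show ?thesis using K(1,2) by blast
  qed
  show "\<exists>f N. \<forall>i. f i \<in> bdd_cont_funs X \<and> (\<forall>x\<in>topspace X. \<bar>f i x\<bar> \<le> N) \<and> (\<forall>y\<in>topspace Y. T (f i) y = g i y)"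
    if gc: "\<And>i::nat. continuous_map Y euclideanreal (g i)" and gb: "\<And>i y. y \<in> topspace Y \<Longrightarrow> \<bar>g i y\<bar> \<le> M"
    for g M
  proof -
    define G where "G = (\<lambda>i. restrict (g i) (topspace Y))"
    have G: "G i \<in> bdd_cont_funs Y" for i unfolding G_def by (rule restrict_in_bdd_cont_funs[OF gc gb])
    \<comment> \<open>\<open>norm_bounded_seq\<close> asks for a positive bound; \<open>M\<close>
      may be 0, or even negative when \<open>Y\<close> is empty.\<close>
    have "sup_norm Y (G i) \<le> max M 1" for i
      using gb by (intro sup_norm_le) (auto simp: G_def le_max_iff_disj)
    then have "norm_bounded_seq Y G" unfolding norm_bounded_seq_def using G
      by (intro conjI image_subsetI exI[of _ "max M 1"]) auto
    then obtain f where f: "norm_bounded_seq X f" "\<forall>n. T (f n) = G n"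
      using ib unfolding inversely_bounded_def by blast
    then obtain N where N: "\<forall>n. sup_norm X (f n) \<le> N" "range f \<subseteq> bdd_cont_funs X"
      unfolding norm_bounded_seq_def by blast
    have fb: "f i \<in> bdd_cont_funs X" for i using N(2) by (rule range_subsetD)
    show ?thesis
    proof (intro exI[of _ f] exI[of _ N] allI conjI ballI fb)
      show "\<bar>f i x\<bar> \<le> N" if "x \<in> topspace X" for i x
        using abs_le_sup_norm[OF fb that] N(1) order_trans by blast
      show "T (f i) y = g i y" if "y \<in> topspace Y" for i y using f(2) that by (simp add: G_def)
    qed
  qed
qed

theorem corollary1p5:
  fixes X :: "'a topology" and Y :: "'b topology"
    and DX :: "('a \<Rightarrow> real) set" and DY :: "('b \<Rightarrow> real) set"
    and T :: "('a \<Rightarrow> real) \<Rightarrow> ('b \<Rightarrow> real)"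
  assumes "tychonoff_space X" and "tychonoff_space Y"
    and "metrizable_space X" and "perfectly_normal_space Y"
    and "DX = cont_funs X \<or> DX = bdd_cont_funs X"
    and "DY = cont_funs Y \<or> DY = bdd_cont_funs Y"
    and "uniformly_continuous_p X DX Y DY T"
    and "inversely_bounded X DX Y DY T"
    and "T ` DX = DY"
  shows "(countable_dimensional_space X \<longrightarrow> countable_dimensional_space Y) \<and>
         (strongly_countable_dimensional_space X \<longrightarrow> strongly_countable_dimensional_space Y) \<and>
         (zero_dimensional_space X \<longrightarrow> zero_dimensional_space Y)"
proof -
  interpret inversely_bounded_operator X Y T
    by (rule inversely_bounded_operatorI[OF assms(5-8)])
  have X: "perfectly_normal_space X" using assms(3) by (rule metrizable_imp_perfectly_normal_space)
  show ?thesis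
    using countable_dimensional_image[OF X assms(4)] strongly_countable_dimensional_image[OF X assms(4)]
      zero_dimensional_image[OF X assms(4)] by blast
qed

end
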